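(* Let $g_1,g_2,g,\varepsilon>0$ and assume that $g^2<g_1g_2$. (1) Fix $\lambda_{1,\varepsilon}>0$ and $\lambda_{2,\varepsilon}>0$. Then the positive solution $(\eta_1,\eta_2)$ (both components positive in $\mathbb{R}^2$) of $$-\varepsilon^2\Delta\eta_1+|x|^2\eta_1+g_1\eta_1^3+g\,\eta_1\eta_2^2=\lambda_{1,\varepsilon}\eta_1\quad\text{in }\mathbb{R}^2,$$ $$-\varepsilon^2\Delta\eta_2+|x|^2\eta_2+g_2\eta_2^3+g\,\eta_1^2\eta_2=\lambda_{2,\varepsilon}\eta_2\quad\text{in }\mathbb{R}^2,$$ $$\eta_i(x)\to0\ \text{ as }|x|\to\infty,\quad i=1,2,$$ is unique, if it exists. (2) The positive minimizer $(\eta_{1,\varepsilon},\eta_{2,\varepsilon})$ of $E^0_\varepsilon$ in $\mathcal{H}$ is unique and radially symmetric. Every other minimizer of $E^0_\varepsilon$ in $\mathcal H$ has the form $(e^{i\alpha_1}\eta_{1,\varepsilon},e^{i\alpha_2}\eta_{2,\varepsilon})$, where $\alpha_1,\alpha_2$ are (real) constants. If $g_1=g_2$ then $\eta_{1,\varepsilon}\equiv\eta_{2,\varepsilon}$.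
   Context: The space is $$\mathcal{H}=\Big\{(u_1,u_2):\ u_j\in H^1(\mathbb{R}^2,\mathbb{C}),\ \int_{\mathbb{R}^2}|x|^2|u_j|^2\,dx<\infty,\ \|u_j\|_{L^2(\mathbb{R}^2)}=1,\ j=1,2\Big\},$$ and the energy without rotation is $$E^0_\varepsilon(u_1,u_2)=\sum_{j=1}^2\int_{\mathbb{R}^2}\Big\{\frac{|\nabla u_j|^2}{2}+\frac{|x|^2}{2\varepsilon^2}|u_j|^2+\frac{g_j}{4\varepsilon^2}|u_j|^4\Big\}dx+\frac{g}{2\varepsilon^2}\int_{\mathbb{R}^2}|u_1|^2|u_2|^2\,dx .$$ A positive minimizer is one whose two components are (real and) positive. *)

theory Defs
  imports "HOL-Analysis.Analysis"
begin

section \<open>Classical derivatives\<close>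

definition partial ::
    "'a::euclidean_space \<Rightarrow> ('a \<Rightarrow> 'b::real_normed_vector) \<Rightarrow> 'a \<Rightarrow> 'b" where
  "partial b f = (\<lambda>x. frechet_derivative f (at x) b)"

primrec C_k :: "nat \<Rightarrow> ('a::euclidean_space \<Rightarrow> 'b::real_normed_vector) \<Rightarrow> bool" where
  "C_k 0 f \<longleftrightarrow> continuous_on UNIV f"
| "C_k (Suc k) f \<longleftrightarrow> f differentiable_on UNIV \<and> (\<forall>b\<in>Basis. C_k k (partial b f))"

definition laplacian :: "('a::euclidean_space \<Rightarrow> 'b::real_normed_vector) \<Rightarrow> 'a \<Rightarrow> 'b" where
  "laplacian f x = (\<Sum>b\<in>Basis. partial b (partial b f) x)"


section \<open>Weak derivatives and the Sobolev space\<close>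

text \<open>
  Elements of Lebesgue and Sobolev spaces are represented by Borel functions; statements about
  them are meant, and are formulated below, up to equality almost everywhere.
\<close>

definition test_function :: "('a::euclidean_space \<Rightarrow> real) \<Rightarrow> bool" where
  "test_function \<phi> \<longleftrightarrow> (\<forall>k. C_k k \<phi>) \<and> compact (closure {x. \<phi> x \<noteq> 0})"

definition locally_integrable ::
    "('a::euclidean_space \<Rightarrow> 'b::{banach, second_countable_topology}) \<Rightarrow> bool" where
  "locally_integrable f \<longleftrightarrow> (\<forall>K. compact K \<longrightarrow> set_integrable lborel K f)"

definition has_weak_partial ::
    "'a::euclidean_space \<Rightarrow> ('a \<Rightarrow> 'b::{banach, second_countable_topology}) \<Rightarrow> ('a \<Rightarrow> 'b) \<Rightarrow> bool"
  where
  "has_weak_partial b u v \<longleftrightarrow> locally_integrable u \<and> locally_integrable v \<and>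
     (\<forall>\<phi>. test_function \<phi> \<longrightarrow>
        (LINT x|lborel. partial b \<phi> x *\<^sub>R u x) = - (LINT x|lborel. \<phi> x *\<^sub>R v x))"

text \<open>
  A weak partial derivative is unique up to a null set, so integrals of expressions in
  \<open>weak_partial b u\<close> do not depend on the choice.
\<close>

definition weak_partial ::
    "'a::euclidean_space \<Rightarrow> ('a \<Rightarrow> 'b::{banach, second_countable_topology}) \<Rightarrow> 'a \<Rightarrow> 'b" where
  "weak_partial b u = (SOME v. has_weak_partial b u v)"

definition weak_grad_sq ::
    "('a::euclidean_space \<Rightarrow> 'b::{banach, second_countable_topology}) \<Rightarrow> 'a \<Rightarrow> real" where
  "weak_grad_sq u x = (\<Sum>b\<in>Basis. (norm (weak_partial b u x))\<^sup>2)"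

definition L2 :: "('a::euclidean_space \<Rightarrow> 'b::{banach, second_countable_topology}) set" where
  "L2 = {f \<in> borel_measurable lborel. integrable lborel (\<lambda>x. (norm (f x))\<^sup>2)}"

definition L2_norm :: "('a::euclidean_space \<Rightarrow> 'b::{banach, second_countable_topology}) \<Rightarrow> real" where
  "L2_norm f = sqrt (LINT x|lborel. (norm (f x))\<^sup>2)"

definition H1 :: "('a::euclidean_space \<Rightarrow> 'b::{banach, second_countable_topology}) set" where
  "H1 = {u \<in> L2. \<forall>b\<in>Basis. \<exists>v\<in>L2. has_weak_partial b u v}"


section \<open>The two-component Gross--Pitaevskii problem\<close>

definition H_space :: "((real^2 \<Rightarrow> complex) \<times> (real^2 \<Rightarrow> complex)) set" where
  "H_space = {(u1, u2). \<forall>u\<in>{u1, u2}.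
     u \<in> H1 \<and> integrable lborel (\<lambda>x. (norm x)\<^sup>2 * (norm (u x))\<^sup>2) \<and> L2_norm u = 1}"

text \<open>
  For positive parameters all integrands are nonnegative, hence the energy is taken as an extended
  nonnegative integral; it is finite on \<open>H_space\<close> because $H^1(\mathbb{R}^2)$ embeds in
  $L^4(\mathbb{R}^2)$.
\<close>

definition component_energy :: "real \<Rightarrow> real \<Rightarrow> (real^2 \<Rightarrow> complex) \<Rightarrow> ennreal" where
  "component_energy \<epsilon> a u =
     (\<integral>\<^sup>+ x. ennreal (weak_grad_sq u x / 2 + (norm x)\<^sup>2 / (2 * \<epsilon>\<^sup>2) * (norm (u x))\<^sup>2
                     + a / (4 * \<epsilon>\<^sup>2) * (norm (u x)) ^ 4) \<partial>lborel)"

definition energy ::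
    "real \<Rightarrow> real \<Rightarrow> real \<Rightarrow> real \<Rightarrow> (real^2 \<Rightarrow> complex) \<times> (real^2 \<Rightarrow> complex) \<Rightarrow> ennreal" where
  "energy \<epsilon> g1 g2 g = (\<lambda>(u1, u2).
     component_energy \<epsilon> g1 u1 + component_energy \<epsilon> g2 u2 +
     ennreal (g / (2 * \<epsilon>\<^sup>2)) * (\<integral>\<^sup>+ x. ennreal ((norm (u1 x))\<^sup>2 * (norm (u2 x))\<^sup>2) \<partial>lborel))"

definition minimizer ::
    "real \<Rightarrow> real \<Rightarrow> real \<Rightarrow> real \<Rightarrow> (real^2 \<Rightarrow> complex) \<times> (real^2 \<Rightarrow> complex) \<Rightarrow> bool" where
  "minimizer \<epsilon> g1 g2 g u \<longleftrightarrow>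
     u \<in> H_space \<and> (\<forall>v\<in>H_space. energy \<epsilon> g1 g2 g u \<le> energy \<epsilon> g1 g2 g v)"

definition positive_ae :: "('a::euclidean_space \<Rightarrow> complex) \<Rightarrow> bool" where
  "positive_ae u \<longleftrightarrow> (AE x in lborel. u x \<in> \<real> \<and> 0 < Re (u x))"

definition positive_minimizer ::
    "real \<Rightarrow> real \<Rightarrow> real \<Rightarrow> real \<Rightarrow> (real^2 \<Rightarrow> complex) \<times> (real^2 \<Rightarrow> complex) \<Rightarrow> bool" where
  "positive_minimizer \<epsilon> g1 g2 g u \<longleftrightarrow>
     minimizer \<epsilon> g1 g2 g u \<and> positive_ae (fst u) \<and> positive_ae (snd u)"

definition radial_ae :: "('a::euclidean_space \<Rightarrow> 'b) \<Rightarrow> bool" where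
  "radial_ae u \<longleftrightarrow> (\<exists>f. AE x in lborel. u x = f (norm x))"

definition positive_solution ::
    "real \<Rightarrow> real \<Rightarrow> real \<Rightarrow> real \<Rightarrow> real \<Rightarrow> real \<Rightarrow> (real^2 \<Rightarrow> real) \<times> (real^2 \<Rightarrow> real) \<Rightarrow> bool" where
  "positive_solution \<epsilon> g1 g2 g l1 l2 = (\<lambda>(\<eta>1, \<eta>2).
     C_k 2 \<eta>1 \<and> C_k 2 \<eta>2 \<and>
     (\<forall>x. 0 < \<eta>1 x \<and> 0 < \<eta>2 x) \<and>
     (\<forall>x. - \<epsilon>\<^sup>2 * laplacian \<eta>1 x + (norm x)\<^sup>2 * \<eta>1 x + g1 * \<eta>1 x ^ 3 + g * \<eta>1 x * (\<eta>2 x)\<^sup>2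
            = l1 * \<eta>1 x) \<and>
     (\<forall>x. - \<epsilon>\<^sup>2 * laplacian \<eta>2 x + (norm x)\<^sup>2 * \<eta>2 x + g2 * \<eta>2 x ^ 3 + g * (\<eta>1 x)\<^sup>2 * \<eta>2 x
            = l2 * \<eta>2 x) \<and>
     (\<eta>1 \<longlongrightarrow> 0) at_infinity \<and> (\<eta>2 \<longlongrightarrow> 0) at_infinity)"

end

theory Submission
  imports Defs "HOL-Computational_Algebra.Polynomial"
begin

text \<open>
  Everything rests on one convexity: \<open>|\<nabla>\<surd>\<rho>|\<^sup>2\<close> is convex in the density \<open>\<rho> = |u|\<^sup>2\<close>, and since
  \<open>g\<^sup>2 < g1 * g2\<close> the interaction is a uniformly convex quadratic form in the two densities. The
  Dirichlet energy is the limit of difference quotients, for which convexity is the triangle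
  inequality for the vector \<open>(\<surd>(1 - s) u, \<surd>s v)\<close>, whose norm is the square root of the mixed density.

  Convexity makes the densities of a minimising sequence Cauchy in \<open>L\<^sup>2\<close>; the trap prevents loss of
  mass and Fatou's lemma gives a minimizer. It also makes the moduli of minimizers unique, whence
  the radial symmetry and the symmetry in the components. Positivity and constancy of the phase come
  from the defect in the triangle inequality: it controls the differences of the direction of
  \<open>(\<surd>(1 - s) u, \<surd>s \<phi>)\<close> for a bump \<open>\<phi>\<close>, and as \<open>s \<rightarrow> 0\<close> neither the indicator of \<open>u = 0\<close> nor the phase
  can vary.

  For classical solutions the same convexity enters through Picone's identity with a cutoff.
\<close>

subsection \<open>Test functions\<close>

text \<open>Moduli and mixed moduli are not differentiable at zeros, so a chain rule for gradients
  would be delicate. With difference quotients every convexity statement becomes an identity between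
  vectors at a pair of points, and a real function in \<open>L2\<close> has a weak derivative in
  \<open>L2\<close> exactly when its quotients stay bounded: duality on test functions gives one
  direction, the mean value theorem for shifted test functions the other.

  The defect is weighted by the moduli at the two points, hence says nothing near zeros of u. The
  bump repairs this: the mixed vector has norm at least sqrt s times the bump, so the weight is at
  least of order s, and the energy cost is of order s as well. Integrals of squared differences over
  a step t are therefore O(t^2). For a function with values 0 and 1 the square of a difference is
  its modulus, so T / t steps sum to O(t) and the function is constant. For the phase the same bound
  still allows a Lipschitz-type variation; there the vanishing defect of a minimizer against its own
  modulus enters in addition.\<close>

lemma partial_eq:
  assumes "(f has_derivative f') (at x)"
  shows "partial b f x = f' b"
  using frechet_derivative_at[OF assms] by (simp add: partial_def)

lemma has_derivative_frechet:
  "f differentiable_on UNIV \<Longrightarrow> (f has_derivative frechet_derivative f (at x)) (at x)"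
  by (metis differentiable_on_def frechet_derivative_works iso_tuple_UNIV_I)

lemma differentiable_onI_UNIV:
  "(\<And>x. (f has_derivative f' x) (at x)) \<Longrightarrow> f differentiable_on UNIV"
  unfolding differentiable_on_def differentiable_def by auto

lemma has_vector_derivative_partial:
  fixes f :: "'a::euclidean_space \<Rightarrow> 'b::real_normed_vector"
  assumes "f differentiable_on UNIV"
  shows "((\<lambda>s. f (x + s *\<^sub>R b)) has_vector_derivative partial b f (x + t *\<^sub>R b)) (at t)"
proof -
  let ?D = "frechet_derivative f (at (x + t *\<^sub>R b))"
  have d: "(f has_derivative ?D) (at (x + t *\<^sub>R b))"
    using has_derivative_frechet[OF assms] .
  have "((\<lambda>s. f (x + s *\<^sub>R b)) has_derivative (\<lambda>s. ?D (s *\<^sub>R b))) (at t)"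
    by (rule has_derivative_compose[where g=f and f="\<lambda>s. x + s *\<^sub>R b", OF _ d])
      (auto intro!: derivative_eq_intros)
  moreover have "(\<lambda>s. ?D (s *\<^sub>R b)) = (\<lambda>s. s *\<^sub>R partial b f (x + t *\<^sub>R b))"
    using has_derivative_bounded_linear[OF d]
    by (auto simp: partial_def linear_simps bounded_linear.linear linear_scale)
  ultimately show ?thesis by (simp add: has_vector_derivative_def)
qed

lemma C_k_continuous: "C_k k f \<Longrightarrow> continuous_on UNIV f"
  by (cases k) (auto intro: differentiable_imp_continuous_on)

lemma C_k_SucD: "C_k (Suc k) f \<Longrightarrow> C_k k f"
proof (induction k arbitrary: f)
  case 0
  then show ?case by (simp add: differentiable_imp_continuous_on)
next
  case (Suc k)
  then show ?case by (metis C_k.simps(2))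
qed

lemma C_k_const: "C_k k (\<lambda>x. c)"
proof (induction k arbitrary: c)
  case (Suc k)
  have "partial b (\<lambda>x::'a. c) = (\<lambda>x. 0)" for b :: 'a
    by (auto simp: partial_def)
  then show ?case using Suc[of 0] by (simp add: differentiable_on_def)
qed simp

lemma C_k_add: "C_k k f \<Longrightarrow> C_k k g \<Longrightarrow> C_k k (\<lambda>x. f x + g x)"
proof (induction k arbitrary: f g)
  case 0
  then show ?case by (simp add: continuous_on_add)
next
  case (Suc k)
  have d: "f differentiable_on UNIV" "g differentiable_on UNIV" using Suc.prems by auto
  have "((\<lambda>x. f x + g x) has_derivative
      (\<lambda>h. frechet_derivative f (at x) h + frechet_derivative g (at x) h)) (at x)" for x
    using has_derivative_add[OF d[THEN has_derivative_frechet]] .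
  then have "partial b (\<lambda>x. f x + g x) = (\<lambda>x. partial b f x + partial b g x)" for b
    using partial_eq by (fastforce simp: partial_def)
  then show ?case using Suc d by simp
qed

lemma C_k_sum:
  assumes "\<And>i. i \<in> I \<Longrightarrow> C_k k (f i)"
  shows "C_k k (\<lambda>x. \<Sum>i\<in>I. f i x)"
  using assms by (induction I rule: infinite_finite_induct) (auto simp: C_k_const C_k_add)

lemma partial_mult:
  fixes f g :: "'a::euclidean_space \<Rightarrow> real"
  assumes "f differentiable_on UNIV" "g differentiable_on UNIV"
  shows "partial b (\<lambda>x. f x * g x) = (\<lambda>x. f x * partial b g x + partial b f x * g x)"
proof
  fix x
  have "((\<lambda>x. f x * g x) has_derivative
      (\<lambda>h. f x * frechet_derivative g (at x) h + frechet_derivative f (at x) h * g x)) (at x)"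
    using has_derivative_mult[OF assms[THEN has_derivative_frechet]] .
  then show "partial b (\<lambda>x. f x * g x) x = f x * partial b g x + partial b f x * g x"
    using partial_eq by (fastforce simp: partial_def)
qed

lemma C_k_mult:
  fixes f g :: "'a::euclidean_space \<Rightarrow> real"
  shows "C_k k f \<Longrightarrow> C_k k g \<Longrightarrow> C_k k (\<lambda>x. f x * g x)"
proof (induction k arbitrary: f g)
  case 0
  then show ?case by (simp add: continuous_on_mult)
next
  case (Suc k)
  have d: "f differentiable_on UNIV" "g differentiable_on UNIV" using Suc.prems by auto
  have "(\<lambda>x. f x * g x) differentiable_on UNIV"
    using d by (simp add: differentiable_on_mult)
  moreover have "C_k k (partial b (\<lambda>x. f x * g x))" if "b \<in> Basis" for b
    unfolding partial_mult[OF d]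
    using that Suc.prems C_k_SucD[OF Suc.prems(1)] C_k_SucD[OF Suc.prems(2)]
    by (auto intro!: C_k_add Suc.IH)
  ultimately show ?case by simp
qed

lemma C_k_prod:
  fixes f :: "'i \<Rightarrow> 'a::euclidean_space \<Rightarrow> real"
  assumes "\<And>i. i \<in> I \<Longrightarrow> C_k k (f i)"
  shows "C_k k (\<lambda>x. \<Prod>i\<in>I. f i x)"
  using assms by (induction I rule: infinite_finite_induct) (auto simp: C_k_const C_k_mult)

text \<open>One affine chain rule serves both the translates in the difference quotients and the
  orthogonal maps behind radial symmetry. The sum arises from expanding \<open>A b\<close> in the
  basis.\<close>

lemma partial_compose_affine:
  fixes f :: "'a::euclidean_space \<Rightarrow> real" and A :: "'c::euclidean_space \<Rightarrow> 'a"
  assumes "linear A" "f differentiable_on UNIV"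
  shows "partial b (\<lambda>x. f (a + A x)) = (\<lambda>x. \<Sum>c\<in>Basis. (A b \<bullet> c) * partial c f (a + A x))"
    and "(\<lambda>x. f (a + A x)) differentiable_on UNIV"
proof -
  let ?D = "\<lambda>x. frechet_derivative f (at (a + A x))"
  have d: "(f has_derivative ?D x) (at (a + A x))" for x
    using has_derivative_frechet[OF assms(2)] .
  have "((\<lambda>x. a + A x) has_derivative A) (at x)" for x
    using assms(1) by (auto intro!: derivative_eq_intros bounded_linear_imp_has_derivative
        simp: linear_conv_bounded_linear)
  then have c: "((\<lambda>x. f (a + A x)) has_derivative (\<lambda>h. ?D x (A h))) (at x)" for x
    using has_derivative_compose d by blast
  then show "(\<lambda>x. f (a + A x)) differentiable_on UNIV"
    by (rule differentiable_onI_UNIV)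
  have l: "linear (?D x)" for x
    using d has_derivative_linear by blast
  have "?D x (A b) = (\<Sum>c\<in>Basis. (A b \<bullet> c) * ?D x c)" for x
    by (subst euclidean_representation[of "A b", symmetric])
      (simp add: linear_sum[OF l] linear_scale[OF l] o_def)
  then show "partial b (\<lambda>x. f (a + A x)) = (\<lambda>x. \<Sum>c\<in>Basis. (A b \<bullet> c) * partial c f (a + A x))"
    using partial_eq[OF c] by (auto simp: partial_def)
qed

lemma C_k_compose_affine:
  fixes f :: "'a::euclidean_space \<Rightarrow> real" and A :: "'c::euclidean_space \<Rightarrow> 'a"
  assumes "linear A"
  shows "C_k k f \<Longrightarrow> C_k k (\<lambda>x. f (a + A x))"
proof (induction k arbitrary: f)
  case 0
  have "continuous_on UNIV A"
    using assms linear_continuous_on linear_conv_bounded_linear by blast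
  then show ?case using 0
    by (auto intro!: continuous_on_compose2[of UNIV f] continuous_intros)
next
  case (Suc k)
  then have d: "f differentiable_on UNIV" by auto
  show ?case
    using Suc partial_compose_affine[OF assms d]
    by (auto intro!: C_k_sum C_k_mult C_k_const)
qed

text \<open>Carrying the whole sequence of one-variable derivatives makes the induction over
  \<open>k\<close> work: a partial derivative of the ridge function for \<open>F n\<close> is a
  constant multiple of the one for \<open>F (Suc n)\<close>.\<close>

lemma C_k_smooth_ridge:
  fixes F :: "nat \<Rightarrow> real \<Rightarrow> real" and v :: "'a::euclidean_space"
  assumes F: "\<And>n t. (F n has_real_derivative F (Suc n) t) (at t)"
  shows "C_k k (\<lambda>x. F n (c + v \<bullet> x))"
proof (induction k arbitrary: n)
  case 0
  have "continuous_on UNIV (F n)"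
    using F DERIV_isCont continuous_at_imp_continuous_on by blast
  then show ?case
    by (auto intro!: continuous_on_compose2[of UNIV "F n"] continuous_intros)
next
  case (Suc k)
  have d: "((\<lambda>x. F n (c + v \<bullet> x)) has_derivative (\<lambda>h. (v \<bullet> h) * F (Suc n) (c + v \<bullet> x))) (at x)" for x
  proof -
    have "((\<lambda>x. c + v \<bullet> x) has_derivative (\<lambda>h. v \<bullet> h)) (at x)"
      by (auto intro!: derivative_eq_intros)
    from DERIV_compose_FDERIV[OF F this] show ?thesis .
  qed
  have "partial b (\<lambda>x. F n (c + v \<bullet> x)) = (\<lambda>x. (v \<bullet> b) * F (Suc n) (c + v \<bullet> x))" for b
    using partial_eq[OF d] by auto
  then show ?case
    using Suc differentiable_onI_UNIV[OF d] by (auto intro!: C_k_mult C_k_const)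
qed

section \<open>Functions flat at zero, and bumps supported in boxes\<close>

text \<open>In the variable y = 1 / t, differentiating p(y) exp(- y) with respect to t replaces p by
  y^2 (p - p'). This operator is iterated \<open>n\<close> times.\<close>

definition flat_deriv :: "nat \<Rightarrow> real poly \<Rightarrow> real poly" where
  "flat_deriv n p = ((\<lambda>p. [:0, 0, 1:] * (p - pderiv p)) ^^ n) p"

text \<open>A class closed under differentiation that contains exp(- 1 / t) extended by zero, so
  that smoothness at 0 reduces to a single limit for all orders.\<close>

definition flat :: "real poly \<Rightarrow> real \<Rightarrow> real" where
  "flat p t = (if t > 0 then poly p (1 / t) * exp (- (1 / t)) else 0)"

lemma poly_exp_tendsto_0:
  fixes p :: "real poly"
  shows "((\<lambda>y. poly p y * exp (- y)) \<longlongrightarrow> 0) at_top"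
proof -
  have "((\<lambda>y. \<Sum>i\<le>degree p. coeff p i * (y ^ i / exp y)) \<longlongrightarrow> (\<Sum>i\<le>degree p. coeff p i * 0)) at_top"
    by (intro tendsto_intros tendsto_power_div_exp_0)
  moreover have "(\<Sum>i\<le>degree p. coeff p i * (y ^ i / exp y)) = poly p y * exp (- y)" for y
    by (simp add: poly_altdef exp_minus divide_inverse mult_ac sum_distrib_left)
  ultimately show ?thesis by simp
qed

lemma flat_has_derivative:
  "(flat p has_real_derivative flat ([:0, 0, 1:] * (p - pderiv p)) t) (at t)"
proof (cases t "0::real" rule: linorder_cases)
  case less
  have "((\<lambda>_. 0) has_real_derivative 0) (at t)" by simp
  then have "(flat p has_real_derivative 0) (at t)"
    by (rule DERIV_cong_ev[THEN iffD1, rotated 3, OF _ refl _ refl])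
      (use less in \<open>auto simp: flat_def eventually_nhds intro!: exI[of _ "{..<0}"]\<close>)
  then show ?thesis using less by (simp add: flat_def)
next
  case greater
  have "((\<lambda>t. poly p (1 / t) * exp (- (1 / t))) has_real_derivative
      poly p (1 / t) * (exp (- (1 / t)) * (1 / t^2)) +
      (poly (pderiv p) (1 / t) * - (1 / t^2)) * exp (- (1 / t))) (at t)"
    using greater
    by (auto intro!: derivative_eq_intros DERIV_chain2[OF poly_DERIV] simp: power2_eq_square)
  then have "((\<lambda>t. poly p (1 / t) * exp (- (1 / t))) has_real_derivative
      flat ([:0, 0, 1:] * (p - pderiv p)) t) (at t)"
    using greater by (simp add: flat_def power2_eq_square algebra_simps)
  then show ?thesis
    by (rule DERIV_cong_ev[THEN iffD1, rotated 3, OF _ refl _ refl])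
      (use greater in \<open>auto simp: flat_def eventually_nhds intro!: exI[of _ "{0<..}"]\<close>)
next
  case equal
  \<comment> \<open>Dividing by h multiplies the polynomial by y = 1 / h, so the quotient is again a
    polynomial times exp(- y) and tends to 0.\<close>
  have "((\<lambda>h. flat p h / h) \<longlongrightarrow> 0) (at_right 0)"
  proof -
    have "((\<lambda>y. poly ([:0, 1:] * p) y * exp (- y)) \<longlongrightarrow> 0) at_top"
      by (rule poly_exp_tendsto_0)
    then have "((\<lambda>h. poly ([:0, 1:] * p) (inverse h) * exp (- inverse h)) \<longlongrightarrow> 0) (at_right 0)"
      by (rule filterlim_compose) (rule filterlim_inverse_at_top_right)
    then show ?thesis
      by (rule Lim_transform_eventually)
        (auto simp: eventually_at_filter flat_def field_simps)
  qed
  moreover have "((\<lambda>h. flat p h / h) \<longlongrightarrow> 0) (at_left 0)"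
    by (rule Lim_transform_eventually[OF tendsto_const])
      (auto simp: eventually_at_filter flat_def)
  ultimately have "((\<lambda>h. flat p h / h) \<longlongrightarrow> 0) (at 0)"
    by (simp add: filterlim_at_split)
  then show ?thesis using equal by (simp add: DERIV_def flat_def)
qed

lemma flat_deriv_has_derivative:
  "(flat (flat_deriv n p) has_real_derivative flat (flat_deriv (Suc n) p) t) (at t)"
  unfolding flat_deriv_def using flat_has_derivative by simp

text \<open>For \<open>n > 0\<close> positive exactly on the open box. Large \<open>n\<close> pushes
  every factor towards 1 inside the box, so that indicators of boxes are bounded limits of test
  functions.\<close>

definition bump :: "real \<Rightarrow> 'a::euclidean_space \<Rightarrow> 'a \<Rightarrow> 'a \<Rightarrow> real" where
  "bump n a b x = (\<Prod>c\<in>Basis. flat 1 (n * (x \<bullet> c - a \<bullet> c)) * flat 1 (n * (b \<bullet> c - x \<bullet> c)))"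

lemma flat_1_bounds: "0 \<le> flat 1 t" "flat 1 t \<le> 1" "0 < flat 1 t \<longleftrightarrow> 0 < t"
  by (auto simp: flat_def)

lemma bump_bounds: "0 \<le> bump n a b x" "bump n a b x \<le> 1"
  unfolding bump_def by (auto intro!: prod_nonneg prod_le_1 mult_le_one simp: flat_1_bounds)

lemma bump_pos: "n > 0 \<Longrightarrow> 0 < bump n a b x \<longleftrightarrow> x \<in> box a b"
proof -
  assume n: "n > 0"
  have nz: "flat 1 t \<noteq> 0 \<longleftrightarrow> 0 < t" for t :: real
    using flat_1_bounds[of t] by linarith
  have "0 < bump n a b x \<longleftrightarrow> bump n a b x \<noteq> 0"
    using bump_bounds(1)[of n a b x] by linarith
  also have "\<dots> \<longleftrightarrow> x \<in> box a b"
    using n unfolding bump_def by (auto simp: nz mem_box zero_less_mult_iff)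
  finally show ?thesis .
qed

lemma test_function_bump:
  fixes a b :: "'a::euclidean_space"
  assumes "n > 0"
  shows "test_function (bump n a b)"
  unfolding test_function_def
proof
  have "C_k k (\<lambda>x. flat 1 (n * (x \<bullet> c - a \<bullet> c)))" "C_k k (\<lambda>x. flat 1 (n * (b \<bullet> c - x \<bullet> c)))"
    for k and c :: 'a
    using C_k_smooth_ridge[of "\<lambda>n. flat (flat_deriv n 1)" k 0 "- n * (a \<bullet> c)" "n *\<^sub>R c"]
      C_k_smooth_ridge[of "\<lambda>n. flat (flat_deriv n 1)" k 0 "n * (b \<bullet> c)" "- n *\<^sub>R c"]
      flat_deriv_has_derivative
    by (auto simp: flat_deriv_def algebra_simps inner_commute)
  then show "\<forall>k. C_k k (bump n a b)"
    unfolding bump_def by (auto intro!: C_k_prod C_k_mult)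
  have "{x. bump n a b x \<noteq> 0} \<subseteq> cbox a b"
    using bump_pos[OF assms] bump_bounds(1) box_subset_cbox by (metis (mono_tags) less_eq_real_def mem_Collect_eq subset_iff)
  then show "compact (closure {x. bump n a b x \<noteq> 0})"
    by (simp add: bounded_subset[OF bounded_cbox])
qed

lemma bump_tendsto_indicator:
  "(\<lambda>n. bump (real (Suc n)) a b x) \<longlonglongrightarrow> indicator (box a b) x"
proof -
  have flat_lim: "(\<lambda>n. flat 1 (real (Suc n) * t)) \<longlonglongrightarrow> (if t > 0 then 1 else 0)" for t
  proof (cases "t > 0")
    case True
    have "(\<lambda>n. exp (- (inverse (real (Suc n)) * (1 / t)))) \<longlonglongrightarrow> exp (- (0 * (1 / t)))"
      by (intro tendsto_intros LIMSEQ_inverse_real_of_nat)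
    moreover have "0 < real (Suc n) * t" for n using True by simp
    ultimately show ?thesis using True by (simp add: flat_def field_simps)
  next
    case False
    then have "\<not> 0 < real (Suc n) * t" for n by (simp add: zero_less_mult_iff)
    then show ?thesis using False by (simp add: flat_def)
  qed
  have "(\<lambda>n. bump (real (Suc n)) a b x) \<longlonglongrightarrow> (\<Prod>c\<in>Basis.
      (if x \<bullet> c - a \<bullet> c > 0 then 1 else 0) * (if b \<bullet> c - x \<bullet> c > 0 then 1 else 0))"
    unfolding bump_def by (intro tendsto_intros flat_lim)
  moreover have "(\<Prod>c\<in>Basis. (if x \<bullet> c - a \<bullet> c > 0 then 1 else 0) *
      (if b \<bullet> c - x \<bullet> c > 0 then 1 else (0::real))) = indicator (box a b) x"
    by (cases "x \<in> box a b") (auto simp: mem_box)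
  ultimately show ?thesis by simp
qed

section \<open>Closure properties of test functions\<close>

lemma test_function_add: "test_function f \<Longrightarrow> test_function g \<Longrightarrow> test_function (\<lambda>x. f x + g x)"
proof -
  assume f: "test_function f" and g: "test_function g"
  have "{x. f x + g x \<noteq> 0} \<subseteq> {x. f x \<noteq> 0} \<union> {x. g x \<noteq> 0}" by auto
  then have "compact (closure {x. f x + g x \<noteq> 0})"
    using f g unfolding test_function_def compact_closure by (meson bounded_Un bounded_subset)
  then show ?thesis using f g by (auto simp: test_function_def C_k_add)
qed

lemma test_function_cmult: "test_function f \<Longrightarrow> test_function (\<lambda>x. c * f x)"
proof -
  assume f: "test_function f"
  have "{x. c * f x \<noteq> 0} \<subseteq> {x. f x \<noteq> 0}" by auto
  then have "compact (closure {x. c * f x \<noteq> 0})"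
    using f unfolding test_function_def compact_closure by (meson bounded_subset)
  then show ?thesis using f by (auto simp: test_function_def C_k_mult C_k_const)
qed

lemma test_function_compose_affine:
  fixes f :: "'a::euclidean_space \<Rightarrow> real" and A :: "'a \<Rightarrow> 'a"
  assumes f: "test_function f" and A: "orthogonal_transformation A"
  shows "test_function (\<lambda>x. f (a + A x))"
proof -
  let ?K = "closure {x. f x \<noteq> 0}"
  have l: "linear A" using A orthogonal_transformation_linear by blast
  have K: "compact ?K" using f by (simp add: test_function_def)
  obtain r where r: "\<And>x. x \<in> ?K \<Longrightarrow> norm x \<le> r"
    using compact_imp_bounded[OF K] by (auto simp: bounded_iff)
  have "{x. f (a + A x) \<noteq> 0} \<subseteq> cball 0 (r + norm a)"
  proof
    fix x assume "x \<in> {x. f (a + A x) \<noteq> 0}"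
    then have "norm (a + A x) \<le> r" using r closure_subset[of "{x. f x \<noteq> 0}"] by auto
    moreover have "norm (A x) = norm x" using A by (simp add: orthogonal_transformation_norm)
    moreover have "norm (A x) \<le> norm (a + A x) + norm a"
      by (metis add.commute add_diff_cancel_left' norm_triangle_ineq4)
    ultimately show "x \<in> cball 0 (r + norm a)" by simp
  qed
  then have "compact (closure {x. f (a + A x) \<noteq> 0})"
    by (simp add: bounded_subset[OF bounded_cball])
  then show ?thesis using f C_k_compose_affine[OF l] by (auto simp: test_function_def)
qed

lemma test_function_continuous: "test_function f \<Longrightarrow> continuous_on UNIV f"
  unfolding test_function_def using C_k_continuous by blast

lemma test_function_differentiable: "test_function f \<Longrightarrow> f differentiable_on UNIV"
  unfolding test_function_def by (metis C_k.simps(2))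

lemma test_function_partial_continuous:
  "test_function f \<Longrightarrow> b \<in> Basis \<Longrightarrow> continuous_on UNIV (partial b f)"
  unfolding test_function_def by (metis C_k.simps)

lemma test_function_partial:
  assumes "test_function f" "b \<in> Basis"
  shows "test_function (partial b f)"
proof -
  let ?K = "closure {x. f x \<noteq> 0}"
  have "partial b f x = 0" if "x \<notin> ?K" for x
  proof -
    have "frechet_derivative f (at x) = frechet_derivative (\<lambda>_. 0) (at x)"
      by (rule frechet_derivative_transform_within_open[of f x "- ?K"])
        (use that closure_subset[of "{x. f x \<noteq> 0}"] test_function_differentiable[OF assms(1)]
          in \<open>auto simp: differentiable_on_def\<close>)
    then show ?thesis by (simp add: partial_def)
  qed
  then have "{x. partial b f x \<noteq> 0} \<subseteq> ?K" by auto
  then have "compact (closure {x. partial b f x \<noteq> 0})"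
    using assms(1) unfolding test_function_def compact_closure
    by (meson bounded_closure bounded_subset)
  then show ?thesis
    using assms unfolding test_function_def by (metis C_k.simps(2))
qed

section \<open>Measure-preserving maps and translations\<close>

lemma
  fixes f :: "'a::euclidean_space \<Rightarrow> 'b::{banach, second_countable_topology}" and T :: "'a \<Rightarrow> 'a"
  assumes T: "T \<in> borel_measurable borel" "distr lborel borel T = lborel"
    and f: "integrable lborel f"
  shows integrable_measure_preserving: "integrable lborel (\<lambda>x. f (T x))"
    and integral_measure_preserving: "(LINT x|lborel. f (T x)) = (LINT x|lborel. f x)"
proof -
  have m: "f \<in> borel_measurable borel" "T \<in> lborel \<rightarrow>\<^sub>M borel"
    using f T by (auto dest: borel_measurable_integrable)
  show "integrable lborel (\<lambda>x. f (T x))"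
    using integrable_distr_eq[OF m(2,1)] f unfolding T(2) by simp
  show "(LINT x|lborel. f (T x)) = (LINT x|lborel. f x)"
    using integral_distr[OF m(2,1)] unfolding T(2) by simp
qed

lemma AE_measure_preserving:
  fixes T :: "'a::euclidean_space \<Rightarrow> 'a"
  assumes T: "T \<in> borel_measurable borel" "distr lborel borel T = lborel"
    and P: "AE x in lborel. P x"
  shows "AE x in lborel. P (T x)"
proof -
  have "T \<in> lborel \<rightarrow>\<^sub>M borel" using T by simp
  from AE_distrD[OF this, of P] show ?thesis using P unfolding T(2) by simp
qed

lemma measure_preserving_translation:
  fixes h :: "'a::euclidean_space"
  shows "(\<lambda>x. x + h) \<in> borel_measurable borel" "distr lborel borel (\<lambda>x. x + h) = lborel"
  using lborel_distr_plus[of h] by (auto simp: add.commute[of _ h] cong: distr_cong)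

lemmas integrable_translate = integrable_measure_preserving[OF measure_preserving_translation]
lemmas integral_translate = integral_measure_preserving[OF measure_preserving_translation]
lemmas AE_translate = AE_measure_preserving[OF measure_preserving_translation]

section \<open>The space \<open>L2\<close> and the Cauchy-Schwarz inequality\<close>

lemma power2_norm_add_le:
  fixes x y :: "'b::real_normed_vector"
  shows "(norm (x + y))\<^sup>2 \<le> 2 * (norm x)\<^sup>2 + 2 * (norm y)\<^sup>2"
proof -
  have "(norm (x + y))\<^sup>2 \<le> (norm x + norm y)\<^sup>2"
    by (intro power_mono norm_triangle_ineq norm_ge_zero)
  also have "\<dots> \<le> 2 * (norm x)\<^sup>2 + 2 * (norm y)\<^sup>2"
    using zero_le_power2[of "norm x - norm y"] unfolding power2_sum power2_diff by linarith
  finally show ?thesis .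
qed

lemma L2_measurable: "f \<in> L2 \<Longrightarrow> f \<in> borel_measurable borel"
  and L2_integrable: "f \<in> L2 \<Longrightarrow> integrable lborel (\<lambda>x. (norm (f x))\<^sup>2)"
  by (auto simp: L2_def)

lemma L2_boundI:
  assumes "integrable lborel w" "f \<in> borel_measurable borel" "\<And>x. (norm (f x))\<^sup>2 \<le> w x"
  shows "f \<in> L2"
  unfolding L2_def
  using assms by (auto intro!: Bochner_Integration.integrable_bound[OF assms(1)] AE_I2 order_trans[OF assms(3) abs_ge_self])

lemma L2_add:
  assumes "f \<in> L2" "g \<in> L2" shows "(\<lambda>x. f x + g x) \<in> L2"
  by (rule L2_boundI[of "\<lambda>x. 2 * (norm (f x))\<^sup>2 + 2 * (norm (g x))\<^sup>2"])
    (use assms in \<open>auto intro!: borel_measurable_add power2_norm_add_le simp: L2_measurable L2_integrable\<close>)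

lemma L2_scaleR:
  assumes "f \<in> L2" shows "(\<lambda>x. c *\<^sub>R f x) \<in> L2"
  by (rule L2_boundI[of "\<lambda>x. c\<^sup>2 * (norm (f x))\<^sup>2"])
    (use assms in \<open>auto intro!: borel_measurable_scaleR simp: L2_measurable L2_integrable power_mult_distrib\<close>)

lemma L2_diff:
  assumes "f \<in> L2" "g \<in> L2" shows "(\<lambda>x. f x - g x) \<in> L2"
  using L2_add[OF assms(1) L2_scaleR[OF assms(2), of "-1"]] by simp

lemma L2_measure_preserving:
  fixes f :: "'a::euclidean_space \<Rightarrow> 'b::{banach, second_countable_topology}" and T :: "'a \<Rightarrow> 'a"
  assumes "T \<in> borel_measurable borel" "distr lborel borel T = lborel" "f \<in> L2"
  shows "(\<lambda>x. f (T x)) \<in> L2"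
  using integrable_measure_preserving[OF assms(1,2) L2_integrable[OF assms(3)]]
    L2_measurable[OF assms(3)] assms(1) by (auto simp: L2_def)

lemmas L2_translate = L2_measure_preserving[OF measure_preserving_translation]

lemma integrable_L2_mult:
  fixes f :: "'a::euclidean_space \<Rightarrow> real" and g :: "'a \<Rightarrow> 'b::{banach, second_countable_topology}"
  assumes "f \<in> L2" "g \<in> L2"
  shows "integrable lborel (\<lambda>x. f x *\<^sub>R g x)"
proof (rule Bochner_Integration.integrable_bound)
  show "integrable lborel (\<lambda>x. (norm (f x))\<^sup>2 + (norm (g x))\<^sup>2)"
    using assms[THEN L2_integrable] by (rule Bochner_Integration.integrable_add)
  show "(\<lambda>x. f x *\<^sub>R g x) \<in> borel_measurable lborel"
    using assms[THEN L2_measurable] by simp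
  have "norm (f x *\<^sub>R g x) \<le> norm ((norm (f x))\<^sup>2 + (norm (g x))\<^sup>2)" for x
    using sum_squares_bound[of "\<bar>f x\<bar>" "norm (g x)"]
      mult_nonneg_nonneg[OF abs_ge_zero norm_ge_zero, of "f x" "g x"]
    by (simp only: norm_scaleR real_norm_def power2_abs)
  then show "AE x in lborel. norm (f x *\<^sub>R g x) \<le> norm ((norm (f x))\<^sup>2 + (norm (g x))\<^sup>2)"
    by simp
qed

lemma integral_Cauchy_Schwarz:
  fixes f g :: "'a::euclidean_space \<Rightarrow> real"
  assumes "f \<in> L2" "g \<in> L2"
  shows "(LINT x|lborel. f x * g x)\<^sup>2 \<le> (LINT x|lborel. (f x)\<^sup>2) * (LINT x|lborel. (g x)\<^sup>2)"
proof -
  let ?F = "LINT x|lborel. (f x)\<^sup>2" and ?G = "LINT x|lborel. (g x)\<^sup>2" and ?H = "LINT x|lborel. f x * g x"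
  have i: "integrable lborel (\<lambda>x. (f x)\<^sup>2)" "integrable lborel (\<lambda>x. (g x)\<^sup>2)"
    "integrable lborel (\<lambda>x. f x * g x)"
    using assms L2_integrable integrable_L2_mult[OF assms] by fastforce+
  have q: "0 \<le> s\<^sup>2 * ?F + 2 * (s * t) * ?H + t\<^sup>2 * ?G" for s t
  proof -
    have "0 \<le> (LINT x|lborel. (s * f x + t * g x)\<^sup>2)" by simp
    also have "\<dots> = (LINT x|lborel. s\<^sup>2 * (f x)\<^sup>2 + (2 * (s * t)) * (f x * g x) + t\<^sup>2 * (g x)\<^sup>2)"
      by (intro Bochner_Integration.integral_cong) (auto simp: power2_eq_square algebra_simps)
    also have "\<dots> = s\<^sup>2 * ?F + 2 * (s * t) * ?H + t\<^sup>2 * ?G"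
      using i by simp
    finally show ?thesis .
  qed
  have FG: "0 \<le> ?F" "0 \<le> ?G" by simp_all
  show ?thesis
  proof (cases "?G = 0 \<and> ?F = 0")
    case True
    then have "0 \<le> 2 * ?H" "0 \<le> - (2 * ?H)" using q[of 1 1] q[of 1 "-1"] by auto
    then show ?thesis using True by simp
  next
    case False
    \<comment> \<open>The quadratic form at (G, - H) and at (- H, F). In this case F or G is
      positive and can be cancelled.\<close>
    have "0 \<le> ?G * (?F * ?G - ?H\<^sup>2)" "0 \<le> ?F * (?F * ?G - ?H\<^sup>2)"
      using q[of ?G "- ?H"] q[of "- ?H" ?F] by (auto simp: power2_eq_square algebra_simps)
    then show ?thesis using False FG by (auto simp: zero_le_mult_iff)
  qed
qed

lemma integral_Cauchy_Schwarz':
  fixes f g :: "'a::euclidean_space \<Rightarrow> real"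
  assumes "f \<in> L2" "g \<in> L2"
  shows "\<bar>LINT x|lborel. f x * g x\<bar> \<le> L2_norm f * L2_norm g"
proof -
  have "\<bar>LINT x|lborel. f x * g x\<bar> = sqrt ((LINT x|lborel. f x * g x)\<^sup>2)" by simp
  also have "\<dots> \<le> sqrt ((LINT x|lborel. (f x)\<^sup>2) * (LINT x|lborel. (g x)\<^sup>2))"
    using integral_Cauchy_Schwarz[OF assms] by (rule real_sqrt_le_mono)
  finally show ?thesis by (simp add: L2_norm_def real_sqrt_mult)
qed

lemma L2_norm_power2: "(L2_norm f)\<^sup>2 = (LINT x|lborel. (norm (f x))\<^sup>2)"
  unfolding L2_norm_def by (rule real_sqrt_pow2) simp

lemma L2_norm_nonneg: "0 \<le> L2_norm f"
  unfolding L2_norm_def by simp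

section \<open>Products of locally integrable functions with compactly supported ones\<close>

lemma set_integrable_imp_integrable_mult:
  fixes f :: "'a::euclidean_space \<Rightarrow> 'b::{banach, second_countable_topology}"
  assumes f: "locally_integrable f" and K: "compact K"
    and m: "\<phi> \<in> borel_measurable borel" "\<And>x. \<bar>\<phi> x\<bar> \<le> M" "\<And>x. x \<notin> K \<Longrightarrow> \<phi> x = 0"
  shows "integrable lborel (\<lambda>x. \<phi> x *\<^sub>R f x)"
proof (rule Bochner_Integration.integrable_bound)
  have i: "integrable lborel (\<lambda>x. indicator K x *\<^sub>R f x)"
    using f K by (auto simp: locally_integrable_def set_integrable_def)
  then show "integrable lborel (\<lambda>x. M *\<^sub>R (indicator K x *\<^sub>R f x))"
    by (rule integrable_scaleR_right)
  have e: "(\<lambda>x. \<phi> x *\<^sub>R f x) = (\<lambda>x. \<phi> x *\<^sub>R (indicator K x *\<^sub>R f x))"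
    using m(3) by (force simp: indicator_def)
  show "(\<lambda>x. \<phi> x *\<^sub>R f x) \<in> borel_measurable lborel"
    unfolding e using m(1) borel_measurable_integrable[OF i]
    by (intro borel_measurable_scaleR[of \<phi>]) simp_all
  have "norm (\<phi> x *\<^sub>R f x) \<le> norm (M *\<^sub>R (indicator K x *\<^sub>R f x))" for x
  proof (cases "x \<in> K")
    case True
    have "\<bar>\<phi> x\<bar> \<le> \<bar>M\<bar>" using m(2)[of x] by linarith
    then show ?thesis using True by (simp add: mult_right_mono)
  qed (simp add: m(3))
  then show "AE x in lborel. norm (\<phi> x *\<^sub>R f x) \<le> norm (M *\<^sub>R (indicator K x *\<^sub>R f x))" by simp
qed

lemma continuous_compact_support_bounded:
  fixes \<phi> :: "'a::euclidean_space \<Rightarrow> real"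
  assumes "continuous_on UNIV \<phi>" "compact K" "\<And>x. x \<notin> K \<Longrightarrow> \<phi> x = 0"
  obtains M where "M \<ge> 0" "\<And>x. \<bar>\<phi> x\<bar> \<le> M"
proof -
  have "bounded (\<phi> ` K)"
    using assms(1,2) by (meson compact_continuous_image compact_imp_bounded continuous_on_subset subset_UNIV)
  then obtain M where "\<And>x. x \<in> K \<Longrightarrow> \<bar>\<phi> x\<bar> \<le> M"
    by (auto simp: bounded_iff)
  then have "\<bar>\<phi> x\<bar> \<le> max M 0" for x
    using assms(3)[of x] by (cases "x \<in> K") force+
  then show ?thesis using that[of "max M 0"] by auto
qed

lemma integrable_continuous_mult:
  fixes f :: "'a::euclidean_space \<Rightarrow> 'b::{banach, second_countable_topology}"
  assumes "locally_integrable f" "continuous_on UNIV \<phi>" "compact K" "\<And>x. x \<notin> K \<Longrightarrow> \<phi> x = 0"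
  shows "integrable lborel (\<lambda>x. \<phi> x *\<^sub>R f x)"
proof -
  obtain M where "\<And>x. \<bar>\<phi> x\<bar> \<le> M"
    using continuous_compact_support_bounded[OF assms(2-4)] by metis
  then show ?thesis
    using assms set_integrable_imp_integrable_mult[of f K \<phi> M] borel_measurable_continuous_onI by blast
qed

lemma test_function_support:
  assumes "test_function \<phi>"
  obtains K where "compact K" "\<And>x. x \<notin> K \<Longrightarrow> \<phi> x = 0"
  using assms closure_subset[of "{x. \<phi> x \<noteq> 0}"] unfolding test_function_def by blast

lemma integrable_test_mult:
  fixes f :: "'a::euclidean_space \<Rightarrow> 'b::{banach, second_countable_topology}"
  assumes "locally_integrable f" "test_function \<phi>"
  shows "integrable lborel (\<lambda>x. \<phi> x *\<^sub>R f x)"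
  using test_function_support[OF assms(2)] integrable_continuous_mult[OF assms(1)]
    test_function_continuous[OF assms(2)] by metis

lemma continuous_imp_locally_integrable:
  fixes f :: "'a::euclidean_space \<Rightarrow> 'b::{banach, second_countable_topology}"
  shows "continuous_on UNIV f \<Longrightarrow> locally_integrable f"
  unfolding locally_integrable_def set_integrable_def
  using borel_integrable_compact continuous_on_subset by blast

lemma L2_imp_locally_integrable:
  fixes f :: "'a::euclidean_space \<Rightarrow> 'b::{banach, second_countable_topology}"
  assumes "f \<in> L2"
  shows "locally_integrable f"
  unfolding locally_integrable_def set_integrable_def
proof (intro allI impI)
  fix K :: "'a set" assume K: "compact K"
  have "(\<lambda>x. indicator K x :: real) \<in> L2"
    using emeasure_compact_finite[OF K] borel_compact[OF K]
    by (intro L2_boundI[of "indicator K"]) (auto simp: power2_eq_square indicator_inter_arith[symmetric])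
  from integrable_L2_mult[OF this assms]
  show "integrable lborel (\<lambda>x. indicator K x *\<^sub>R f x)" .
qed

lemma test_function_L2:
  assumes "test_function \<phi>"
  shows "\<phi> \<in> L2"
proof -
  have "locally_integrable \<phi>"
    using test_function_continuous[OF assms] by (rule continuous_imp_locally_integrable)
  from integrable_test_mult[OF this assms] show ?thesis
    using borel_measurable_continuous_onI[OF test_function_continuous[OF assms]]
    by (simp add: L2_def power2_eq_square)
qed

subsection \<open>The fundamental lemma of the calculus of variations\<close>

text \<open>Bumps converge boundedly to indicators of open boxes, so integrals over boxes vanish.
  Boxes form a generating class stable under intersection, which extends this to all Borel sets; a
  function with vanishing integrals over all Borel sets is zero almost everywhere.\<close>

lemma locally_integrable_eq_0_AE:
  fixes f :: "'a::euclidean_space \<Rightarrow> 'b::{banach, second_countable_topology}"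
  assumes f: "locally_integrable f"
    and 0: "\<And>\<phi>. test_function \<phi> \<Longrightarrow> (LINT x|lborel. \<phi> x *\<^sub>R f x) = 0"
  shows "AE x in lborel. f x = 0"
proof -
  have box0: "(LINT x|lborel. indicator (box a b) x *\<^sub>R f x) = 0" for a b
  proof -
    have i: "integrable lborel (\<lambda>x. indicator (cbox a b) x *\<^sub>R f x)"
      using f by (auto simp: locally_integrable_def set_integrable_def)
    have tb: "test_function (bump (real (Suc n)) a b)" for n
      by (rule test_function_bump) simp
    have "(\<lambda>n. LINT x|lborel. bump (real (Suc n)) a b x *\<^sub>R f x) \<longlonglongrightarrow>
        (LINT x|lborel. indicator (box a b) x *\<^sub>R f x)"
    proof (rule integral_dominated_convergence[where w = "\<lambda>x. norm (indicator (cbox a b) x *\<^sub>R f x)"])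
      show "(\<lambda>x. indicator (box a b) x *\<^sub>R f x) \<in> borel_measurable lborel"
      proof -
        have "(\<lambda>x. indicator (box a b) x *\<^sub>R f x) =
            (\<lambda>x. indicator (box a b) x *\<^sub>R (indicator (cbox a b) x *\<^sub>R f x))"
          using box_subset_cbox[of a b] by (force split: split_indicator)
        moreover have "\<dots> \<in> borel_measurable lborel"
          using borel_measurable_integrable[OF i]
          by (intro borel_measurable_scaleR[of "indicator (box a b)"]) simp_all
        ultimately show ?thesis by simp
      qed
      show "(\<lambda>x. bump (real (Suc n)) a b x *\<^sub>R f x) \<in> borel_measurable lborel" for n
        using integrable_test_mult[OF f tb] by (rule borel_measurable_integrable)
      show "AE x in lborel. (\<lambda>n. bump (real (Suc n)) a b x *\<^sub>R f x) \<longlonglongrightarrow> indicator (box a b) x *\<^sub>R f x"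
        by (intro AE_I2 tendsto_intros bump_tendsto_indicator)
      have "norm (bump (real (Suc n)) a b x *\<^sub>R f x) \<le> norm (indicator (cbox a b) x *\<^sub>R f x)" for n x
      proof (cases "x \<in> box a b")
        case True
        then have "x \<in> cbox a b" using box_subset_cbox by blast
        then show ?thesis
          using bump_bounds[of "real (Suc n)" a b x] by (simp add: mult_left_le_one_le)
      next
        case False
        then have "bump (real (Suc n)) a b x = 0"
          using bump_pos[of "real (Suc n)" a b x] bump_bounds(1)[of "real (Suc n)" a b x] by simp
        then show ?thesis by simp
      qed
      then show "AE x in lborel. norm (bump (real (Suc n)) a b x *\<^sub>R f x)
          \<le> norm (indicator (cbox a b) x *\<^sub>R f x)" for n by simp
    qed (rule integrable_norm[OF i])
    then show ?thesis using 0[OF tb] by (simp add: LIMSEQ_const_iff)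
  qed
  have "AE x in lborel. x \<in> box (- real n *\<^sub>R One) (real n *\<^sub>R One) \<longrightarrow> f x = 0" for n
  proof -
    let ?B = "box (- real n *\<^sub>R One) (real n *\<^sub>R One) :: 'a set"
    \<comment> \<open>The function is only locally integrable. Cutting it off to a bounded box makes
      it integrable, and then the sets with zero integral are closed under complements and countable
      disjoint unions.\<close>
    let ?f = "\<lambda>x. indicator ?B x *\<^sub>R f x"
    have "integrable lborel (\<lambda>x. indicator (cbox (- real n *\<^sub>R One) (real n *\<^sub>R One)) x *\<^sub>R f x)"
      using f by (auto simp: locally_integrable_def set_integrable_def)
    then have "integrable lborel (\<lambda>x. indicator ?B x *\<^sub>R
        (indicator (cbox (- real n *\<^sub>R One) (real n *\<^sub>R One)) x *\<^sub>R f x))"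
      by (rule integrable_mult_indicator[rotated]) simp
    moreover have "(\<lambda>x. indicator ?B x *\<^sub>R
        (indicator (cbox (- real n *\<^sub>R One) (real n *\<^sub>R One)) x *\<^sub>R f x)) = ?f"
      using box_subset_cbox[of "- real n *\<^sub>R One" "real n *\<^sub>R One::'a"]
      by (force split: split_indicator)
    ultimately have i: "integrable lborel ?f" by simp
    have si: "set_integrable lborel A ?f" if "A \<in> sets borel" for A
      unfolding set_integrable_def using that integrable_mult_indicator[OF _ i] by simp
    have A: "set_lebesgue_integral lborel A ?f = 0" if "A \<in> sets borel" for A
    proof -
      have "Int_stable (range (\<lambda>(a, b). box a b :: 'a set))"
        by (auto simp: Int_stable_def box_Int_box)
      moreover have "range (\<lambda>(a, b). box a b :: 'a set) \<subseteq> Pow UNIV" by auto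
      moreover have "A \<in> sigma_sets UNIV (range (\<lambda>(a, b). box a b :: 'a set))"
        using that by (subst (asm) borel_eq_box) simp
      ultimately show ?thesis
      proof (induction rule: sigma_sets_induct_disjoint)
        case (basic A)
        then obtain a b where A: "A = box a b" by auto
        obtain c d where "box a b \<inter> ?B = box c d"
          unfolding box_Int_box by blast
        moreover have "(\<lambda>x. indicator (box a b) x *\<^sub>R indicator ?B x *\<^sub>R f x) =
            (\<lambda>x. indicator (box a b \<inter> ?B) x *\<^sub>R f x)"
          by (auto simp: indicator_def)
        ultimately show ?case
          using box0[of c d] by (simp only: A set_lebesgue_integral_def)
      next
        case empty
        then show ?case by (simp add: set_lebesgue_integral_def)
      next
        case (compl A)
        then have Am: "A \<in> sets borel" by (subst borel_eq_box) simp
        have "set_lebesgue_integral lborel (A \<union> (UNIV - A)) ?f =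
            set_lebesgue_integral lborel A ?f + set_lebesgue_integral lborel (UNIV - A) ?f"
          using Am by (intro set_integral_Un si) auto
        moreover have "set_lebesgue_integral lborel (A \<union> (UNIV - A)) ?f = 0"
          using box0 by (simp add: set_lebesgue_integral_def)
        ultimately show ?case using compl by simp
      next
        case (union A)
        then have Am: "A i \<in> sets borel" for i by (subst borel_eq_box) auto
        then have "set_lebesgue_integral lborel (\<Union>i. A i) ?f = (\<Sum>i. set_lebesgue_integral lborel (A i) ?f)"
          using union by (intro lebesgue_integral_countable_add si)
            (auto simp: disjoint_family_on_def)
        then show ?case using union by simp
      qed
    qed
    have "AE x in lborel. ?f x = 0"
      using i A by (intro sigma_finite_measure.density_zero[OF sigma_finite_lborel]) simp_all
    then show ?thesis by (auto simp: indicator_def elim: eventually_mono)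
  qed
  then have ae: "AE x in lborel. \<forall>n. x \<in> box (- real n *\<^sub>R One) (real n *\<^sub>R One) \<longrightarrow> f x = 0"
    unfolding AE_all_countable by blast
  have ex: "\<exists>n. x \<in> box (- real n *\<^sub>R One) (real n *\<^sub>R One)" for x :: 'a
  proof -
    obtain n where "norm x < real n" using reals_Archimedean2 by blast
    then have "\<bar>x \<bullet> i\<bar> < real n" if "i \<in> Basis" for i
      using Basis_le_norm[OF that, of x] by linarith
    then show ?thesis by (intro exI[of _ n]) (auto simp: mem_box abs_less_iff minus_less_iff)
  qed
  show ?thesis using ae by eventually_elim (use ex in blast)
qed

lemma locally_integrable_diff:
  "locally_integrable f \<Longrightarrow> locally_integrable g \<Longrightarrow> locally_integrable (\<lambda>x. f x - g x)"
  unfolding locally_integrable_def by (auto intro: set_integral_diff)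

lemma has_weak_partial_unique:
  fixes u :: "'a::euclidean_space \<Rightarrow> 'b::{banach, second_countable_topology}"
  assumes "has_weak_partial b u v" "has_weak_partial b u v'"
  shows "AE x in lborel. v x = v' x"
proof -
  have v: "locally_integrable v" "locally_integrable v'"
    using assms by (auto simp: has_weak_partial_def)
  have "AE x in lborel. v x - v' x = 0"
  proof (rule locally_integrable_eq_0_AE)
    fix \<phi> :: "'a \<Rightarrow> real" assume \<phi>: "test_function \<phi>"
    have "(LINT x|lborel. \<phi> x *\<^sub>R v x) = (LINT x|lborel. \<phi> x *\<^sub>R v' x)"
      using assms \<phi> unfolding has_weak_partial_def by (metis add.inverse_inverse)
    then show "(LINT x|lborel. \<phi> x *\<^sub>R (v x - v' x)) = 0"
      using integrable_test_mult[OF v(1) \<phi>] integrable_test_mult[OF v(2) \<phi>]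
      by (simp add: scaleR_diff_right)
  qed (rule locally_integrable_diff[OF v])
  then show ?thesis by simp
qed

lemma weak_partial_AE:
  "has_weak_partial b u v \<Longrightarrow> AE x in lborel. weak_partial b u x = v x"
  unfolding weak_partial_def by (metis has_weak_partial_unique someI)

subsection \<open>Difference quotients of compactly supported functions\<close>

text \<open>Assuming differentiability at \<open>s = 0\<close> for every base point is enough: the
  base point is moved along the line. The same form of hypothesis is used below, since only
  derivatives in a single direction are ever integrated.\<close>

lemma dirderiv_at:
  fixes f :: "'a::euclidean_space \<Rightarrow> real"
  assumes "\<And>x. ((\<lambda>s. f (x + s *\<^sub>R b)) has_real_derivative f' x) (at 0)"
  shows "((\<lambda>s. f (x + s *\<^sub>R b)) has_real_derivative f' (x + t *\<^sub>R b)) (at t)"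
proof -
  have *: "((\<lambda>s. f ((x + t *\<^sub>R b) + s *\<^sub>R b)) has_real_derivative f' (x + t *\<^sub>R b)) (at (t - t))"
    using assms[of "x + t *\<^sub>R b"] by simp
  have "((\<lambda>s. s - t) has_real_derivative 1) (at t)"
    by (auto intro!: derivative_eq_intros)
  from DERIV_chain2[of "\<lambda>s. f ((x + t *\<^sub>R b) + s *\<^sub>R b)" _ "\<lambda>s. s - t", OF * this]
  show ?thesis by (simp add: algebra_simps)
qed

lemma dirderiv_difference_bound:
  fixes f :: "'a::euclidean_space \<Rightarrow> real"
  assumes d: "\<And>x. ((\<lambda>s. f (x + s *\<^sub>R b)) has_real_derivative f' x) (at 0)"
    and M: "\<And>x. \<bar>f' x\<bar> \<le> M"
  shows "\<bar>f (x + t *\<^sub>R b) - f x\<bar> \<le> M * \<bar>t\<bar>"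
proof -
  have "norm ((\<lambda>s. f (x + s *\<^sub>R b)) t - (\<lambda>s. f (x + s *\<^sub>R b)) 0) \<le> M * norm (t - 0)"
  proof (rule field_differentiable_bound[of UNIV _ "\<lambda>t. f' (x + t *\<^sub>R b)"])
    show "((\<lambda>s. f (x + s *\<^sub>R b)) has_field_derivative f' (x + s *\<^sub>R b)) (at s within UNIV)" for s
      using dirderiv_at[OF d] by simp
  qed (use M in auto)
  then show ?thesis by simp
qed

lemma dirderiv_support:
  fixes f :: "'a::euclidean_space \<Rightarrow> real"
  assumes d: "\<And>x. ((\<lambda>s. f (x + s *\<^sub>R b)) has_real_derivative f' x) (at 0)"
    and K: "closed K" "\<And>x. x \<notin> K \<Longrightarrow> f x = 0" and x: "x \<notin> K"
  shows "f' x = 0"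
proof -
  have "open ((\<lambda>s. x + s *\<^sub>R b) -` (- K))"
    using K(1) by (intro open_vimage) (auto intro!: continuous_intros)
  moreover have "0 \<in> (\<lambda>s. x + s *\<^sub>R b) -` (- K)" using x by simp
  ultimately have "eventually (\<lambda>s. f (x + s *\<^sub>R b) = 0) (nhds 0)"
    using K(2) by (auto simp: eventually_nhds)
  then have "((\<lambda>s. f (x + s *\<^sub>R b)) has_real_derivative 0) (at 0)"
    by (subst DERIV_cong_ev[OF refl _ refl, of _ "\<lambda>_. 0"]) auto
  then show ?thesis using d[of x] DERIV_unique by blast
qed

text \<open>Dominated convergence: by the mean value theorem the quotients are bounded by a bound
  for \<open>f'\<close>, and for steps below 1 they vanish off one compact set, on which
  \<open>u\<close> is integrable.\<close>

lemma difference_quotient_limit: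
  fixes f :: "'a::euclidean_space \<Rightarrow> real" and u :: "'a \<Rightarrow> 'b::{banach, second_countable_topology}"
  assumes u: "locally_integrable u"
    and d: "\<And>x. ((\<lambda>s. f (x + s *\<^sub>R b)) has_real_derivative f' x) (at 0)"
    and f: "continuous_on UNIV f" "continuous_on UNIV f'"
    and K: "compact K" "\<And>x. x \<notin> K \<Longrightarrow> f x = 0"
    and t: "t \<longlonglongrightarrow> 0" "\<And>n. t n \<noteq> (0::real)"
  shows "(\<lambda>n. LINT x|lborel. ((f (x + t n *\<^sub>R b) - f x) / t n) *\<^sub>R u x)
      \<longlonglongrightarrow> (LINT x|lborel. f' x *\<^sub>R u x)"
proof -
  have f'0: "x \<notin> K \<Longrightarrow> f' x = 0" for x
    using dirderiv_support[OF d compact_imp_closed[OF K(1)] K(2)] .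
  obtain M where M: "M \<ge> 0" "\<And>x. \<bar>f' x\<bar> \<le> M"
    using continuous_compact_support_bounded[OF f(2) K(1) f'0] by blast
  obtain N where N: "\<And>n. n \<ge> N \<Longrightarrow> \<bar>t n\<bar> < 1"
    using t(1) LIMSEQ_D[of t 0 1] by auto
  \<comment> \<open>The support thickened by \<open>norm b\<close> contains every point at which a
    quotient with step below 1 can be nonzero.\<close>
  define K' where "K' = (\<lambda>(x, y). x + y) ` (K \<times> cball 0 (norm b))"
  have K': "compact K'"
    unfolding K'_def
    by (intro compact_continuous_image compact_Times K compact_cball)
      (auto intro!: continuous_intros simp: case_prod_beta)
  have out: "f (x + s *\<^sub>R b) - f x = 0" if "x \<notin> K'" "\<bar>s\<bar> < 1" for x s
  proof -
    have "norm (s *\<^sub>R b) \<le> norm b" "norm (- (s *\<^sub>R b)) \<le> norm b"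
      using that(2) by (simp_all add: mult_left_le_one_le)
    moreover have "x - y \<notin> K" if "norm y \<le> norm b" for y
      using \<open>x \<notin> K'\<close> that imageI[of "(x - y, y)" "K \<times> cball 0 (norm b)" "\<lambda>(x, y). x + y"]
      unfolding K'_def by auto
    ultimately have "x - (- (s *\<^sub>R b)) \<notin> K" "x - 0 \<notin> K"
      using norm_ge_zero norm_zero by metis+
    then have "x + s *\<^sub>R b \<notin> K" "x \<notin> K" by simp_all
    then show ?thesis using K(2) by simp
  qed
  have qb: "\<bar>(f (x + s *\<^sub>R b) - f x) / s\<bar> \<le> M" if "s \<noteq> 0" for x s
    using dirderiv_difference_bound[OF d M(2), of x s] that by (simp add: divide_le_eq abs_mult)
  \<comment> \<open>Shifting the index by \<open>N\<close> makes every step smaller than 1;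
    \<open>LIMSEQ_offset\<close> undoes the shift.\<close>
  let ?q = "\<lambda>n x. ((f (x + t (n + N) *\<^sub>R b) - f x) / t (n + N))"
  have i: "integrable lborel (\<lambda>x. indicator K' x *\<^sub>R u x)"
    using u K' by (auto simp: locally_integrable_def set_integrable_def)
  have qm: "?q n \<in> borel_measurable borel" for n
  proof -
    have "continuous_on UNIV (?q n)"
      using f(1) t(2) by (auto intro!: continuous_intros continuous_on_compose2[of UNIV f])
    then show ?thesis by (rule borel_measurable_continuous_onI)
  qed
  have "(\<lambda>n. LINT x|lborel. ?q n x *\<^sub>R u x) \<longlonglongrightarrow> (LINT x|lborel. f' x *\<^sub>R u x)"
  proof (rule integral_dominated_convergence[where w = "\<lambda>x. M * norm (indicator K' x *\<^sub>R u x)"])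
    show "(\<lambda>x. f' x *\<^sub>R u x) \<in> borel_measurable lborel"
      using integrable_continuous_mult[OF u f(2) K(1) f'0] by (rule borel_measurable_integrable)
    show "(\<lambda>x. ?q n x *\<^sub>R u x) \<in> borel_measurable lborel" for n
      using out N
      by (intro borel_measurable_integrable set_integrable_imp_integrable_mult[OF u K' qm[of n], of M])
        (auto intro: qb[OF t(2)] simp del: abs_divide)
    show "integrable lborel (\<lambda>x. M * norm (indicator K' x *\<^sub>R u x))"
      by (rule integrable_mult_right[OF integrable_norm[OF i]])
    show "AE x in lborel. (\<lambda>n. ?q n x *\<^sub>R u x) \<longlonglongrightarrow> f' x *\<^sub>R u x"
    proof (intro AE_I2 tendsto_scaleR tendsto_const)
      fix x
      have "((\<lambda>s. (f (x + s *\<^sub>R b) - f x) / s) \<longlongrightarrow> f' x) (at 0)"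
        using d[of x] by (simp add: DERIV_def)
      moreover have "filterlim (\<lambda>n. t (n + N)) (at 0) sequentially"
        using t LIMSEQ_ignore_initial_segment[OF t(1), of N] by (simp add: filterlim_at)
      ultimately show "(\<lambda>n. ?q n x) \<longlonglongrightarrow> f' x"
        using filterlim_compose by blast
    qed
    have "norm (?q n x *\<^sub>R u x) \<le> M * norm (indicator K' x *\<^sub>R u x)" for n x
    proof (cases "x \<in> K'")
      case True
      have "norm (?q n x *\<^sub>R u x) = \<bar>?q n x\<bar> * norm (u x)" by (rule norm_scaleR)
      also have "\<dots> \<le> M * norm (u x)"
        by (intro mult_right_mono qb t(2)) simp
      finally show ?thesis using True by simp
    next
      case False
      then show ?thesis using out[OF False, of "t (n + N)"] N[of "n + N"] by simp
    qed
    then show "AE x in lborel. norm (?q n x *\<^sub>R u x) \<le> M * norm (indicator K' x *\<^sub>R u x)" for n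
      by simp
  qed
  then show ?thesis by (rule LIMSEQ_offset)
qed

text \<open>Translation invariance makes the integral of every difference quotient zero, and these
  integrals tend to that of \<open>f'\<close>. Applied to products, this is integration by parts for
  compact supports.\<close>

lemma integral_dirderiv_eq_0:
  fixes f :: "'a::euclidean_space \<Rightarrow> real"
  assumes d: "\<And>x. ((\<lambda>s. f (x + s *\<^sub>R b)) has_real_derivative f' x) (at 0)"
    and f: "continuous_on UNIV f" "continuous_on UNIV f'"
    and K: "compact K" "\<And>x. x \<notin> K \<Longrightarrow> f x = 0"
  shows "(LINT x|lborel. f' x) = 0"
proof -
  let ?t = "\<lambda>n. inverse (real (Suc n))"
  have 1: "locally_integrable (\<lambda>_::'a. 1::real)"
    by (rule continuous_imp_locally_integrable) simp
  have "integrable lborel (\<lambda>x. f x *\<^sub>R (1::real))"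
    using integrable_continuous_mult[OF 1 f(1) K] .
  then have i: "integrable lborel f" by simp
  have "(LINT x|lborel. (f (x + ?t n *\<^sub>R b) - f x) / ?t n) = 0" for n
    using integrable_translate[OF i] integral_translate[OF i] i by simp
  moreover have "(\<lambda>n. LINT x|lborel. ((f (x + ?t n *\<^sub>R b) - f x) / ?t n) *\<^sub>R (1::real))
      \<longlonglongrightarrow> (LINT x|lborel. f' x *\<^sub>R 1)"
    by (rule difference_quotient_limit[OF 1 d f K]) (use LIMSEQ_inverse_real_of_nat in \<open>simp_all add: K(2)\<close>)
  ultimately show ?thesis by (simp add: LIMSEQ_const_iff)
qed

lemma test_function_dirderiv:
  "test_function \<phi> \<Longrightarrow> ((\<lambda>s. \<phi> (x + s *\<^sub>R b)) has_real_derivative partial b \<phi> x) (at 0)"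
  using has_vector_derivative_partial[OF test_function_differentiable, of \<phi> x b 0]
  by (simp add: has_real_derivative_iff_has_vector_derivative)

section \<open>Fatou's lemma, completeness of \<open>L2\<close>, and duality with test
  functions\<close>

text \<open>The bound is a convergent sequence and not a constant because the energies of a
  minimising sequence are bounded only by the infimum plus an error tending to 0.\<close>

lemma Fatou_integrable:
  fixes f :: "nat \<Rightarrow> 'a \<Rightarrow> real"
  assumes f: "\<And>n. integrable M (f n)" "\<And>n x. 0 \<le> f n x"
    and lim: "AE x in M. (\<lambda>n. f n x) \<longlonglongrightarrow> g x" and g: "g \<in> borel_measurable M"
    and C: "\<And>n. (LINT x|M. f n x) \<le> C n" "C \<longlonglongrightarrow> c"
  shows "integrable M g" and "(LINT x|M. g x) \<le> c"
proof -
  have g0: "AE x in M. 0 \<le> g x"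
    using lim by eventually_elim (auto intro: LIMSEQ_le_const f(2))
  have "0 \<le> C n" for n
    using Bochner_Integration.integral_nonneg[of M "f n", OF f(2)] C(1)[of n] by (rule order_trans)
  then have c0: "0 \<le> c" using C(2) by (auto intro: LIMSEQ_le_const)
  have "(\<integral>\<^sup>+x. ennreal (g x) \<partial>M) \<le> (\<integral>\<^sup>+x. liminf (\<lambda>n. ennreal (f n x)) \<partial>M)"
  proof (rule nn_integral_mono_AE)
    show "AE x in M. ennreal (g x) \<le> liminf (\<lambda>n. ennreal (f n x))"
      using lim
    proof eventually_elim
      case (elim x)
      then have "(\<lambda>n. ennreal (f n x)) \<longlonglongrightarrow> ennreal (g x)" by (rule tendsto_ennrealI)
      then show ?case using lim_imp_Liminf[OF sequentially_bot] by fastforce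
    qed
  qed
  also have "\<dots> \<le> liminf (\<lambda>n. \<integral>\<^sup>+x. ennreal (f n x) \<partial>M)"
    using f(1) by (intro nn_integral_liminf) (auto dest: borel_measurable_integrable)
  also have "\<dots> \<le> liminf (\<lambda>n. ennreal (C n))"
  proof (rule Liminf_mono, rule always_eventually, rule allI)
    fix n
    have "(\<integral>\<^sup>+x. ennreal (f n x) \<partial>M) = ennreal (LINT x|M. f n x)"
      using f by (intro nn_integral_eq_integral) auto
    then show "(\<integral>\<^sup>+x. ennreal (f n x) \<partial>M) \<le> ennreal (C n)"
      using C(1) by (simp add: ennreal_leI)
  qed
  also have "\<dots> = ennreal c"
    using tendsto_ennrealI[OF C(2)] by (rule lim_imp_Liminf[OF sequentially_bot])
  finally have b: "(\<integral>\<^sup>+x. ennreal (g x) \<partial>M) \<le> ennreal c" .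
  show i: "integrable M g"
    using b g0 g by (intro integrableI_nonneg) (auto simp: le_less_trans[OF _ ennreal_less_top])
  show "(LINT x|M. g x) \<le> c"
    using b nn_integral_eq_integral[OF i g0] c0 by simp
qed

text \<open>The rate 4^-n pays for the weight 2^n in \<open>h\<close>: the weighted squared
  increments have a finite sum almost everywhere, so the increments are dominated by a geometric
  series and the sequence converges pointwise. Fatou's lemma then carries the rate over to the
  limit.\<close>

lemma L2_complete:
  fixes f :: "nat \<Rightarrow> 'a::euclidean_space \<Rightarrow> real"
  assumes f: "\<And>n. f n \<in> L2"
    and cauchy: "\<And>n m. n \<le> m \<Longrightarrow> (LINT x|lborel. (f m x - f n x)\<^sup>2) \<le> (1/4)^n"
  obtains g where "g \<in> L2" "AE x in lborel. (\<lambda>n. f n x) \<longlonglongrightarrow> g x"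
    "\<And>n. (LINT x|lborel. (g x - f n x)\<^sup>2) \<le> (1/4)^n"
proof -
  define h where "h = (\<lambda>n x. 2 ^ n * (f (Suc n) x - f n x)\<^sup>2)"
  have fm[measurable]: "f n \<in> borel_measurable borel" for n using f L2_measurable by blast
  have di: "integrable lborel (\<lambda>x. (f m x - f n x)\<^sup>2)" for m n
    using L2_integrable[OF L2_diff[OF f[of m] f[of n]]] by simp
  have "(\<integral>\<^sup>+x. ennreal (h n x) \<partial>lborel) \<le> ennreal ((1/2)^n)" for n
  proof -
    have "(\<integral>\<^sup>+x. ennreal (h n x) \<partial>lborel) = ennreal (LINT x|lborel. h n x)"
      using di[of "Suc n" n] by (intro nn_integral_eq_integral) (auto simp: h_def)
    also have "(LINT x|lborel. h n x) \<le> 2 ^ n * (1/4)^n"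
      using cauchy[of n "Suc n"] by (simp add: h_def)
    also have "2 ^ n * (1/4)^n = (1/2::real)^n"
      by (simp flip: power_mult_distrib)
    finally show ?thesis by (simp add: ennreal_leI)
  qed
  then have "(\<Sum>n. \<integral>\<^sup>+x. ennreal (h n x) \<partial>lborel) \<le> (\<Sum>n. ennreal ((1/2)^n))"
    by (intro suminf_le) auto
  also have "\<dots> = ennreal (\<Sum>n. (1/2)^n)"
    by (intro suminf_ennreal2) (auto intro: summable_geometric)
  finally have "(\<integral>\<^sup>+x. (\<Sum>n. ennreal (h n x)) \<partial>lborel) \<noteq> \<infinity>"
    by (subst nn_integral_suminf) (auto simp: h_def top_unique)
  then have "AE x in lborel. (\<Sum>n. ennreal (h n x)) \<noteq> \<infinity>"
    by (intro nn_integral_PInf_AE) (auto simp: h_def)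
  then have conv: "AE x in lborel. convergent (\<lambda>n. f n x)"
  proof eventually_elim
    case (elim x)
    then obtain B where B: "(\<Sum>n. ennreal (h n x)) = ennreal B" "0 \<le> B"
      by (cases "\<Sum>n. ennreal (h n x)") auto
    have hB: "h n x \<le> B" for n
    proof -
      have "ennreal (h n x) \<le> (\<Sum>n. ennreal (h n x))"
        using sum_le_suminf[of "\<lambda>n. ennreal (h n x)" "{n}"] by simp
      then show ?thesis using B by simp
    qed
    have "norm (f (Suc n) x - f n x) \<le> sqrt B * (sqrt (1/2))^n" for n
    proof -
      have "(f (Suc n) x - f n x)\<^sup>2 \<le> B * (1/2)^n"
        using hB[of n] by (simp add: h_def field_simps)
      then have "sqrt ((f (Suc n) x - f n x)\<^sup>2) \<le> sqrt (B * (1/2)^n)"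
        by (rule real_sqrt_le_mono)
      then show ?thesis by (simp only: real_sqrt_abs real_norm_def) (simp add: real_sqrt_mult real_sqrt_power)
    qed
    moreover have "summable (\<lambda>n. sqrt B * (sqrt (1/2))^n)"
    proof (rule summable_mult[OF summable_geometric])
      have "sqrt (1/2) < sqrt 1" by (rule real_sqrt_less_mono) simp
      then show "norm (sqrt (1/2)) < 1" by simp
    qed
    ultimately have "summable (\<lambda>n. f (Suc n) x - f n x)"
      using summable_comparison_test'[of "\<lambda>n. sqrt B * (sqrt (1/2))^n" 0 "\<lambda>n. f (Suc n) x - f n x"]
      by blast
    then have "(\<lambda>n. \<Sum>k<n. f (Suc k) x - f k x) \<longlonglongrightarrow> (\<Sum>n. f (Suc n) x - f n x)"
      by (rule summable_LIMSEQ)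
    then have "(\<lambda>n. f n x - f 0 x) \<longlonglongrightarrow> (\<Sum>n. f (Suc n) x - f n x)"
      by (simp only: sum_lessThan_telescope[of "\<lambda>n. f n x"])
    from tendsto_add[OF this tendsto_const[of "f 0 x"]] show ?case
      by (auto simp: convergent_def)
  qed
  define g where "g = (\<lambda>x. lim (\<lambda>n. f n x))"
  have gm[measurable]: "g \<in> borel_measurable borel"
    unfolding g_def by measurable
  have ae: "AE x in lborel. (\<lambda>n. f n x) \<longlonglongrightarrow> g x"
    using conv by eventually_elim (simp add: g_def convergent_LIMSEQ_iff)
  have F: "integrable lborel (\<lambda>x. (g x - f n x)\<^sup>2)" "(LINT x|lborel. (g x - f n x)\<^sup>2) \<le> (1/4)^n" for n
  proof -
    have *: "AE x in lborel. (\<lambda>k. (f (k + n) x - f n x)\<^sup>2) \<longlonglongrightarrow> (g x - f n x)\<^sup>2"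
      using ae by eventually_elim (intro tendsto_intros LIMSEQ_ignore_initial_segment)
    show "integrable lborel (\<lambda>x. (g x - f n x)\<^sup>2)" "(LINT x|lborel. (g x - f n x)\<^sup>2) \<le> (1/4)^n"
      by (rule Fatou_integrable[OF _ _ *, of "\<lambda>_. (1/4)^n"]; auto intro!: di cauchy)+
  qed
  have "(\<lambda>x. g x - f 0 x) \<in> L2"
    using F(1)[of 0] by (simp add: L2_def)
  from L2_add[OF this f[of 0]] have "g \<in> L2" by simp
  then show ?thesis using that ae F(2) by blast
qed

lemma L2_norm_triangle:
  fixes f g :: "'a::euclidean_space \<Rightarrow> real"
  assumes "f \<in> L2" "g \<in> L2"
  shows "L2_norm (\<lambda>x. f x + g x) \<le> L2_norm f + L2_norm g"
proof (rule power2_le_imp_le)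
  have i: "integrable lborel (\<lambda>x. (f x)\<^sup>2)" "integrable lborel (\<lambda>x. (g x)\<^sup>2)"
    "integrable lborel (\<lambda>x. f x * g x)"
    using assms L2_integrable integrable_L2_mult[OF assms] by fastforce+
  have "(L2_norm (\<lambda>x. f x + g x))\<^sup>2 = (LINT x|lborel. (f x)\<^sup>2 + (g x)\<^sup>2 + 2 * (f x * g x))"
    unfolding L2_norm_power2 by (intro Bochner_Integration.integral_cong) (auto simp: power2_sum)
  also have "\<dots> = (LINT x|lborel. (f x)\<^sup>2) + (LINT x|lborel. (g x)\<^sup>2) + 2 * (LINT x|lborel. f x * g x)"
    using i by simp
  also have "\<dots> \<le> (L2_norm f + L2_norm g)\<^sup>2"
    using integral_Cauchy_Schwarz'[OF assms] L2_norm_power2[of f] L2_norm_power2[of g]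
    by (simp add: power2_sum)
  finally show "(L2_norm (\<lambda>x. f x + g x))\<^sup>2 \<le> (L2_norm f + L2_norm g)\<^sup>2" .
qed (simp add: L2_norm_nonneg)

text \<open>The representing function is the limit of a minimising sequence of
  \<open>\<phi> \<mapsto> \<parallel>\<phi>\<parallel>\<^sup>2 / 2 - l \<phi>\<close> over test functions, which is Cauchy by the parallelogram identity.\<close>

lemma Riesz_test_functions:
  fixes l :: "('a::euclidean_space \<Rightarrow> real) \<Rightarrow> real"
  assumes lin: "\<And>\<phi> \<psi> c. test_function \<phi> \<Longrightarrow> test_function \<psi> \<Longrightarrow> l (\<lambda>x. \<phi> x + c * \<psi> x) = l \<phi> + c * l \<psi>"
    and bound: "\<And>\<phi>. test_function \<phi> \<Longrightarrow> \<bar>l \<phi>\<bar> \<le> M * L2_norm \<phi>" and M: "0 \<le> M"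
  obtains v where "v \<in> L2" "L2_norm v \<le> M"
    "\<And>\<phi>. test_function \<phi> \<Longrightarrow> l \<phi> = (LINT x|lborel. \<phi> x * v x)"
proof -
  define J where "J = (\<lambda>\<phi>. (LINT x|lborel. (\<phi> x)\<^sup>2) / 2 - l \<phi>)"
  define i where "i = (INF \<phi>\<in>Collect test_function. J \<phi>)"
  have tL2: "\<phi> \<in> L2" if "test_function \<phi>" for \<phi> :: "'a \<Rightarrow> real" using that by (rule test_function_L2)
  have t0: "test_function (\<lambda>_::'a. 0::real)"
    by (simp add: test_function_def C_k_const)
  have tlin: "test_function (\<lambda>x. \<phi> x + c * \<psi> x)" if "test_function \<phi>" "test_function \<psi>" for \<phi> \<psi> :: "'a \<Rightarrow> real" and c
    using that by (intro test_function_add test_function_cmult)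
  have Jlow: "- M\<^sup>2 / 2 \<le> J \<phi>" if "test_function \<phi>" for \<phi>
  proof -
    have "0 \<le> (L2_norm \<phi> - M)\<^sup>2 / 2" by simp
    also have "\<dots> = (LINT x|lborel. (\<phi> x)\<^sup>2) / 2 - M * L2_norm \<phi> + M\<^sup>2 / 2"
      using L2_norm_power2[of \<phi>] by (simp add: power2_diff field_simps)
    finally show ?thesis using bound[OF that] unfolding J_def by linarith
  qed
  then have bdd: "bdd_below (J ` Collect test_function)" by (auto intro!: bdd_belowI2)
  have iJ: "i \<le> J \<phi>" if "test_function \<phi>" for \<phi>
    unfolding i_def using bdd that by (auto intro: cINF_lower)
  have expand: "J (\<lambda>x. \<phi> x + c * \<psi> x) = J \<phi> + c * ((LINT x|lborel. \<phi> x * \<psi> x) - l \<psi>) + c\<^sup>2 / 2 * (LINT x|lborel. (\<psi> x)\<^sup>2)"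
    if "test_function \<phi>" "test_function \<psi>" for \<phi> \<psi> c
  proof -
    have *: "integrable lborel (\<lambda>x. (\<phi> x)\<^sup>2)" "integrable lborel (\<lambda>x. (\<psi> x)\<^sup>2)" "integrable lborel (\<lambda>x. \<phi> x * \<psi> x)"
      using that[THEN tL2] L2_integrable integrable_L2_mult[of \<phi> \<psi>] by fastforce+
    have "(LINT x|lborel. (\<phi> x + c * \<psi> x)\<^sup>2) = (LINT x|lborel. (\<phi> x)\<^sup>2 + (2 * c) * (\<phi> x * \<psi> x) + c\<^sup>2 * (\<psi> x)\<^sup>2)"
      by (intro Bochner_Integration.integral_cong) (auto simp: power2_eq_square algebra_simps)
    also have "\<dots> = (LINT x|lborel. (\<phi> x)\<^sup>2) + 2 * c * (LINT x|lborel. \<phi> x * \<psi> x) + c\<^sup>2 * (LINT x|lborel. (\<psi> x)\<^sup>2)"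
      using * by simp
    finally show ?thesis unfolding J_def lin[OF that] by (simp add: field_simps)
  qed
  \<comment> \<open>The value of \<open>J\<close> at a midpoint is the mean of the two values minus
    one eighth of the squared distance. Hence an error of (1/4)^n / 8 above the infimum yields a
    squared distance of at most (1/4)^n.\<close>
  have "\<exists>\<phi>. test_function \<phi> \<and> J \<phi> < i + (1/4)^n / 8" for n
  proof -
    have "i < i + (1/4)^n / 8" by simp
    then show ?thesis unfolding i_def using cINF_less_iff[OF _ bdd] t0 by blast
  qed
  then obtain \<phi> where \<phi>: "\<And>n. test_function (\<phi> n)" "\<And>n. J (\<phi> n) < i + (1/4)^n / 8"
    by metis
  have cauchy: "(LINT x|lborel. (\<phi> m x - \<phi> n x)\<^sup>2) \<le> (1/4)^n" if "n \<le> m" for n m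
  proof -
    let ?d = "\<lambda>x. \<phi> m x + (-1) * \<phi> n x"
    have td: "test_function ?d" using \<phi>(1) by (intro tlin)
    have "J (\<lambda>x. \<phi> n x + (1/2) * ?d x) = J (\<phi> n) + 1/2 * ((LINT x|lborel. \<phi> n x * ?d x) - l ?d) + 1/8 * (LINT x|lborel. (?d x)\<^sup>2)"
      using expand[OF \<phi>(1) td, of n "1/2"] by (simp add: power2_eq_square)
    moreover have "J (\<lambda>x. \<phi> n x + 1 * ?d x) = J (\<phi> n) + ((LINT x|lborel. \<phi> n x * ?d x) - l ?d) + 1/2 * (LINT x|lborel. (?d x)\<^sup>2)"
      using expand[OF \<phi>(1) td, of n 1] by simp
    moreover have "J (\<lambda>x. \<phi> n x + 1 * ?d x) = J (\<phi> m)" by simp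
    moreover have "i \<le> J (\<lambda>x. \<phi> n x + (1/2) * ?d x)" using \<phi>(1) td by (intro iJ tlin)
    moreover have "(1/4::real)^m \<le> (1/4)^n" using that by (intro power_decreasing) auto
    ultimately have "(LINT x|lborel. (?d x)\<^sup>2) \<le> (1/4)^n"
      using \<phi>(2)[of m] \<phi>(2)[of n] by argo
    then show ?thesis by simp
  qed
  obtain v where v: "v \<in> L2" "\<And>n. (LINT x|lborel. (v x - \<phi> n x)\<^sup>2) \<le> (1/4)^n"
    using L2_complete[of \<phi>, OF tL2[OF \<phi>(1)] cauchy] by metis
  have diff: "(\<lambda>x. v x - \<phi> n x) \<in> L2" "L2_norm (\<lambda>x. v x - \<phi> n x) \<le> (1/2)^n" for n
  proof -
    show "(\<lambda>x. v x - \<phi> n x) \<in> L2" using v(1) tL2[OF \<phi>(1)] by (rule L2_diff)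
    have "sqrt ((1/4)^n) = ((1/2)^n :: real)"
    proof (rule real_sqrt_unique)
      show "((1/2)^n)\<^sup>2 = (1/4::real)^n" by (simp add: power_mult[symmetric] mult.commute[of n 2]) (simp add: power_mult power2_eq_square)
    qed simp
    then show "L2_norm (\<lambda>x. v x - \<phi> n x) \<le> (1/2)^n"
      using real_sqrt_le_mono[OF v(2)[of n]] by (simp add: L2_norm_def)
  qed
  have p0: "(\<lambda>n. (1/2::real)^n) \<longlonglongrightarrow> 0" by (rule LIMSEQ_power_zero) simp
  have lim: "(\<lambda>n. LINT x|lborel. \<phi> n x * f x) \<longlonglongrightarrow> (LINT x|lborel. v x * f x)" if f: "f \<in> L2" for f
  proof (rule Lim_null_comparison[THEN LIM_zero_cancel])
    show "(\<lambda>n. (1/2)^n * L2_norm f) \<longlonglongrightarrow> 0" using tendsto_mult_left_zero[OF p0] .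
    show "\<forall>\<^sub>F n in sequentially. norm ((LINT x|lborel. \<phi> n x * f x) - (LINT x|lborel. v x * f x)) \<le> (1/2)^n * L2_norm f"
    proof (intro always_eventually allI)
      fix n
      have "(LINT x|lborel. \<phi> n x * f x) - (LINT x|lborel. v x * f x) = - (LINT x|lborel. (v x - \<phi> n x) * f x)"
        using integrable_L2_mult[OF tL2[OF \<phi>(1)] f, of n] integrable_L2_mult[OF v(1) f]
        by (simp add: left_diff_distrib)
      also have "\<bar>\<dots>\<bar> \<le> L2_norm (\<lambda>x. v x - \<phi> n x) * L2_norm f"
        using integral_Cauchy_Schwarz'[OF diff(1) f] by simp
      also have "\<dots> \<le> (1/2)^n * L2_norm f"
        by (intro mult_right_mono diff(2) L2_norm_nonneg)
      finally show "norm ((LINT x|lborel. \<phi> n x * f x) - (LINT x|lborel. v x * f x)) \<le> (1/2)^n * L2_norm f"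
        by simp
    qed
  qed
  have rep: "l \<psi> = (LINT x|lborel. \<psi> x * v x)" if \<psi>: "test_function \<psi>" for \<psi>
  proof -
    define N where "N = (LINT x|lborel. (\<psi> x)\<^sup>2)"
    define d where "d = (LINT x|lborel. v x * \<psi> x) - l \<psi>"
    \<comment> \<open>First variation: moving from the near-minimisers by a multiple
      \<open>c\<close> of \<open>\<psi>\<close> cannot go below the infimum, so the derivative
      \<open>d\<close> of \<open>J\<close> at the limit has to vanish.\<close>
    have "0 \<le> c * d + c\<^sup>2 / 2 * N" for c
    proof -
      have "(\<lambda>n. (1/4)^n / 8 + c * ((LINT x|lborel. \<phi> n x * \<psi> x) - l \<psi>) + c\<^sup>2 / 2 * N)
          \<longlonglongrightarrow> 0 / 8 + c * d + c\<^sup>2 / 2 * N"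
        unfolding d_def by (intro tendsto_intros lim tL2 \<psi> LIMSEQ_power_zero) auto
      moreover have "0 \<le> (1/4)^n / 8 + c * ((LINT x|lborel. \<phi> n x * \<psi> x) - l \<psi>) + c\<^sup>2 / 2 * N" for n
        using iJ[OF tlin[OF \<phi>(1)[of n] \<psi>, of c]] expand[OF \<phi>(1)[of n] \<psi>, of c] \<phi>(2)[of n]
        unfolding N_def by linarith
      ultimately show ?thesis by (auto intro: LIMSEQ_le_const)
    qed
    \<comment> \<open>Almost the optimal step; the summand 1 keeps it meaningful when
      \<open>N = 0\<close>.\<close>
    from this[of "- d / (N + 1)"] have "0 \<le> - (d\<^sup>2 / (N + 1)) + d\<^sup>2 / (N + 1) * (N / (N + 1)) / 2"
      by (simp add: power2_eq_square)
    moreover define X r where "X = d\<^sup>2 / (N + 1)" and "r = N / (N + 1)"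
    ultimately have "0 \<le> - X + X * r / 2" by simp
    moreover have N: "0 \<le> N" by (simp add: N_def)
    then have "X * r \<le> X * 1"
      unfolding X_def r_def by (intro mult_left_mono) auto
    ultimately have "d\<^sup>2 / (N + 1) \<le> 0" unfolding X_def[symmetric] by linarith
    then have "d = 0" using N by (simp add: divide_le_0_iff)
    then show ?thesis by (simp add: d_def mult.commute)
  qed
  \<comment> \<open>The bound is tested on \<open>\<phi> n\<close>, which tends to \<open>v\<close>
    in L^2; in the limit it says that the square of \<open>L2_norm v\<close> is at most
    \<open>M * L2_norm v\<close>.\<close>
  have "L2_norm v \<le> M"
  proof -
    have nb: "L2_norm (\<phi> n) \<le> L2_norm v + (1/2)^n" for n
    proof -
      have "L2_norm (\<phi> n) \<le> L2_norm v + L2_norm (\<lambda>x. - 1 *\<^sub>R (v x - \<phi> n x))"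
        using L2_norm_triangle[OF v(1) L2_scaleR[OF diff(1), of "-1" n]] by simp
      also have "L2_norm (\<lambda>x. - 1 *\<^sub>R (v x - \<phi> n x)) = L2_norm (\<lambda>x. v x - \<phi> n x)"
        by (simp add: L2_norm_def power2_commute)
      finally show ?thesis using diff(2)[of n] by linarith
    qed
    have "(LINT x|lborel. v x * v x) \<le> M * (L2_norm v + 0)"
    proof (rule LIMSEQ_le[OF lim[OF v(1)]])
      show "(\<lambda>n. M * (L2_norm v + (1/2)^n)) \<longlonglongrightarrow> M * (L2_norm v + 0)"
        by (intro tendsto_intros p0)
      have "(LINT x|lborel. \<phi> n x * v x) \<le> M * (L2_norm v + (1/2)^n)" for n
        using bound[OF \<phi>(1)[of n]] rep[OF \<phi>(1)[of n]] mult_left_mono[OF nb[of n] M] by linarith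
      then show "\<exists>N. \<forall>n\<ge>N. (LINT x|lborel. \<phi> n x * v x) \<le> M * (L2_norm v + (1/2)^n)" by blast
    qed
    then have "L2_norm v * L2_norm v \<le> M * L2_norm v"
      using L2_norm_power2[of v] by (simp add: power2_eq_square)
    then show ?thesis
      using L2_norm_nonneg[of v] M by (cases "L2_norm v = 0") auto
  qed
  then show ?thesis using that v(1) rep by blast
qed

subsection \<open>Difference quotients and weak derivatives\<close>

text \<open>Discrete integration by parts: it moves a difference quotient from the test function to
  \<open>u\<close>.\<close>

lemma integral_translate_mult:
  fixes f g :: "'a::euclidean_space \<Rightarrow> real"
  assumes "f \<in> L2" "g \<in> L2"
  shows "(LINT x|lborel. f (x - h) * g x) = (LINT x|lborel. f x * g (x + h))"
proof -
  have "integrable lborel (\<lambda>x. f (x + - h) *\<^sub>R g x)"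
    using assms by (intro integrable_L2_mult L2_translate)
  note integral_translate[OF this, of h]
  then show ?thesis
    by (simp only: add_diff_cancel_right' real_scaleR_def diff_conv_add_uminus[symmetric])
qed

text \<open>The functional that defines the weak derivative is a limit of integrals of
  \<open>\<phi>\<close> against difference quotients of \<open>u\<close>, hence bounded by
  \<open>M\<close> times the L^2 norm of \<open>\<phi>\<close>, and Riesz represents it. A bound
  along one sequence of steps is enough; the later argument by contradiction provides no
  more.\<close>

lemma weak_partial_of_difference_quotients:
  fixes u :: "'a::euclidean_space \<Rightarrow> real"
  assumes u: "u \<in> L2" and b: "b \<in> Basis" and M: "0 \<le> M"
    and t: "t \<longlonglongrightarrow> 0" "\<And>n. t n \<noteq> 0"
    and bound: "\<And>n. (LINT x|lborel. (u (x + t n *\<^sub>R b) - u x)\<^sup>2) \<le> M\<^sup>2 * (t n)\<^sup>2"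
  obtains v where "v \<in> L2" "has_weak_partial b u v" "L2_norm v \<le> M"
proof -
  define l where "l = (\<lambda>\<phi>. - (LINT x|lborel. partial b \<phi> x * u x))"
  have lu: "locally_integrable u" using u by (rule L2_imp_locally_integrable)
  have pi: "integrable lborel (\<lambda>x. partial b \<phi> x * u x)" if "test_function \<phi>" for \<phi>
    using integrable_test_mult[OF lu test_function_partial[OF that b]] by simp
  have "l (\<lambda>x. \<phi> x + c * \<psi> x) = l \<phi> + c * l \<psi>" if "test_function \<phi>" "test_function \<psi>" for \<phi> \<psi> c
  proof -
    have "((\<lambda>x. \<phi> x + c * \<psi> x) has_derivative
        (\<lambda>h. frechet_derivative \<phi> (at x) h + c * frechet_derivative \<psi> (at x) h)) (at x)" for x
      using that by (intro has_derivative_add has_derivative_mult_right has_derivative_frechet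
          test_function_differentiable)
    from partial_eq[OF this, of b]
    have "partial b (\<lambda>x. \<phi> x + c * \<psi> x) x = partial b \<phi> x + c * partial b \<psi> x" for x
      by (simp add: partial_def)
    then show ?thesis
      using that[THEN pi] by (simp add: l_def algebra_simps)
  qed
  moreover have "\<bar>l \<phi>\<bar> \<le> M * L2_norm \<phi>" if \<phi>: "test_function \<phi>" for \<phi>
  proof -
    obtain K where K: "compact K" "\<And>x. x \<notin> K \<Longrightarrow> \<phi> x = 0"
      using test_function_support[OF \<phi>] by blast
    \<comment> \<open>Backward steps on the test function become forward steps on \<open>u\<close>,
      for which the bound is assumed.\<close>
    have "(\<lambda>n. LINT x|lborel. ((\<phi> (x + (- t n) *\<^sub>R b) - \<phi> x) / (- t n)) *\<^sub>R u x)
        \<longlonglongrightarrow> (LINT x|lborel. partial b \<phi> x *\<^sub>R u x)"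
      using t by (intro difference_quotient_limit[OF lu test_function_dirderiv[OF \<phi>] _ _ K]
          test_function_continuous test_function_partial_continuous \<phi> b)
        (auto intro: tendsto_eq_intros)
    then have "(\<lambda>n. \<bar>LINT x|lborel. ((\<phi> (x + (- t n) *\<^sub>R b) - \<phi> x) / (- t n)) *\<^sub>R u x\<bar>) \<longlonglongrightarrow> \<bar>l \<phi>\<bar>"
      unfolding l_def abs_minus_cancel real_scaleR_def by (rule tendsto_rabs)
    moreover have "\<bar>LINT x|lborel. ((\<phi> (x + (- t n) *\<^sub>R b) - \<phi> x) / (- t n)) *\<^sub>R u x\<bar> \<le> M * L2_norm \<phi>" for n
    proof -
      let ?h = "t n *\<^sub>R b"
      have \<phi>2: "\<phi> \<in> L2" using \<phi> by (rule test_function_L2)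
      have i: "integrable lborel (\<lambda>x. \<phi> (x - ?h) * u x)" "integrable lborel (\<lambda>x. \<phi> x * u x)"
        "integrable lborel (\<lambda>x. \<phi> x * u (x + ?h))"
        using integrable_L2_mult[OF L2_translate[OF \<phi>2] u, of "- ?h"] integrable_L2_mult[OF \<phi>2 u]
          integrable_L2_mult[OF \<phi>2 L2_translate[OF u], of ?h] by simp_all
      have "(LINT x|lborel. ((\<phi> (x + (- t n) *\<^sub>R b) - \<phi> x) / (- t n)) *\<^sub>R u x)
          = (LINT x|lborel. (\<phi> (x - ?h) * u x - \<phi> x * u x) / (- t n))"
        by (intro Bochner_Integration.integral_cong) (auto simp: left_diff_distrib)
      also have "\<dots> = ((LINT x|lborel. \<phi> (x - ?h) * u x) - (LINT x|lborel. \<phi> x * u x)) / (- t n)"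
        using i by simp
      also have "(LINT x|lborel. \<phi> (x - ?h) * u x) = (LINT x|lborel. \<phi> x * u (x + ?h))"
        by (rule integral_translate_mult[OF \<phi>2 u])
      also have "\<dots> - (LINT x|lborel. \<phi> x * u x) = (LINT x|lborel. \<phi> x * (u (x + ?h) - u x))"
        using i by (simp add: right_diff_distrib)
      finally have "\<bar>LINT x|lborel. ((\<phi> (x + (- t n) *\<^sub>R b) - \<phi> x) / (- t n)) *\<^sub>R u x\<bar>
          = \<bar>LINT x|lborel. \<phi> x * (u (x + ?h) - u x)\<bar> / \<bar>t n\<bar>"
        using t(2)[of n] by (simp add: abs_divide)
      also have "\<dots> \<le> (L2_norm \<phi> * L2_norm (\<lambda>x. u (x + ?h) - u x)) / \<bar>t n\<bar>"
        by (intro divide_right_mono integral_Cauchy_Schwarz' \<phi>2 L2_diff L2_translate u) simp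
      also have "\<dots> \<le> (L2_norm \<phi> * (M * \<bar>t n\<bar>)) / \<bar>t n\<bar>"
      proof (intro divide_right_mono mult_left_mono L2_norm_nonneg)
        have "sqrt (LINT x|lborel. (u (x + ?h) - u x)\<^sup>2) \<le> sqrt (M\<^sup>2 * (t n)\<^sup>2)"
          using bound by (rule real_sqrt_le_mono)
        then show "L2_norm (\<lambda>x. u (x + ?h) - u x) \<le> M * \<bar>t n\<bar>"
          using M by (simp add: L2_norm_def real_sqrt_mult)
      qed simp
      finally show ?thesis using t(2)[of n] by (simp add: mult.commute)
    qed
    ultimately show ?thesis by (auto intro: LIMSEQ_le_const2)
  qed
  ultimately obtain v where v: "v \<in> L2" "L2_norm v \<le> M"
    "\<And>\<phi>. test_function \<phi> \<Longrightarrow> l \<phi> = (LINT x|lborel. \<phi> x * v x)"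
    using Riesz_test_functions[of l M] M by metis
  have "has_weak_partial b u v"
    using v lu L2_imp_locally_integrable[OF v(1)] by (simp add: has_weak_partial_def l_def minus_equation_iff)
  then show ?thesis using that v by blast
qed

text \<open>Tested with \<open>\<phi>\<close>, the difference of \<open>u\<close> is the change over
  [0, t] of \<open>G s\<close>, the integral of \<open>u\<close> against \<open>\<phi>\<close>
  shifted by \<open>s *\<^sub>R b\<close>. The derivative of \<open>G\<close> is \<open>v\<close>
  tested with the shifted function, bounded through Cauchy-Schwarz uniformly in \<open>s\<close>.
  The mean value theorem and duality turn this into a bound on the L^2 norm.\<close>

lemma difference_bound_of_weak_partial:
  fixes u v :: "'a::euclidean_space \<Rightarrow> real"
  assumes u: "u \<in> L2" and v: "v \<in> L2" and w: "has_weak_partial b u v" and b: "b \<in> Basis"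
  shows "(LINT x|lborel. (u (x + t *\<^sub>R b) - u x)\<^sup>2) \<le> t\<^sup>2 * (LINT x|lborel. (v x)\<^sup>2)"
proof -
  let ?w = "\<lambda>x. u (x + t *\<^sub>R b) - u x"
  have wL2: "?w \<in> L2" using u by (intro L2_diff L2_translate)
  have lu: "locally_integrable u" using u by (rule L2_imp_locally_integrable)
  have bound: "\<bar>LINT x|lborel. \<phi> x * ?w x\<bar> \<le> (\<bar>t\<bar> * L2_norm v) * L2_norm \<phi>"
    if \<phi>: "test_function \<phi>" for \<phi>
  proof -
    define \<phi>s where "\<phi>s = (\<lambda>s x. \<phi> (- (s *\<^sub>R b) + id x))"
    have ts: "test_function (\<phi>s s)" for s
      unfolding \<phi>s_def using \<phi> by (rule test_function_compose_affine) (simp add: orthogonal_transformation_id)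
    have \<phi>2: "\<phi> \<in> L2" using \<phi> by (rule test_function_L2)
    define G where "G = (\<lambda>s. LINT x|lborel. \<phi>s s x * u x)"
    have i: "integrable lborel (\<lambda>x. \<phi>s s x * u x)" for s
      using integrable_test_mult[OF lu ts] by simp
    have dG: "(G has_real_derivative - (LINT x|lborel. partial b (\<phi>s s) x * u x)) (at s)" for s
      unfolding DERIV_def
    proof (subst tendsto_at_iff_sequentially, intro allI impI)
      fix h assume h: "\<forall>i. h i \<in> UNIV - {0::real}" "h \<longlonglongrightarrow> 0"
      obtain K where K: "compact K" "\<And>x. x \<notin> K \<Longrightarrow> \<phi>s s x = 0"
        using test_function_support[OF ts[of s]] by blast
      have lim: "(\<lambda>n. LINT x|lborel. ((\<phi>s s (x + (- h n) *\<^sub>R b) - \<phi>s s x) / (- h n)) *\<^sub>R u x)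
          \<longlonglongrightarrow> (LINT x|lborel. partial b (\<phi>s s) x *\<^sub>R u x)"
        using h by (intro difference_quotient_limit[OF lu test_function_dirderiv[OF ts] _ _ K]
            test_function_continuous test_function_partial_continuous ts b)
          (auto intro: tendsto_eq_intros)
      have eq: "(LINT x|lborel. ((\<phi>s s (x + (- h n) *\<^sub>R b) - \<phi>s s x) / (- h n)) *\<^sub>R u x)
          = - ((G (s + h n) - G s) / h n)" for n
      proof -
        have "(LINT x|lborel. ((\<phi>s s (x + (- h n) *\<^sub>R b) - \<phi>s s x) / (- h n)) *\<^sub>R u x)
            = (LINT x|lborel. (\<phi>s (s + h n) x * u x - \<phi>s s x * u x) / (- h n))"
          by (intro Bochner_Integration.integral_cong) (auto simp: \<phi>s_def algebra_simps)
        then show ?thesis using i by (simp add: G_def)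
      qed
      from tendsto_minus[OF lim[unfolded eq]] have "(\<lambda>n. - (- ((G (s + h n) - G s) / h n))) \<longlonglongrightarrow> - (LINT x|lborel. partial b (\<phi>s s) x * u x)"
        by (simp only: real_scaleR_def)
      then show "((\<lambda>h. (G (s + h) - G s) / h) \<circ> h) \<longlonglongrightarrow> - (LINT x|lborel. partial b (\<phi>s s) x * u x)"
        by (simp add: o_def)
    qed
    have dGb: "norm (- (LINT x|lborel. partial b (\<phi>s s) x * u x)) \<le> L2_norm \<phi> * L2_norm v" for s
    proof -
      have "- (LINT x|lborel. partial b (\<phi>s s) x * u x) = (LINT x|lborel. \<phi>s s x * v x)"
        using w ts[of s] by (simp add: has_weak_partial_def)
      moreover have "L2_norm (\<phi>s s) = L2_norm \<phi>"
        using integral_translate[OF L2_integrable[OF \<phi>2], of "- (s *\<^sub>R b)"]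
        by (simp add: L2_norm_def \<phi>s_def)
      ultimately show ?thesis
        using integral_Cauchy_Schwarz'[OF test_function_L2[OF ts] v, of s] by simp
    qed
    have "norm (G t - G 0) \<le> (L2_norm \<phi> * L2_norm v) * norm (t - 0)"
      by (rule field_differentiable_bound[of UNIV]) (use dG dGb in auto)
    moreover have "G t - G 0 = (LINT x|lborel. \<phi> x * ?w x)"
      using integral_translate_mult[OF \<phi>2 u, of "t *\<^sub>R b"]
        integrable_L2_mult[OF \<phi>2 L2_translate[OF u], of "t *\<^sub>R b"] integrable_L2_mult[OF \<phi>2 u]
      by (simp add: G_def \<phi>s_def right_diff_distrib)
    ultimately show ?thesis by (simp add: mult_ac)
  qed
  have ii: "integrable lborel (\<lambda>x. \<phi> x * ?w x)" if "test_function \<phi>" for \<phi>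
    using integrable_L2_mult[OF test_function_L2[OF that] wL2] by simp
  \<comment> \<open>Riesz supplies a function with the desired norm that has the same integrals; the
    fundamental lemma identifies it with the difference.\<close>
  obtain w' where w': "w' \<in> L2" "L2_norm w' \<le> \<bar>t\<bar> * L2_norm v"
    "\<And>\<phi>. test_function \<phi> \<Longrightarrow> (LINT x|lborel. \<phi> x * ?w x) = (LINT x|lborel. \<phi> x * w' x)"
  proof (rule Riesz_test_functions[of "\<lambda>\<phi>. LINT x|lborel. \<phi> x * ?w x" "\<bar>t\<bar> * L2_norm v"])
    show "(LINT x|lborel. (\<phi> x + c * \<psi> x) * ?w x) = (LINT x|lborel. \<phi> x * ?w x) + c * (LINT x|lborel. \<psi> x * ?w x)"
      if "test_function \<phi>" "test_function \<psi>" for \<phi> \<psi> c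
      using that[THEN ii] by (simp add: distrib_right mult.assoc)
  qed (use bound that in \<open>auto simp: L2_norm_nonneg\<close>)
  have "AE x in lborel. ?w x - w' x = 0"
  proof (rule locally_integrable_eq_0_AE)
    show "locally_integrable (\<lambda>x. ?w x - w' x)"
      by (intro L2_imp_locally_integrable L2_diff[OF wL2 w'(1)])
    show "(LINT x|lborel. \<phi> x *\<^sub>R (?w x - w' x)) = 0" if "test_function \<phi>" for \<phi>
      using w'(3)[OF that] ii[OF that] integrable_L2_mult[OF test_function_L2[OF that] w'(1)]
      by (simp add: right_diff_distrib)
  qed
  then have "(LINT x|lborel. (?w x)\<^sup>2) = (LINT x|lborel. (w' x)\<^sup>2)"
    using L2_measurable[OF wL2] L2_measurable[OF w'(1)] by (intro integral_cong_AE) auto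
  also have "\<dots> = (L2_norm w')\<^sup>2" by (simp add: L2_norm_power2)
  also have "\<dots> \<le> (\<bar>t\<bar> * L2_norm v)\<^sup>2"
    by (intro power_mono w'(2) L2_norm_nonneg)
  also have "\<dots> = t\<^sup>2 * (LINT x|lborel. (v x)\<^sup>2)"
    by (simp add: power_mult_distrib L2_norm_power2)
  finally show ?thesis .
qed

lemma has_weak_partial_bounded_linear:
  fixes u :: "'a::euclidean_space \<Rightarrow> 'b::{banach, second_countable_topology}"
    and T :: "'b \<Rightarrow> 'c::{banach, second_countable_topology}"
  assumes T: "bounded_linear T" and w: "has_weak_partial b u v" and b: "b \<in> Basis"
  shows "has_weak_partial b (\<lambda>x. T (u x)) (\<lambda>x. T (v x))"
  unfolding has_weak_partial_def
proof (intro conjI allI impI)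
  have l: "locally_integrable u" "locally_integrable v" using w by (auto simp: has_weak_partial_def)
  have li: "locally_integrable (\<lambda>x. T (f x))" if "locally_integrable f" for f :: "'a \<Rightarrow> 'b"
    unfolding locally_integrable_def set_integrable_def
  proof (intro allI impI)
    fix K :: "'a set" assume "compact K"
    then have "integrable lborel (\<lambda>x. indicator K x *\<^sub>R f x)"
      using that by (simp add: locally_integrable_def set_integrable_def)
    from integrable_bounded_linear[OF T this] show "integrable lborel (\<lambda>x. indicator K x *\<^sub>R T (f x))"
      by (simp add: linear_scale[OF bounded_linear.linear[OF T]])
  qed
  show "locally_integrable (\<lambda>x. T (u x))" "locally_integrable (\<lambda>x. T (v x))"
    using l by (auto intro: li)
  fix \<phi> :: "'a \<Rightarrow> real" assume \<phi>: "test_function \<phi>"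
  have "(LINT x|lborel. partial b \<phi> x *\<^sub>R T (u x)) = T (LINT x|lborel. partial b \<phi> x *\<^sub>R u x)"
    using integral_bounded_linear[OF T integrable_test_mult[OF l(1) test_function_partial[OF \<phi> b]]]
    by (simp add: linear_scale[OF bounded_linear.linear[OF T]])
  also have "\<dots> = T (- (LINT x|lborel. \<phi> x *\<^sub>R v x))"
    using w \<phi> by (simp add: has_weak_partial_def)
  also have "\<dots> = - (LINT x|lborel. \<phi> x *\<^sub>R T (v x))"
    using integral_bounded_linear[OF T integrable_test_mult[OF l(2) \<phi>]]
    by (simp add: linear_scale[OF bounded_linear.linear[OF T]] linear_neg[OF bounded_linear.linear[OF T]])
  finally show "(LINT x|lborel. partial b \<phi> x *\<^sub>R T (u x)) = - (LINT x|lborel. \<phi> x *\<^sub>R T (v x))" .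
qed

subsection \<open>Uniqueness of positive solutions\<close>

lemma DERIV_max_0_square: "((\<lambda>y. (max 0 y)\<^sup>2) has_real_derivative 2 * max 0 y) (at y)"
proof (cases y "0::real" rule: linorder_cases)
  case less
  have "((\<lambda>_. 0) has_real_derivative 0) (at y)" by simp
  then have "((\<lambda>y. (max 0 y)\<^sup>2) has_real_derivative 0) (at y)"
    by (rule DERIV_cong_ev[THEN iffD1, rotated 3, OF _ refl _ refl])
      (use less in \<open>auto simp: eventually_nhds max_def intro!: exI[of _ "{..<0}"]\<close>)
  then show ?thesis using less by simp
next
  case greater
  have "((\<lambda>y. y\<^sup>2) has_real_derivative 2 * y) (at y)"
    by (auto intro!: derivative_eq_intros)
  then have "((\<lambda>y. (max 0 y)\<^sup>2) has_real_derivative 2 * y) (at y)"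
    by (rule DERIV_cong_ev[THEN iffD1, rotated 3, OF _ refl _ refl])
      (use greater in \<open>auto simp: eventually_nhds max_def intro!: exI[of _ "{0<..}"]\<close>)
  then show ?thesis using greater by simp
next
  case equal
  have "((\<lambda>h::real. (max 0 h)\<^sup>2 / h) \<longlongrightarrow> 0) (at 0)"
  proof (rule Lim_null_comparison)
    show "\<forall>\<^sub>F h in at 0. norm ((max 0 h)\<^sup>2 / h) \<le> \<bar>h::real\<bar>"
      by (auto simp: eventually_at_filter max_def power2_eq_square)
    show "((\<lambda>h::real. \<bar>h\<bar>) \<longlongrightarrow> 0) (at 0)"
      by (auto intro!: tendsto_eq_intros)
  qed
  then show ?thesis using equal by (simp add: DERIV_def)
qed

text \<open>Squaring the positive part makes the cutoff continuously differentiable across the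
  sphere of radius \<open>R\<close>, while its gradient stays of order 1 / R.\<close>

definition cutoff :: "real \<Rightarrow> 'a::euclidean_space \<Rightarrow> real" where
  "cutoff R x = (max 0 (1 - (norm x)\<^sup>2 / R\<^sup>2))\<^sup>2"

definition cutoff' :: "'a::euclidean_space \<Rightarrow> real \<Rightarrow> 'a \<Rightarrow> real" where
  "cutoff' b R x = 2 * max 0 (1 - (norm x)\<^sup>2 / R\<^sup>2) * (- 2 * (x \<bullet> b) / R\<^sup>2)"

lemma cutoff_dirderiv:
  "((\<lambda>s. cutoff R (x + s *\<^sub>R b)) has_real_derivative cutoff' b R x) (at 0)"
proof -
  have "((\<lambda>s. 1 - (norm (x + s *\<^sub>R b))\<^sup>2 / R\<^sup>2) has_real_derivative - 2 * (x \<bullet> b) / R\<^sup>2) (at 0)"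
  proof -
    have "(norm (x + s *\<^sub>R b))\<^sup>2 = x \<bullet> x + 2 * s * (x \<bullet> b) + s\<^sup>2 * (b \<bullet> b)" for s
      unfolding power2_norm_eq_inner
      by (simp add: inner_add_left inner_add_right inner_commute power2_eq_square algebra_simps)
    then show ?thesis
      unfolding divide_inverse by (auto intro!: derivative_eq_intros)
  qed
  from DERIV_chain2[OF DERIV_max_0_square this] show ?thesis
    by (simp add: cutoff_def cutoff'_def)
qed

lemma cutoff_support: "R > 0 \<Longrightarrow> x \<notin> cball 0 R \<Longrightarrow> cutoff R x = 0"
  by (auto simp: cutoff_def max_def not_le field_simps power_mono_iff
      intro!: antisym dest!: power_strict_mono[of R "norm x" 2])

lemma continuous_on_cutoff: "continuous_on UNIV (cutoff R)" "continuous_on UNIV (cutoff' b R)"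
  unfolding cutoff_def[abs_def] cutoff'_def[abs_def] divide_inverse
  by (intro continuous_intros)+

lemma cutoff'_square_sum_le:
  fixes x :: "'a::euclidean_space"
  assumes R: "R > 0"
  shows "(\<Sum>b\<in>Basis. (cutoff' b R x)\<^sup>2) \<le> 16 / R\<^sup>2 * indicator (cball 0 R) x"
proof (cases "norm x \<le> R")
  case True
  let ?m = "max 0 (1 - (norm x)\<^sup>2 / R\<^sup>2)"
  have m: "0 \<le> ?m" "?m \<le> 1" by auto
  have "(\<Sum>b\<in>Basis. (cutoff' b R x)\<^sup>2) = (16 * ?m\<^sup>2 / R ^ 4) * (\<Sum>b\<in>Basis. (x \<bullet> b)\<^sup>2)"
    unfolding sum_distrib_left
    by (intro sum.cong) (auto simp: cutoff'_def power_mult_distrib power_divide simp flip: power_mult)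
  also have "\<dots> = (16 * ?m\<^sup>2 / R ^ 4) * (norm x)\<^sup>2"
    using euclidean_inner[of x x] by (simp add: power2_norm_eq_inner power2_eq_square[of "x \<bullet> _"])
  also have "\<dots> \<le> (16 * 1 / R ^ 4) * R\<^sup>2"
    using m True R by (intro mult_mono divide_right_mono mult_left_mono power_mono power_le_one) auto
  also have "\<dots> = 16 / R\<^sup>2" using R by (simp add: power2_eq_square power4_eq_xxxx)
  finally show ?thesis using True by simp
next
  case False
  then have "R\<^sup>2 < (norm x)\<^sup>2" using R by (intro power_strict_mono) auto
  then have "1 - (norm x)\<^sup>2 / R\<^sup>2 < 0" using R by simp
  then have "cutoff' b R x = 0" for b by (simp add: cutoff'_def)
  then show ?thesis by (simp add: R less_imp_le)
qed

lemma C_k_2D: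
  fixes f :: "'a::euclidean_space \<Rightarrow> real"
  assumes "C_k 2 f" "b \<in> Basis"
  shows "f differentiable_on UNIV" "partial b f differentiable_on UNIV"
    "continuous_on UNIV f" "continuous_on UNIV (partial b f)" "continuous_on UNIV (partial b (partial b f))"
  using assms by (auto simp: numeral_2_eq_2 intro: differentiable_imp_continuous_on)

lemma dirderiv_partial:
  fixes f :: "'a::euclidean_space \<Rightarrow> real"
  shows "f differentiable_on UNIV \<Longrightarrow> ((\<lambda>s. f (x + s *\<^sub>R b)) has_real_derivative partial b f x) (at 0)"
  using has_vector_derivative_partial[of f x b 0]
  by (simp add: has_real_derivative_iff_has_vector_derivative)

lemma integrable_continuous_compact_support:
  fixes f :: "'a::euclidean_space \<Rightarrow> real"
  assumes "continuous_on UNIV f" "compact K" "\<And>x. x \<notin> K \<Longrightarrow> f x = 0"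
  shows "integrable lborel f"
  using integrable_continuous_mult[OF continuous_imp_locally_integrable[of "\<lambda>_. 1::real"], OF _ assms] by simp

section \<open>Picone's identity with a cutoff\<close>

text \<open>Put f = \<zeta>^2 (\<xi>^2 \<eta>' / \<eta> - \<xi> \<xi>') with derivatives along
  \<open>b\<close>. Its derivative integrates to zero, and F - f' is the square of \<eta> times the
  derivative of \<zeta> \<xi> / \<eta>. This is Picone's square for the pair \<eta>, \<zeta> \<xi>,
  and the only price of the cutoff is the term with \<open>\<zeta>'\<close>.\<close>

lemma Picone_partial:
  fixes \<eta> \<xi> \<zeta> :: "'a::euclidean_space \<Rightarrow> real"
  assumes \<eta>: "C_k 2 \<eta>" "\<And>x. 0 < \<eta> x" and \<xi>: "C_k 2 \<xi>" and b: "b \<in> Basis"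
    and \<zeta>: "\<And>x. ((\<lambda>s. \<zeta> (x + s *\<^sub>R b)) has_real_derivative \<zeta>' x) (at 0)"
    "continuous_on UNIV \<zeta>" "continuous_on UNIV \<zeta>'" "compact K" "\<And>x. x \<notin> K \<Longrightarrow> \<zeta> x = 0"
  defines "F \<equiv> \<lambda>x. (\<zeta> x)\<^sup>2 * ((\<xi> x)\<^sup>2 * partial b (partial b \<eta>) x / \<eta> x - \<xi> x * partial b (partial b \<xi>) x)
      + (\<zeta>' x)\<^sup>2 * (\<xi> x)\<^sup>2"
  shows "integrable lborel F" "0 \<le> (LINT x|lborel. F x)"
proof -
  let ?p = "partial b \<eta>" and ?pp = "partial b (partial b \<eta>)"
  let ?q = "partial b \<xi>" and ?qq = "partial b (partial b \<xi>)"
  define f where "f = (\<lambda>x. (\<zeta> x)\<^sup>2 * ((\<xi> x)\<^sup>2 * ?p x / \<eta> x - \<xi> x * ?q x))"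
  define f' where "f' = (\<lambda>x. 2 * \<zeta> x * \<zeta>' x * ((\<xi> x)\<^sup>2 * ?p x / \<eta> x - \<xi> x * ?q x)
    + (\<zeta> x)\<^sup>2 * ((2 * \<xi> x * ?q x * ?p x + (\<xi> x)\<^sup>2 * ?pp x) / \<eta> x - (\<xi> x)\<^sup>2 * ?p x * ?p x / (\<eta> x)\<^sup>2
      - ?q x * ?q x - \<xi> x * ?qq x))"
  have nz: "\<eta> x \<noteq> 0" for x using \<eta>(2)[of x] by simp
  note c = C_k_2D(3-5)[OF \<eta>(1) b] C_k_2D(3-5)[OF \<xi> b] \<zeta>(2,3)
  note d = dirderiv_partial[OF C_k_2D(1)[OF \<eta>(1) b]] dirderiv_partial[OF C_k_2D(2)[OF \<eta>(1) b]]
    dirderiv_partial[OF C_k_2D(1)[OF \<xi> b]] dirderiv_partial[OF C_k_2D(2)[OF \<xi> b]]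
  have df: "((\<lambda>s. f (x + s *\<^sub>R b)) has_real_derivative f' x) (at 0)" for x
    unfolding f_def f'_def
    by (rule derivative_eq_intros \<zeta>(1) d refl | simp add: nz)+
      (use nz[of x] in \<open>simp add: power2_eq_square field_simps\<close>)
  have \<zeta>'0: "\<zeta>' x = 0" if "x \<notin> K" for x
    using dirderiv_support[OF \<zeta>(1) compact_imp_closed[OF \<zeta>(4)] \<zeta>(5) that] .
  have cont: "continuous_on UNIV f" "continuous_on UNIV f'" "continuous_on UNIV F"
    unfolding f_def f'_def F_def using nz by (intro continuous_intros c; simp)+
  have supp: "f x = 0" "f' x = 0" "F x = 0" if "x \<notin> K" for x
    using that \<zeta>(5) \<zeta>'0 by (auto simp: f_def f'_def F_def)
  show i: "integrable lborel F"
    using cont(3) \<zeta>(4) supp(3) by (rule integrable_continuous_compact_support)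
  have i': "integrable lborel f'"
    using cont(2) \<zeta>(4) supp(2) by (rule integrable_continuous_compact_support)
  have "F x - f' x = (\<zeta>' x * \<xi> x + \<zeta> x * ?q x - \<zeta> x * \<xi> x * ?p x / \<eta> x)\<^sup>2" for x
    unfolding F_def f'_def using nz[of x] by (simp add: power2_eq_square field_simps)
  then have "0 \<le> (LINT x|lborel. F x - f' x)" by simp
  also have "\<dots> = (LINT x|lborel. F x) - (LINT x|lborel. f' x)" using i i' by simp
  also have "(LINT x|lborel. f' x) = 0"
    using df cont(1,2) \<zeta>(4) supp(1) by (rule integral_dirderiv_eq_0)
  finally show "0 \<le> (LINT x|lborel. F x)" by simp
qed

lemma Picone_cutoff:
  fixes \<eta> \<xi> :: "'a::euclidean_space \<Rightarrow> real"
  assumes \<eta>: "C_k 2 \<eta>" "\<And>x. 0 < \<eta> x" and \<xi>: "C_k 2 \<xi>" and R: "R > 0"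
  defines "F \<equiv> \<lambda>x. (cutoff R x)\<^sup>2 * ((\<xi> x)\<^sup>2 * laplacian \<eta> x / \<eta> x - \<xi> x * laplacian \<xi> x)
      + (\<Sum>b\<in>Basis. (cutoff' b R x)\<^sup>2) * (\<xi> x)\<^sup>2"
  shows "integrable lborel F" "0 \<le> (LINT x|lborel. F x)"
proof -
  let ?G = "\<lambda>b x. (cutoff R x)\<^sup>2 * ((\<xi> x)\<^sup>2 * partial b (partial b \<eta>) x / \<eta> x - \<xi> x * partial b (partial b \<xi>) x)
      + (cutoff' b R x)\<^sup>2 * (\<xi> x)\<^sup>2"
  have G: "integrable lborel (?G b)" "0 \<le> (LINT x|lborel. ?G b x)" if "b \<in> Basis" for b
    by (rule Picone_partial[OF \<eta> \<xi> that cutoff_dirderiv continuous_on_cutoff compact_cball cutoff_support[OF R]]; assumption)+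
  have F: "F = (\<lambda>x. \<Sum>b\<in>Basis. ?G b x)"
    unfolding F_def laplacian_def
    by (simp add: sum.distrib sum_distrib_left sum_distrib_right sum_subtractf sum_divide_distrib right_diff_distrib)
  show "integrable lborel F" unfolding F using G(1) by (intro Bochner_Integration.integrable_sum)
  have "(LINT x|lborel. F x) = (\<Sum>b\<in>Basis. LINT x|lborel. ?G b x)"
    unfolding F using G(1) by (intro Bochner_Integration.integral_sum)
  then show "0 \<le> (LINT x|lborel. F x)" using G(2) by (simp add: sum_nonneg)
qed

text \<open>In dimension two decay to zero suffices: the gradient of the cutoff is of size \<open>1 / R\<close> on a
  disc of area of order \<open>R\<^sup>2\<close>.\<close>

lemma cutoff_gradient_small:
  fixes \<xi> :: "real^2 \<Rightarrow> real"
  assumes c: "continuous_on UNIV \<xi>" and lim: "(\<xi> \<longlongrightarrow> 0) at_infinity" and \<delta>: "0 < \<delta>"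
  shows "\<exists>R0>0. \<forall>R\<ge>R0. (LINT x|lborel. (\<Sum>b\<in>Basis. (cutoff' b R x)\<^sup>2) * (\<xi> x)\<^sup>2) \<le> \<delta>"
proof -
  let ?V = "\<lambda>R::real. measure lborel (cball (0::real^2) R)"
  define C where "C = unit_ball_vol 2"
  have C: "0 < C" by (simp add: C_def)
  have V: "?V R = C * R\<^sup>2" if "0 \<le> R" for R
    using content_cball[OF that, of "0::real^2"] by (simp add: C_def)
  \<comment> \<open>The final bound is \<open>16 * B / R\<^sup>2 + 16 * d * C\<close>: this
    \<open>d\<close> makes the second term \<delta> / 2, and \<open>R0\<close> below makes the first
    at most \<delta> / 2.\<close>
  define d where "d = \<delta> / (32 * C)"
  have d: "0 < d" using \<delta> C by (simp add: d_def)
  have "\<forall>\<^sub>F x in at_infinity. dist (\<xi> x) 0 < sqrt d"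
    using lim d by (intro tendstoD) auto
  then obtain R1 where R1: "\<And>x. norm x \<ge> R1 \<Longrightarrow> \<bar>\<xi> x\<bar> < sqrt d"
    by (auto simp: eventually_at_infinity)
  define R2 where "R2 = max R1 1"
  have "bounded (\<xi> ` cball 0 R2)"
    using c by (meson compact_cball compact_continuous_image compact_imp_bounded continuous_on_subset subset_UNIV)
  then obtain M where "\<forall>y\<in>\<xi> ` cball 0 R2. norm y \<le> M" unfolding bounded_iff by blast
  then have M: "\<And>x. x \<in> cball 0 R2 \<Longrightarrow> \<bar>\<xi> x\<bar> \<le> M" by simp
  have \<xi>b: "(\<xi> x)\<^sup>2 \<le> M\<^sup>2 * indicator (cball 0 R2) x + d" for x
  proof (cases "x \<in> cball 0 R2")
    case True
    have "\<bar>\<xi> x\<bar>\<^sup>2 \<le> M\<^sup>2" using M[OF True] by (intro power_mono) auto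
    then show ?thesis using True d by simp
  next
    case False
    then have "\<bar>\<xi> x\<bar> < sqrt d" by (intro R1) (simp add: R2_def)
    then have "\<bar>\<xi> x\<bar>\<^sup>2 \<le> (sqrt d)\<^sup>2" by (intro power_mono) auto
    then show ?thesis using False d by simp
  qed
  define B where "B = M\<^sup>2 * ?V R2"
  have B: "0 \<le> B" by (simp add: B_def)
  define R0 where "R0 = sqrt (32 * B / \<delta>) + 1"
  have R0: "R0 > 0" using B \<delta> by (simp add: R0_def add_nonneg_pos)
  have "(LINT x|lborel. (\<Sum>b\<in>Basis. (cutoff' b R x)\<^sup>2) * (\<xi> x)\<^sup>2) \<le> \<delta>" if R: "R \<ge> R0" for R
  proof -
    have Rp: "R > 0" using R R0 by simp
    have fin: "emeasure lborel (cball (0::real^2) r) < \<infinity>" for r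
      by (rule emeasure_lborel_cball_finite)
    have ii: "integrable lborel (indicator (cball (0::real^2) r) :: _ \<Rightarrow> real)" for r
      using fin by (simp add: integrable_indicator_iff)
    have "(LINT x|lborel. (\<Sum>b\<in>Basis. (cutoff' b R x)\<^sup>2) * (\<xi> x)\<^sup>2)
        \<le> (LINT x|lborel. 16 / R\<^sup>2 * (M\<^sup>2 * indicator (cball 0 R2) x + d * indicator (cball (0::real^2) R) x))"
    proof (rule integral_mono')
      show "integrable lborel (\<lambda>x. 16 / R\<^sup>2 * (M\<^sup>2 * indicator (cball 0 R2) x + d * indicator (cball (0::real^2) R) x))"
        using ii by (intro integrable_mult_right Bochner_Integration.integrable_add) auto
      show "(\<Sum>b\<in>Basis. (cutoff' b R x)\<^sup>2) * (\<xi> x)\<^sup>2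
          \<le> 16 / R\<^sup>2 * (M\<^sup>2 * indicator (cball 0 R2) x + d * indicator (cball 0 R) x)" for x :: "real^2"
      proof -
        have "(\<Sum>b\<in>Basis. (cutoff' b R x)\<^sup>2) * (\<xi> x)\<^sup>2
          \<le> (16 / R\<^sup>2 * indicator (cball 0 R) x) * (M\<^sup>2 * indicator (cball 0 R2) x + d)"
          using Rp by (intro mult_mono cutoff'_square_sum_le \<xi>b) auto
        also have "\<dots> = 16 / R\<^sup>2 * (indicator (cball 0 R) x * (M\<^sup>2 * indicator (cball 0 R2) x + d))" by simp
        also have "\<dots> \<le> 16 / R\<^sup>2 * (M\<^sup>2 * indicator (cball 0 R2) x + d * indicator (cball 0 R) x)"
          by (intro mult_left_mono) (auto simp: indicator_def)
        finally show ?thesis .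
      qed
    qed (use d in \<open>auto intro!: divide_nonneg_nonneg add_nonneg_nonneg mult_nonneg_nonneg\<close>)
    also have "\<dots> = 16 / R\<^sup>2 * (B + d * ?V R)"
      using ii by (simp add: B_def)
    also have "\<dots> = 16 * B / R\<^sup>2 + 16 * d * C"
      using Rp by (simp add: V field_simps)
    also have "16 * d * C = \<delta> / 2" using C by (simp add: d_def)
    also have "16 * B / R\<^sup>2 \<le> \<delta> / 2"
    proof -
      have "32 * B / \<delta> = (sqrt (32 * B / \<delta>))\<^sup>2" using B \<delta> by simp
      also have "\<dots> \<le> R\<^sup>2" using R B \<delta> by (intro power_mono) (auto simp: R0_def)
      finally show ?thesis using \<delta> Rp by (simp add: field_simps)
    qed
    finally show ?thesis by simp
  qed
  then show ?thesis using R0 by blast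
qed

section \<open>The interaction form and the comparison of two solutions\<close>

definition quad :: "real \<Rightarrow> real \<Rightarrow> real \<Rightarrow> real \<Rightarrow> real \<Rightarrow> real" where
  "quad g1 g2 g r s = g1 * r\<^sup>2 + 2 * g * r * s + g2 * s\<^sup>2"

text \<open>The constant is determinant over trace of the matrix M of the form. By Cayley-Hamilton,
  trace times form minus determinant times the squared norm is the squared norm of M applied to (r,
  s).\<close>

lemma quad_coercive:
  assumes "g1 > 0" "g2 > 0" "g\<^sup>2 < g1 * g2"
  obtains c where "c > 0" "\<And>r s. c * (r\<^sup>2 + s\<^sup>2) \<le> quad g1 g2 g r s"
proof
  let ?c = "(g1 * g2 - g\<^sup>2) / (g1 + g2)"
  show "?c > 0" using assms by simp
  show "?c * (r\<^sup>2 + s\<^sup>2) \<le> quad g1 g2 g r s" for r s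
  proof -
    have "(g1 + g2) * quad g1 g2 g r s - (g1 * g2 - g\<^sup>2) * (r\<^sup>2 + s\<^sup>2) = (g1 * r + g * s)\<^sup>2 + (g * r + g2 * s)\<^sup>2"
      by (simp add: quad_def power2_eq_square algebra_simps)
    also have "\<dots> \<ge> 0" by simp
    finally have "(g1 * g2 - g\<^sup>2) * (r\<^sup>2 + s\<^sup>2) \<le> (g1 + g2) * quad g1 g2 g r s" by simp
    then show ?thesis using assms(1,2) by (simp add: field_simps)
  qed
qed

text \<open>Picone's inequality is used four times, in each component and in both directions. After
  inserting the equations, the trap and the multipliers cancel between the two solutions, and what
  is left is minus the form \<open>Q\<close> of the density differences divided by
  \<open>\<epsilon>\<^sup>2\<close>. So the integral of \<open>Q\<close> with the cutoff is at most
  \<open>\<epsilon>\<^sup>2\<close> times the gradient terms of the cutoff, which disappear as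
  \<open>R\<close> grows.\<close>

lemma positive_solution_unique:
  fixes g1 g2 g \<epsilon> :: real
  assumes g: "g1 > 0" "g2 > 0" "\<epsilon> > 0" "g\<^sup>2 < g1 * g2"
    and "positive_solution \<epsilon> g1 g2 g l1 l2 \<eta>" "positive_solution \<epsilon> g1 g2 g l1 l2 \<xi>"
  shows "\<eta> = \<xi>"
proof -
  obtain \<eta>1 \<eta>2 \<xi>1 \<xi>2 where pair: "\<eta> = (\<eta>1, \<eta>2)" "\<xi> = (\<xi>1, \<xi>2)" by (cases \<eta>, cases \<xi>) auto
  note s\<eta> = assms(5)[unfolded pair positive_solution_def prod.case]
  note s\<xi> = assms(6)[unfolded pair positive_solution_def prod.case]
  have C: "C_k 2 \<eta>1" "C_k 2 \<eta>2" "C_k 2 \<xi>1" "C_k 2 \<xi>2" using s\<eta> s\<xi> by auto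
  have p: "0 < \<eta>1 x" "0 < \<eta>2 x" "0 < \<xi>1 x" "0 < \<xi>2 x" for x using s\<eta> s\<xi> by auto
  have c: "continuous_on UNIV \<eta>1" "continuous_on UNIV \<eta>2" "continuous_on UNIV \<xi>1" "continuous_on UNIV \<xi>2"
    using C C_k_continuous by blast+
  have lim: "(\<eta>1 \<longlongrightarrow> 0) at_infinity" "(\<eta>2 \<longlongrightarrow> 0) at_infinity" "(\<xi>1 \<longlongrightarrow> 0) at_infinity" "(\<xi>2 \<longlongrightarrow> 0) at_infinity"
    using s\<eta> s\<xi> by auto
  let ?W = "\<lambda>a u v l x. ((norm x)\<^sup>2 + a * (u x)\<^sup>2 + g * (v x)\<^sup>2 - l) / \<epsilon>\<^sup>2"
  have lap: "laplacian \<eta>1 x = ?W g1 \<eta>1 \<eta>2 l1 x * \<eta>1 x" "laplacian \<eta>2 x = ?W g2 \<eta>2 \<eta>1 l2 x * \<eta>2 x"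
    "laplacian \<xi>1 x = ?W g1 \<xi>1 \<xi>2 l1 x * \<xi>1 x" "laplacian \<xi>2 x = ?W g2 \<xi>2 \<xi>1 l2 x * \<xi>2 x" for x
  proof -
    have *: "L = ((norm x)\<^sup>2 + a * U\<^sup>2 + g * V\<^sup>2 - l) / \<epsilon>\<^sup>2 * U"
      if "- \<epsilon>\<^sup>2 * L + (norm x)\<^sup>2 * U + a * U ^ 3 + g * U * V\<^sup>2 = l * U" for L U V a l
      using that g(3) by (simp add: field_simps power2_eq_square power3_eq_cube)
    show "laplacian \<eta>1 x = ?W g1 \<eta>1 \<eta>2 l1 x * \<eta>1 x" "laplacian \<xi>1 x = ?W g1 \<xi>1 \<xi>2 l1 x * \<xi>1 x"
      "laplacian \<eta>2 x = ?W g2 \<eta>2 \<eta>1 l2 x * \<eta>2 x" "laplacian \<xi>2 x = ?W g2 \<xi>2 \<xi>1 l2 x * \<xi>2 x"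
      using s\<eta> s\<xi> by (intro *; simp add: mult_ac)+
  qed
  define Q where "Q = (\<lambda>x. quad g1 g2 g ((\<eta>1 x)\<^sup>2 - (\<xi>1 x)\<^sup>2) ((\<eta>2 x)\<^sup>2 - (\<xi>2 x)\<^sup>2))"
  obtain k where k: "k > 0" "\<And>r s. k * (r\<^sup>2 + s\<^sup>2) \<le> quad g1 g2 g r s"
    using quad_coercive[OF g(1,2,4)] by blast
  have Q0: "0 \<le> Q x" for x
    using k(2)[of "(\<eta>1 x)\<^sup>2 - (\<xi>1 x)\<^sup>2" "(\<eta>2 x)\<^sup>2 - (\<xi>2 x)\<^sup>2"] k(1) unfolding Q_def
    by (smt (verit) mult_nonneg_nonneg zero_le_power2)
  have cQ: "continuous_on UNIV Q" unfolding Q_def quad_def by (intro continuous_intros c)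
  let ?D = "\<lambda>R u x. (\<Sum>b\<in>Basis. (cutoff' b R x)\<^sup>2) * (u x)\<^sup>2"
  have iQ: "integrable lborel (\<lambda>x. (cutoff R x)\<^sup>2 * Q x)" if "R > 0" for R
    using cQ cutoff_support[OF that]
    by (intro integrable_continuous_compact_support[of _ "cball 0 R"] continuous_intros continuous_on_cutoff) auto
  have iD: "integrable lborel (?D R u)" if "R > 0" "continuous_on UNIV u" for R and u :: "real^2 \<Rightarrow> real"
  proof (rule integrable_continuous_compact_support[of _ "cball 0 R"])
    show "continuous_on UNIV (?D R u)" by (intro continuous_intros continuous_on_cutoff that)
    show "?D R u x = 0" if "x \<notin> cball 0 R" for x
      using cutoff'_square_sum_le[OF \<open>R > 0\<close>, of x] sum_nonneg[of Basis "\<lambda>b. (cutoff' b R x)\<^sup>2"] that by simp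
  qed simp
  have main: "(LINT x|lborel. (cutoff R x)\<^sup>2 * Q x) \<le> \<epsilon>\<^sup>2 * ((LINT x|lborel. ?D R \<eta>1 x) + (LINT x|lborel. ?D R \<eta>2 x)
      + (LINT x|lborel. ?D R \<xi>1 x) + (LINT x|lborel. ?D R \<xi>2 x))" if R: "R > 0" for R
  proof -
    let ?P = "\<lambda>\<eta> \<xi> x. (cutoff R x)\<^sup>2 * ((\<xi> x)\<^sup>2 * laplacian \<eta> x / \<eta> x - \<xi> x * laplacian \<xi> x) + ?D R \<xi> x"
    note P = Picone_cutoff[OF C(1) p(1) C(3) R] Picone_cutoff[OF C(3) p(3) C(1) R]
      Picone_cutoff[OF C(2) p(2) C(4) R] Picone_cutoff[OF C(4) p(4) C(2) R]
    have "?P \<eta>1 \<xi>1 x + ?P \<xi>1 \<eta>1 x + ?P \<eta>2 \<xi>2 x + ?P \<xi>2 \<eta>2 x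
        = ?D R \<eta>1 x + ?D R \<eta>2 x + ?D R \<xi>1 x + ?D R \<xi>2 x - (cutoff R x)\<^sup>2 * Q x / \<epsilon>\<^sup>2" for x
    proof -
      have [simp]: "\<eta>1 x \<noteq> 0" "\<eta>2 x \<noteq> 0" "\<xi>1 x \<noteq> 0" "\<xi>2 x \<noteq> 0" using p[of x] by auto
      have "(\<xi>1 x)\<^sup>2 * laplacian \<eta>1 x / \<eta>1 x - \<xi>1 x * laplacian \<xi>1 x
          + ((\<eta>1 x)\<^sup>2 * laplacian \<xi>1 x / \<xi>1 x - \<eta>1 x * laplacian \<eta>1 x)
          + ((\<xi>2 x)\<^sup>2 * laplacian \<eta>2 x / \<eta>2 x - \<xi>2 x * laplacian \<xi>2 x)
          + ((\<eta>2 x)\<^sup>2 * laplacian \<xi>2 x / \<xi>2 x - \<eta>2 x * laplacian \<eta>2 x) = - Q x / \<epsilon>\<^sup>2"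
        unfolding lap Q_def quad_def using g(3) by (simp add: field_simps power2_eq_square)
      from arg_cong[OF this, of "\<lambda>y. (cutoff R x)\<^sup>2 * y"] show ?thesis by (simp add: algebra_simps)
    qed
    then have "(LINT x|lborel. ?P \<eta>1 \<xi>1 x + ?P \<xi>1 \<eta>1 x + ?P \<eta>2 \<xi>2 x + ?P \<xi>2 \<eta>2 x)
        = (LINT x|lborel. ?D R \<eta>1 x + ?D R \<eta>2 x + ?D R \<xi>1 x + ?D R \<xi>2 x - (cutoff R x)\<^sup>2 * Q x / \<epsilon>\<^sup>2)"
      by (simp only:)
    also have "\<dots> = (LINT x|lborel. ?D R \<eta>1 x) + (LINT x|lborel. ?D R \<eta>2 x)
      + (LINT x|lborel. ?D R \<xi>1 x) + (LINT x|lborel. ?D R \<xi>2 x) - (LINT x|lborel. (cutoff R x)\<^sup>2 * Q x) / \<epsilon>\<^sup>2"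
      using iD[OF R c(1)] iD[OF R c(2)] iD[OF R c(3)] iD[OF R c(4)] iQ[OF R] by simp
    also have "(LINT x|lborel. ?P \<eta>1 \<xi>1 x + ?P \<xi>1 \<eta>1 x + ?P \<eta>2 \<xi>2 x + ?P \<xi>2 \<eta>2 x)
        = (LINT x|lborel. ?P \<eta>1 \<xi>1 x) + (LINT x|lborel. ?P \<xi>1 \<eta>1 x) + (LINT x|lborel. ?P \<eta>2 \<xi>2 x) + (LINT x|lborel. ?P \<xi>2 \<eta>2 x)"
      using P(1,3,5,7) by simp
    finally have "(LINT x|lborel. (cutoff R x)\<^sup>2 * Q x) / \<epsilon>\<^sup>2 \<le> (LINT x|lborel. ?D R \<eta>1 x) + (LINT x|lborel. ?D R \<eta>2 x)
      + (LINT x|lborel. ?D R \<xi>1 x) + (LINT x|lborel. ?D R \<xi>2 x)"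
      using P(2,4,6,8) by linarith
    then show ?thesis using g(3) by (simp add: field_simps)
  qed
  have "Q x0 = 0" for x0
  proof (rule ccontr)
    assume "Q x0 \<noteq> 0"
    then have Qp: "0 < Q x0" using Q0[of x0] by simp
    define R1 where "R1 = norm x0 + 1"
    have R1: "R1 > 0" "norm x0 < R1" by (auto simp: R1_def add_nonneg_pos)
    define I where "I = (LINT x|lborel. (cutoff R1 x)\<^sup>2 * Q x)"
    have "I \<noteq> 0"
    proof
      assume "I = 0"
      then have "AE x in lborel. (cutoff R1 x)\<^sup>2 * Q x = 0"
        unfolding I_def using integral_nonneg_eq_0_iff_AE[OF iQ[OF R1(1)]] Q0 by simp
      moreover have o: "open {x. (cutoff R1 x)\<^sup>2 * Q x \<noteq> 0}"
        by (intro open_Collect_neq continuous_intros continuous_on_cutoff cQ)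
      ultimately have "{x. (cutoff R1 x)\<^sup>2 * Q x \<noteq> 0} \<in> null_sets lborel"
        by (subst (asm) AE_iff_null) auto
      then have "negligible {x. (cutoff R1 x)\<^sup>2 * Q x \<noteq> 0}"
        by (simp add: negligible_iff_null_sets null_sets_completionI)
      note negl = open_not_negligible[OF o, THEN notE, OF _ this]
      have "(norm x0)\<^sup>2 < R1\<^sup>2" using R1 by (intro power_strict_mono) auto
      then have "cutoff R1 x0 \<noteq> 0" using R1 by (simp add: cutoff_def)
      then have "x0 \<in> {x. (cutoff R1 x)\<^sup>2 * Q x \<noteq> 0}" using Qp by simp
      then show False using negl by blast
    qed
    moreover have "0 \<le> I" unfolding I_def using Q0 by (intro Bochner_Integration.integral_nonneg) simp
    ultimately have I: "0 < I" by simp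
    \<comment> \<open>Four gradient terms of size \<delta>, multiplied by
      \<open>\<epsilon>\<^sup>2\<close>, add up to I / 2 < I.\<close>
    define \<delta> where "\<delta> = I / (8 * \<epsilon>\<^sup>2)"
    have \<delta>: "0 < \<delta>" using I g(3) by (simp add: \<delta>_def)
    obtain a1 a2 a3 a4 where a: "\<forall>R\<ge>a1. (LINT x|lborel. ?D R \<eta>1 x) \<le> \<delta>" "\<forall>R\<ge>a2. (LINT x|lborel. ?D R \<eta>2 x) \<le> \<delta>"
      "\<forall>R\<ge>a3. (LINT x|lborel. ?D R \<xi>1 x) \<le> \<delta>" "\<forall>R\<ge>a4. (LINT x|lborel. ?D R \<xi>2 x) \<le> \<delta>"
      using cutoff_gradient_small[OF c(1) lim(1) \<delta>] cutoff_gradient_small[OF c(2) lim(2) \<delta>]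
        cutoff_gradient_small[OF c(3) lim(3) \<delta>] cutoff_gradient_small[OF c(4) lim(4) \<delta>] by blast
    \<comment> \<open>Including \<open>R1\<close> keeps the integral of \<open>Q\<close> at least
      \<open>I\<close>, because the cutoff increases with its radius.\<close>
    define R where "R = Max {a1, a2, a3, a4, R1}"
    have R: "R \<ge> a1" "R \<ge> a2" "R \<ge> a3" "R \<ge> a4" "R \<ge> R1" by (auto simp: R_def)
    then have Rp: "R > 0" using R1 by simp
    have "I \<le> (LINT x|lborel. (cutoff R x)\<^sup>2 * Q x)"
      unfolding I_def
    proof (intro integral_mono iQ R1 Rp mult_right_mono power_mono Q0)
      show "cutoff R1 x \<le> cutoff R x" for x :: "real^2"
      proof -
        have "(norm x)\<^sup>2 / R\<^sup>2 \<le> (norm x)\<^sup>2 / R1\<^sup>2"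
          using R R1 by (intro divide_left_mono power_mono) auto
        then show ?thesis unfolding cutoff_def by (intro power_mono) auto
      qed
    qed (auto simp: cutoff_def)
    also have "\<dots> \<le> \<epsilon>\<^sup>2 * (\<delta> + \<delta> + \<delta> + \<delta>)"
      using a R by (intro order_trans[OF main[OF Rp]] mult_left_mono add_mono) auto
    also have "\<dots> = I / 2" using g(3) by (simp add: \<delta>_def)
    finally show False using I by simp
  qed
  then have z: "((\<eta>1 x)\<^sup>2 - (\<xi>1 x)\<^sup>2)\<^sup>2 + ((\<eta>2 x)\<^sup>2 - (\<xi>2 x)\<^sup>2)\<^sup>2 = 0" for x
    using k(2)[of "(\<eta>1 x)\<^sup>2 - (\<xi>1 x)\<^sup>2" "(\<eta>2 x)\<^sup>2 - (\<xi>2 x)\<^sup>2"] k(1) unfolding Q_def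
    by (metis add_nonneg_nonneg antisym mult_le_0_iff not_less zero_le_power2)
  then have "\<eta>1 x = \<xi>1 x" "\<eta>2 x = \<xi>2 x" for x
    using z[of x] p[of x] power2_eq_iff_nonneg[of "\<eta>1 x" "\<xi>1 x"] power2_eq_iff_nonneg[of "\<eta>2 x" "\<xi>2 x"]
    by (simp_all add: sum_power2_eq_zero_iff)
  then show ?thesis by (simp add: pair fun_eq_iff)
qed

subsection \<open>The Dirichlet energy as a limit of difference quotients\<close>

text \<open>At \<open>t = 0\<close> the quotient is 0 by the convention for division, so upper
  bounds by Dirichlet energies hold for every real \<open>t\<close>.\<close>

definition diffq :: "'a::euclidean_space \<Rightarrow> real \<Rightarrow> ('a \<Rightarrow> 'b::{banach, second_countable_topology}) \<Rightarrow> real" where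
  "diffq b t u = (LINT x|lborel. (norm (u (x + t *\<^sub>R b) - u x))\<^sup>2) / t\<^sup>2"

definition dirichlet :: "'a::euclidean_space \<Rightarrow> ('a \<Rightarrow> 'b::{banach, second_countable_topology}) \<Rightarrow> real" where
  "dirichlet b u = (LINT x|lborel. (norm (weak_partial b u x))\<^sup>2)"

lemma locally_integrable_measurable:
  fixes f :: "'a::euclidean_space \<Rightarrow> 'b::{banach, second_countable_topology}"
  assumes "locally_integrable f"
  shows "f \<in> borel_measurable borel"
proof (rule borel_measurable_LIMSEQ_metric)
  show "(\<lambda>x. indicator (cball 0 (real n)) x *\<^sub>R f x) \<in> borel_measurable borel" for n
    using assms by (auto simp: locally_integrable_def set_integrable_def dest!: spec[of _ "cball 0 (real n)"]
        borel_measurable_integrable)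
  show "(\<lambda>n. indicator (cball 0 (real n)) x *\<^sub>R f x) \<longlonglongrightarrow> f x" for x
  proof (rule tendsto_eventually)
    obtain N where N: "norm x \<le> real N" using real_arch_simple by blast
    show "\<forall>\<^sub>F n in sequentially. indicator (cball 0 (real n)) x *\<^sub>R f x = f x"
      using eventually_ge_at_top[of N] by eventually_elim (use N in \<open>auto simp: indicator_def\<close>)
  qed
qed

lemma H1_L2: "u \<in> H1 \<Longrightarrow> u \<in> L2"
  by (simp add: H1_def)

lemma has_weak_partial_weak_partial:
  "has_weak_partial b u v \<Longrightarrow> has_weak_partial b u (weak_partial b u)"
  unfolding weak_partial_def by (metis someI)

lemma weak_partial_L2:
  fixes u :: "'a::euclidean_space \<Rightarrow> 'b::{banach, second_countable_topology}"
  assumes "has_weak_partial b u v" "v \<in> L2"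
  shows "weak_partial b u \<in> L2" "dirichlet b u = (LINT x|lborel. (norm (v x))\<^sup>2)"
proof -
  have m: "weak_partial b u \<in> borel_measurable borel"
    using has_weak_partial_weak_partial[OF assms(1)]
    by (intro locally_integrable_measurable) (simp add: has_weak_partial_def)
  have ae: "AE x in lborel. (norm (weak_partial b u x))\<^sup>2 = (norm (v x))\<^sup>2"
    using weak_partial_AE[OF assms(1)] by eventually_elim simp
  have "integrable lborel (\<lambda>x. (norm (weak_partial b u x))\<^sup>2)"
    using L2_integrable[OF assms(2)] m L2_measurable[OF assms(2)]
    by (subst integrable_cong_AE[OF _ _ ae]) auto
  then show "weak_partial b u \<in> L2" using m by (simp add: L2_def)
  show "dirichlet b u = (LINT x|lborel. (norm (v x))\<^sup>2)"
    unfolding dirichlet_def using m L2_measurable[OF assms(2)] by (intro integral_cong_AE ae) auto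
qed

lemma H1_weak_partial:
  fixes u :: "'a::euclidean_space \<Rightarrow> 'b::{banach, second_countable_topology}"
  assumes "u \<in> H1" "b \<in> Basis"
  shows "has_weak_partial b u (weak_partial b u)" "weak_partial b u \<in> L2"
proof -
  obtain v where "v \<in> L2" "has_weak_partial b u v"
    using assms by (auto simp: H1_def)
  then show "has_weak_partial b u (weak_partial b u)" "weak_partial b u \<in> L2"
    by (auto intro: has_weak_partial_weak_partial weak_partial_L2(1))
qed

lemma weak_grad_sq_integral:
  fixes u :: "'a::euclidean_space \<Rightarrow> 'b::{banach, second_countable_topology}"
  assumes "u \<in> H1"
  shows "integrable lborel (weak_grad_sq u)" "(LINT x|lborel. weak_grad_sq u x) = (\<Sum>b\<in>Basis. dirichlet b u)"
  unfolding weak_grad_sq_def[abs_def] dirichlet_def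
  using L2_integrable[OF H1_weak_partial(2)[OF assms]]
  by (auto intro!: Bochner_Integration.integrable_sum Bochner_Integration.integral_sum)

lemma dirichlet_nonneg: "0 \<le> dirichlet b u"
  by (simp add: dirichlet_def)

lemma diffq_nonneg: "0 \<le> diffq b t u"
  by (simp add: diffq_def)

lemma L2_bounded_linear:
  fixes u :: "'a::euclidean_space \<Rightarrow> complex"
  assumes "u \<in> L2"
  shows "(\<lambda>x. Re (u x)) \<in> L2" "(\<lambda>x. Im (u x)) \<in> L2"
  by (rule L2_boundI[OF L2_integrable[OF assms]];
      use L2_measurable[OF assms] in \<open>auto simp: cmod_power2\<close>)+

lemma L2_of_real:
  fixes w :: "'a::euclidean_space \<Rightarrow> real"
  shows "(\<lambda>x. complex_of_real (w x)) \<in> L2 \<longleftrightarrow> w \<in> L2"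
proof
  assume "(\<lambda>x. complex_of_real (w x)) \<in> L2"
  from L2_bounded_linear(1)[OF this] show "w \<in> L2" by simp
next
  assume "w \<in> L2"
  then show "(\<lambda>x. complex_of_real (w x)) \<in> L2" by (auto simp: L2_def)
qed

lemma integral_cmod_square:
  fixes u :: "'a::euclidean_space \<Rightarrow> complex"
  assumes "u \<in> L2"
  shows "(LINT x|lborel. (norm (u x))\<^sup>2) = (LINT x|lborel. (Re (u x))\<^sup>2) + (LINT x|lborel. (Im (u x))\<^sup>2)"
  using L2_integrable[OF L2_bounded_linear(1)[OF assms]] L2_integrable[OF L2_bounded_linear(2)[OF assms]]
  by (simp add: cmod_power2)

lemma diffq_complex:
  fixes u :: "'a::euclidean_space \<Rightarrow> complex"
  assumes "u \<in> L2"
  shows "diffq b t u = diffq b t (\<lambda>x. Re (u x)) + diffq b t (\<lambda>x. Im (u x))"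
  using integral_cmod_square[OF L2_diff[OF L2_translate[OF assms, of "t *\<^sub>R b"] assms]]
  by (simp add: diffq_def add_divide_distrib)

lemma real_diffq_le:
  fixes w v :: "'a::euclidean_space \<Rightarrow> real"
  assumes "w \<in> L2" "v \<in> L2" "has_weak_partial b w v" "b \<in> Basis"
  shows "diffq b t w \<le> (LINT x|lborel. (v x)\<^sup>2)"
proof (cases "t = 0")
  case False
  then show ?thesis
    using difference_bound_of_weak_partial[OF assms, of t]
    by (simp add: diffq_def divide_le_eq mult.commute)
qed (simp add: diffq_def)

lemma frequently_at_right_sequence:
  fixes P :: "real \<Rightarrow> bool"
  assumes "\<exists>\<^sub>F t in at_right 0. P t"
  obtains s where "\<And>n. P (s n)" "\<And>n. 0 < s n" "s \<longlonglongrightarrow> 0"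
proof -
  have "\<exists>t>0. t < inverse (real (Suc n)) \<and> P t" for n
    using assms by (auto simp: frequently_def eventually_at_right_field not_less
        dest!: spec[of _ "inverse (real (Suc n))"])
  then obtain s where s: "\<And>n. 0 < s n" "\<And>n. s n < inverse (real (Suc n))" "\<And>n. P (s n)" by metis
  have "s \<longlonglongrightarrow> 0"
    by (rule tendsto_sandwich[OF _ _ tendsto_const LIMSEQ_inverse_real_of_nat])
      (use s in \<open>auto intro!: always_eventually less_imp_le simp del: of_nat_Suc\<close>)
  then show ?thesis using that s by blast
qed

text \<open>The upper estimate is \<open>real_diffq_le\<close>. If the quotients stayed at most some
  a below the claimed limit along steps tending to 0, these steps would produce a weak derivative of
  norm at most sqrt a; uniqueness identifies it with \<open>v\<close>, a contradiction.\<close>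

lemma real_diffq_tendsto:
  fixes w v :: "'a::euclidean_space \<Rightarrow> real"
  assumes w: "w \<in> L2" and v: "v \<in> L2" and wp: "has_weak_partial b w v" and b: "b \<in> Basis"
  shows "((\<lambda>t. diffq b t w) \<longlongrightarrow> (LINT x|lborel. (v x)\<^sup>2)) (at_right 0)"
proof (rule order_tendstoI)
  fix a assume a: "a < (LINT x|lborel. (v x)\<^sup>2)"
  show "\<forall>\<^sub>F t in at_right 0. a < diffq b t w"
  proof (rule ccontr)
    assume "\<not> ?thesis"
    then have "\<exists>\<^sub>F t in at_right 0. diffq b t w \<le> a"
      by (simp add: not_eventually not_less)
    then obtain s where s: "\<And>n. diffq b (s n) w \<le> a" "\<And>n. 0 < s n" "s \<longlonglongrightarrow> 0"
      using frequently_at_right_sequence by blast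
    have a0: "0 \<le> a" using s(1)[of 0] diffq_nonneg[of b "s 0" w] by linarith
    obtain v' where v': "v' \<in> L2" "has_weak_partial b w v'" "L2_norm v' \<le> sqrt a"
    proof (rule weak_partial_of_difference_quotients[OF w b, of "sqrt a" s])
      show "(LINT x|lborel. (w (x + s n *\<^sub>R b) - w x)\<^sup>2) \<le> (sqrt a)\<^sup>2 * (s n)\<^sup>2" for n
        using s(1,2)[of n] a0 by (simp add: diffq_def divide_le_eq)
      show "s n \<noteq> 0" for n using s(2)[of n] by simp
    qed (use s(3) a0 that in auto)
    have "(LINT x|lborel. (v x)\<^sup>2) = (L2_norm v')\<^sup>2"
      using has_weak_partial_unique[OF wp v'(2)] L2_measurable[OF v] L2_measurable[OF v'(1)]
      unfolding L2_norm_power2 by (intro integral_cong_AE) auto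
    also have "\<dots> \<le> (sqrt a)\<^sup>2" by (intro power_mono v'(3) L2_norm_nonneg)
    finally show False using a a0 by simp
  qed
next
  fix a assume "(LINT x|lborel. (v x)\<^sup>2) < a"
  then show "\<forall>\<^sub>F t in at_right 0. diffq b t w < a"
    using real_diffq_le[OF assms] by (intro always_eventually) (auto intro: le_less_trans)
qed

lemma dirichlet_Re_Im:
  fixes u :: "'a::euclidean_space \<Rightarrow> complex"
  assumes u: "u \<in> H1" and b: "b \<in> Basis"
  defines "v \<equiv> weak_partial b u"
  shows "has_weak_partial b (\<lambda>x. Re (u x)) (\<lambda>x. Re (v x))" "has_weak_partial b (\<lambda>x. Im (u x)) (\<lambda>x. Im (v x))"
    "(\<lambda>x. Re (v x)) \<in> L2" "(\<lambda>x. Im (v x)) \<in> L2"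
    "dirichlet b u = (LINT x|lborel. (Re (v x))\<^sup>2) + (LINT x|lborel. (Im (v x))\<^sup>2)"
  using has_weak_partial_bounded_linear[OF bounded_linear_Re H1_weak_partial(1)[OF u b] b]
    has_weak_partial_bounded_linear[OF bounded_linear_Im H1_weak_partial(1)[OF u b] b]
    L2_bounded_linear[OF H1_weak_partial(2)[OF u b]] integral_cmod_square[OF H1_weak_partial(2)[OF u b]]
  by (simp_all add: v_def dirichlet_def)

lemma diffq_le_dirichlet:
  fixes u :: "'a::euclidean_space \<Rightarrow> complex"
  assumes u: "u \<in> H1" and b: "b \<in> Basis"
  shows "diffq b t u \<le> dirichlet b u"
  unfolding diffq_complex[OF H1_L2[OF u]] dirichlet_Re_Im(5)[OF assms]
  by (intro add_mono real_diffq_le dirichlet_Re_Im(1-4) L2_bounded_linear H1_L2 assms)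

lemma diffq_tendsto_dirichlet:
  fixes u :: "'a::euclidean_space \<Rightarrow> complex"
  assumes u: "u \<in> H1" and b: "b \<in> Basis"
  shows "((\<lambda>t. diffq b t u) \<longlongrightarrow> dirichlet b u) (at_right 0)"
  unfolding diffq_complex[OF H1_L2[OF u]] dirichlet_Re_Im(5)[OF assms]
  by (intro tendsto_add real_diffq_tendsto dirichlet_Re_Im(1-4) L2_bounded_linear H1_L2 assms)

lemma diffq_of_real: "diffq b t (\<lambda>x. complex_of_real (w x)) = diffq b t w"
  by (simp add: diffq_def flip: of_real_diff)

text \<open>The form in which \<open>H1\<close> is verified for mixed moduli and for limits of
  minimising sequences: complex functions with real values whose quotients are bounded in each
  direction.\<close>

lemma H1_of_realI:
  fixes w :: "'a::euclidean_space \<Rightarrow> real"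
  assumes w: "(\<lambda>x. complex_of_real (w x)) \<in> L2"
    and M: "\<And>b t. b \<in> Basis \<Longrightarrow> 0 < t \<Longrightarrow> diffq b t (\<lambda>x. complex_of_real (w x)) \<le> M b"
  shows "(\<lambda>x. complex_of_real (w x)) \<in> H1"
  unfolding H1_def
proof (intro CollectI conjI ballI w)
  fix b :: 'a assume b: "b \<in> Basis"
  have w2: "w \<in> L2" using w by (simp add: L2_of_real)
  have M0: "0 \<le> M b" using M[OF b, of 1] diffq_nonneg[of b 1 "\<lambda>x. complex_of_real (w x)"] by simp
  obtain v where v: "v \<in> L2" "has_weak_partial b w v"
  proof (rule weak_partial_of_difference_quotients[OF w2 b, of "sqrt (M b)" "\<lambda>n. inverse (real (Suc n))"])
    show "(LINT x|lborel. (w (x + inverse (real (Suc n)) *\<^sub>R b) - w x)\<^sup>2)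
        \<le> (sqrt (M b))\<^sup>2 * (inverse (real (Suc n)))\<^sup>2" for n
    proof -
      have "diffq b (inverse (real (Suc n))) w \<le> M b"
        using M[OF b, of "inverse (real (Suc n))"] by (simp only: diffq_of_real) simp
      then have "(LINT x|lborel. (w (x + inverse (real (Suc n)) *\<^sub>R b) - w x)\<^sup>2)
          \<le> M b * (inverse (real (Suc n)))\<^sup>2"
        unfolding diffq_def by (subst (asm) pos_divide_le_eq) auto
      then show ?thesis using M0 by simp
    qed
  qed (use LIMSEQ_inverse_real_of_nat M0 in auto)
  have "has_weak_partial b (\<lambda>x. complex_of_real (w x)) (\<lambda>x. complex_of_real (v x))"
    by (rule has_weak_partial_bounded_linear[OF bounded_linear_of_real v(2) b])
  then show "\<exists>v\<in>L2. has_weak_partial b (\<lambda>x. complex_of_real (w x)) v"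
    using v(1) L2_of_real by blast
qed

subsection \<open>Mixing densities\<close>

definition mix_pair :: "real \<Rightarrow> ('a \<Rightarrow> complex) \<Rightarrow> ('a \<Rightarrow> complex) \<Rightarrow> 'a \<Rightarrow> complex \<times> complex" where
  "mix_pair s u v x = (sqrt (1 - s) *\<^sub>R u x, sqrt s *\<^sub>R v x)"

definition mix :: "real \<Rightarrow> ('a \<Rightarrow> complex) \<Rightarrow> ('a \<Rightarrow> complex) \<Rightarrow> 'a \<Rightarrow> complex" where
  "mix s u v x = complex_of_real (norm (mix_pair s u v x))"

text \<open>The part of the difference quotient of \<open>mix_pair\<close> that comes from its
  direction, that is, the exact loss when the vector is replaced by its norm. The convention
  \<open>sgn 0 = 0\<close> does no harm, as the weight vanishes there.\<close>

definition mix_defect ::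
    "'a::euclidean_space \<Rightarrow> real \<Rightarrow> real \<Rightarrow> ('a \<Rightarrow> complex) \<Rightarrow> ('a \<Rightarrow> complex) \<Rightarrow> real" where
  "mix_defect b t s u v = (LINT x|lborel. norm (mix_pair s u v (x + t *\<^sub>R b)) * norm (mix_pair s u v x)
      * (norm (sgn (mix_pair s u v (x + t *\<^sub>R b)) - sgn (mix_pair s u v x)))\<^sup>2) / t\<^sup>2"

text \<open>The law of cosines, split into a radial and an angular part. If one of the vectors is
  zero, the weight removes the angular part.\<close>

lemma norm_diff_polar:
  fixes a b :: "'b::real_inner"
  shows "(norm (a - b))\<^sup>2 = (norm a - norm b)\<^sup>2 + norm a * norm b * (norm (sgn a - sgn b))\<^sup>2"
proof (cases "a = 0 \<or> b = 0")
  case False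
  have e: "(norm (x - y))\<^sup>2 = (norm x)\<^sup>2 + (norm y)\<^sup>2 - 2 * (x \<bullet> y)" for x y :: 'b
    unfolding power2_norm_eq_inner by (simp add: inner_diff_left inner_diff_right inner_commute)
  have "norm a * norm b * (norm (sgn a - sgn b))\<^sup>2 = 2 * (norm a * norm b) - 2 * (a \<bullet> b)"
    unfolding e using False by (simp add: norm_sgn) (simp add: sgn_div_norm field_simps)
  then show ?thesis unfolding e by (simp add: power2_diff)
qed auto

lemma mix_pair_norm:
  assumes "0 \<le> s" "s \<le> 1"
  shows "(norm (mix_pair s u v x))\<^sup>2 = (1 - s) * (norm (u x))\<^sup>2 + s * (norm (v x))\<^sup>2"
    and "(norm (mix_pair s u v y - mix_pair s u v x))\<^sup>2 = (1 - s) * (norm (u y - u x))\<^sup>2 + s * (norm (v y - v x))\<^sup>2"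
  using assms
  by (simp_all add: mix_pair_def norm_Pair power_mult_distrib flip: scaleR_diff_right)

lemma mix_pair_measurable:
  assumes "u \<in> borel_measurable borel" "v \<in> borel_measurable borel"
  shows "mix_pair s u v \<in> borel_measurable borel"
  unfolding mix_pair_def[abs_def] using assms by measurable

lemma mix_measurable:
  assumes "u \<in> borel_measurable borel" "v \<in> borel_measurable borel"
  shows "mix s u v \<in> borel_measurable borel"
  unfolding mix_def[abs_def] using mix_pair_measurable[OF assms] by measurable

lemma norm_mix: "norm (mix s u v x) = norm (mix_pair s u v x)"
  by (simp add: mix_def)

lemma norm_mix_power2:
  "0 \<le> s \<Longrightarrow> s \<le> 1 \<Longrightarrow> (norm (mix s u v x))\<^sup>2 = (1 - s) * (norm (u x))\<^sup>2 + s * (norm (v x))\<^sup>2"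
  unfolding norm_mix by (rule mix_pair_norm)

context
  fixes s :: real and u v :: "'a::euclidean_space \<Rightarrow> complex"
  assumes s: "0 \<le> s" "s \<le> 1" and uv: "u \<in> L2" "v \<in> L2"
begin

lemma mix_L2: "mix s u v \<in> L2"
  unfolding L2_def
  using mix_measurable[OF uv[THEN L2_measurable], of s] L2_integrable[OF uv(1)] L2_integrable[OF uv(2)]
  by (simp add: norm_mix_power2[OF s])

text \<open>\<open>norm_diff_polar\<close> integrated. Keeping the defect makes this an identity;
  dropping it gives convexity, and estimating it gives positivity and constancy of the
  phase.\<close>

lemma diffq_mix: "diffq b t (mix s u v) + mix_defect b t s u v = (1 - s) * diffq b t u + s * diffq b t v"
proof -
  let ?p = "mix_pair s u v" and ?y = "\<lambda>x. x + t *\<^sub>R b"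
  let ?A = "\<lambda>x. (norm (mix s u v (?y x) - mix s u v x))\<^sup>2"
  let ?B = "\<lambda>x. norm (?p (?y x)) * norm (?p x) * (norm (sgn (?p (?y x)) - sgn (?p x)))\<^sup>2"
  let ?U = "\<lambda>x. (norm (u (?y x) - u x))\<^sup>2" and ?V = "\<lambda>x. (norm (v (?y x) - v x))\<^sup>2"
  have eq: "?A x + ?B x = (1 - s) * ?U x + s * ?V x" for x
  proof -
    have "?A x = (norm (?p (?y x)) - norm (?p x))\<^sup>2"
      by (simp add: mix_def flip: of_real_diff)
    then show ?thesis using norm_diff_polar[of "?p (?y x)" "?p x"] mix_pair_norm(2)[OF s, of u v "?y x" x] by simp
  qed
  have iA: "integrable lborel ?A" by (intro L2_integrable L2_diff L2_translate mix_L2)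
  have iU: "integrable lborel ?U" "integrable lborel ?V"
    by (intro L2_integrable L2_diff L2_translate uv)+
  have iB: "integrable lborel ?B"
  proof -
    have "?B = (\<lambda>x. (1 - s) * ?U x + s * ?V x - ?A x)" using eq by (auto simp: algebra_simps)
    then show ?thesis using iA iU by simp
  qed
  have "(LINT x|lborel. ?A x) + (LINT x|lborel. ?B x) = (LINT x|lborel. ?A x + ?B x)"
    using iA iB by simp
  also have "\<dots> = (LINT x|lborel. (1 - s) * ?U x + s * ?V x)" unfolding eq ..
  also have "\<dots> = (1 - s) * (LINT x|lborel. ?U x) + s * (LINT x|lborel. ?V x)"
    using iU by simp
  finally show ?thesis
    by (simp add: diffq_def mix_defect_def add_divide_distrib[symmetric])
qed

lemma mix_defect_nonneg: "0 \<le> mix_defect b t s u v"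
  unfolding mix_defect_def by simp

lemma mix_H1:
  assumes "u \<in> H1" "v \<in> H1"
  shows "mix s u v \<in> H1"
proof -
  have "diffq b t (mix s u v) \<le> (1 - s) * dirichlet b u + s * dirichlet b v" if "b \<in> Basis" for b t
  proof -
    have "diffq b t (mix s u v) \<le> (1 - s) * diffq b t u + s * diffq b t v"
      using diffq_mix[of b t] mix_defect_nonneg[of b t] by linarith
    also have "\<dots> \<le> (1 - s) * dirichlet b u + s * dirichlet b v"
      using s that assms by (intro add_mono mult_left_mono diffq_le_dirichlet) auto
    finally show ?thesis .
  qed
  then show ?thesis
    using mix_L2 unfolding mix_def[abs_def]
    by (rule_tac H1_of_realI[where M = "\<lambda>b. (1 - s) * dirichlet b u + s * dirichlet b v"]) auto
qed

lemma mix_defect_tendsto: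
  assumes "u \<in> H1" "v \<in> H1" "b \<in> Basis"
  shows "((\<lambda>t. mix_defect b t s u v) \<longlongrightarrow> (1 - s) * dirichlet b u + s * dirichlet b v - dirichlet b (mix s u v)) (at_right 0)"
proof -
  have "mix_defect b t s u v = (1 - s) * diffq b t u + s * diffq b t v - diffq b t (mix s u v)" for t
    using diffq_mix[of b t] by simp
  then show ?thesis using assms by (auto intro!: tendsto_intros diffq_tendsto_dirichlet mix_H1)
qed

lemma dirichlet_mix_le:
  assumes "u \<in> H1" "v \<in> H1" "b \<in> Basis"
  shows "dirichlet b (mix s u v) \<le> (1 - s) * dirichlet b u + s * dirichlet b v"
  using tendsto_lowerbound[OF mix_defect_tendsto[OF assms] always_eventually trivial_limit_at_right_real]
    mix_defect_nonneg by fastforce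

end

subsection \<open>The energy functional\<close>

lemma quad_nonneg:
  assumes "g1 > 0" "g2 > 0" "g\<^sup>2 < g1 * g2"
  shows "0 \<le> quad g1 g2 g r s"
proof -
  obtain c where c: "c > 0" "\<And>r s. c * (r\<^sup>2 + s\<^sup>2) \<le> quad g1 g2 g r s"
    using quad_coercive[OF assms] by blast
  have "0 \<le> c * (r\<^sup>2 + s\<^sup>2)" using c(1) by simp
  then show ?thesis using c(2) by (rule order_trans)
qed

lemma quad_convex_combination:
  "quad g1 g2 g ((1 - s) * r + s * r') ((1 - s) * q + s * q')
    = (1 - s) * quad g1 g2 g r q + s * quad g1 g2 g r' q' - s * (1 - s) * quad g1 g2 g (r - r') (q - q')"
  by (simp add: quad_def power2_eq_square algebra_simps)

definition state :: "(real^2 \<Rightarrow> complex) \<Rightarrow> bool" where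
  "state u \<longleftrightarrow> u \<in> H1 \<and> integrable lborel (\<lambda>x. (norm x)\<^sup>2 * (norm (u x))\<^sup>2) \<and> L2_norm u = 1"

lemma H_space_iff: "(u1, u2) \<in> H_space \<longleftrightarrow> state u1 \<and> state u2"
  by (auto simp: H_space_def state_def)

lemma state_integral:
  assumes "state u"
  shows "(LINT x|lborel. (norm (u x))\<^sup>2) = 1" "u \<in> L2" "u \<in> H1" "u \<in> borel_measurable borel"
    "integrable lborel (\<lambda>x. (norm (u x))\<^sup>2)" "integrable lborel (\<lambda>x. (norm x)\<^sup>2 * (norm (u x))\<^sup>2)"
proof -
  show "u \<in> H1" "integrable lborel (\<lambda>x. (norm x)\<^sup>2 * (norm (u x))\<^sup>2)"
    using assms by (auto simp: state_def)
  then show "u \<in> L2" by (rule_tac H1_L2)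
  then show "u \<in> borel_measurable borel" "integrable lborel (\<lambda>x. (norm (u x))\<^sup>2)"
    by (rule L2_measurable, rule L2_integrable)
  show "(LINT x|lborel. (norm (u x))\<^sup>2) = 1"
    unfolding L2_norm_power2[symmetric] using assms by (simp add: state_def)
qed

lemma state_mix:
  assumes s: "0 \<le> s" "s \<le> 1" and u: "state u" and v: "state v"
  shows "state (mix s u v)"
    and "(LINT x|lborel. (norm x)\<^sup>2 * (norm (mix s u v x))\<^sup>2)
      = (1 - s) * (LINT x|lborel. (norm x)\<^sup>2 * (norm (u x))\<^sup>2) + s * (LINT x|lborel. (norm x)\<^sup>2 * (norm (v x))\<^sup>2)"
proof -
  note U = state_integral[OF u] and V = state_integral[OF v]
  have e: "(\<lambda>x. (norm x)\<^sup>2 * (norm (mix s u v x))\<^sup>2)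
      = (\<lambda>x. (1 - s) * ((norm x)\<^sup>2 * (norm (u x))\<^sup>2) + s * ((norm x)\<^sup>2 * (norm (v x))\<^sup>2))"
    by (auto simp: norm_mix_power2[OF s] algebra_simps)
  have "(LINT x|lborel. (norm (mix s u v x))\<^sup>2) = (1 - s) * 1 + s * 1"
    using U(1,5) V(1,5) by (simp add: norm_mix_power2[OF s])
  then have "L2_norm (mix s u v) = 1" by (simp add: L2_norm_def)
  then show "state (mix s u v)"
    using mix_H1[OF s U(2) V(2) U(3) V(3)] U(6) V(6) unfolding state_def e by simp
  show "(LINT x|lborel. (norm x)\<^sup>2 * (norm (mix s u v x))\<^sup>2)
      = (1 - s) * (LINT x|lborel. (norm x)\<^sup>2 * (norm (u x))\<^sup>2) + s * (LINT x|lborel. (norm x)\<^sup>2 * (norm (v x))\<^sup>2)"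
    unfolding e using U(6) V(6) by simp
qed

section \<open>The energy as a real number on pairs of finite energy\<close>

locale gross_pitaevskii =
  fixes \<epsilon> g1 g2 g :: real
  assumes pos: "0 < \<epsilon>" "0 < g1" "0 < g2" "0 < g" and det: "g\<^sup>2 < g1 * g2"
begin

definition quadratic_energy :: "(real^2 \<Rightarrow> complex) \<Rightarrow> real" where
  "quadratic_energy u = (\<Sum>b\<in>Basis. dirichlet b u) / 2
     + (LINT x|lborel. (norm x)\<^sup>2 * (norm (u x))\<^sup>2) / (2 * \<epsilon>\<^sup>2)"

text \<open>Divided by \<open>4 * \<epsilon>\<^sup>2\<close> this is the sum of the three quartic
  terms of the energy; the doubled cross term of \<open>quad\<close> matches the different prefactor
  of the coupling.\<close>

definition inter :: "(real^2 \<Rightarrow> complex) \<Rightarrow> (real^2 \<Rightarrow> complex) \<Rightarrow> real^2 \<Rightarrow> real" where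
  "inter u1 u2 x = quad g1 g2 g ((norm (u1 x))\<^sup>2) ((norm (u2 x))\<^sup>2)"

definition real_energy :: "(real^2 \<Rightarrow> complex) \<Rightarrow> (real^2 \<Rightarrow> complex) \<Rightarrow> real" where
  "real_energy u1 u2 = quadratic_energy u1 + quadratic_energy u2 + (LINT x|lborel. inter u1 u2 x) / (4 * \<epsilon>\<^sup>2)"

text \<open>The pairs of finite energy: on them the extended energy is the real number
  \<open>real_energy\<close>, on the rest of \<open>H_space\<close> it is infinite.\<close>

definition admissible :: "(real^2 \<Rightarrow> complex) \<Rightarrow> (real^2 \<Rightarrow> complex) \<Rightarrow> bool" where
  "admissible u1 u2 \<longleftrightarrow> state u1 \<and> state u2 \<and> integrable lborel (inter u1 u2)"

lemmas quad_nonneg' = quad_nonneg[OF pos(2,3) det]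

lemma inter_nonneg: "0 \<le> inter u1 u2 x"
  unfolding inter_def by (rule quad_nonneg')

lemma inter_measurable:
  assumes [measurable]: "u1 \<in> borel_measurable borel" "u2 \<in> borel_measurable borel"
  shows "inter u1 u2 \<in> borel_measurable borel"
  unfolding inter_def[abs_def] quad_def by measurable

lemma quadratic_energy_nonneg: "0 \<le> quadratic_energy u"
  unfolding quadratic_energy_def by (intro add_nonneg_nonneg divide_nonneg_nonneg sum_nonneg dirichlet_nonneg) auto

lemma real_energy_nonneg: "0 \<le> real_energy u1 u2"
  unfolding real_energy_def
  by (intro add_nonneg_nonneg divide_nonneg_nonneg quadratic_energy_nonneg Bochner_Integration.integral_nonneg inter_nonneg) auto

lemma component_energy_eq:
  assumes "state u" "0 < a"
  shows "component_energy \<epsilon> a u = ennreal (quadratic_energy u)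
    + (\<integral>\<^sup>+x. ennreal (a / (4 * \<epsilon>\<^sup>2) * (norm (u x)) ^ 4) \<partial>lborel)"
proof -
  note U = state_integral[OF assms(1)]
  let ?f = "\<lambda>x. weak_grad_sq u x / 2 + (norm x)\<^sup>2 / (2 * \<epsilon>\<^sup>2) * (norm (u x))\<^sup>2"
  have w: "integrable lborel (weak_grad_sq u)" "0 \<le> weak_grad_sq u x" for x
    using weak_grad_sq_integral(1)[OF U(3)] by (auto simp: weak_grad_sq_def sum_nonneg)
  have e: "?f = (\<lambda>x. weak_grad_sq u x / 2 + ((norm x)\<^sup>2 * (norm (u x))\<^sup>2) / (2 * \<epsilon>\<^sup>2))" by auto
  have f: "integrable lborel ?f" unfolding e using w(1) U(6) by simp
  have "(LINT x|lborel. ?f x) = quadratic_energy u"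
    unfolding e quadratic_energy_def weak_grad_sq_integral(2)[OF U(3), symmetric]
    using w(1) U(6) by simp
  moreover have f0: "0 \<le> ?f x" for x using w(2)[of x] by simp
  ultimately have "(\<integral>\<^sup>+x. ennreal (?f x) \<partial>lborel) = ennreal (quadratic_energy u)"
    using nn_integral_eq_integral[OF f] by simp
  moreover have "component_energy \<epsilon> a u = (\<integral>\<^sup>+x. ennreal (?f x) + ennreal (a / (4 * \<epsilon>\<^sup>2) * (norm (u x)) ^ 4) \<partial>lborel)"
    unfolding component_energy_def
    using f0 assms(2) by (intro nn_integral_cong ennreal_plus) auto
  ultimately show ?thesis
    using borel_measurable_integrable[OF f] U(4) by (simp add: nn_integral_add)
qed

lemma energy_eq:
  assumes "state u1" "state u2"
  shows "energy \<epsilon> g1 g2 g (u1, u2) = ennreal (quadratic_energy u1 + quadratic_energy u2)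
    + (\<integral>\<^sup>+x. ennreal (inter u1 u2 x / (4 * \<epsilon>\<^sup>2)) \<partial>lborel)"
proof -
  note [measurable] = state_integral(4)[OF assms(1)] state_integral(4)[OF assms(2)]
  let ?A = "\<lambda>x. g1 / (4 * \<epsilon>\<^sup>2) * (norm (u1 x)) ^ 4" and ?B = "\<lambda>x. g2 / (4 * \<epsilon>\<^sup>2) * (norm (u2 x)) ^ 4"
    and ?C = "\<lambda>x. g / (2 * \<epsilon>\<^sup>2) * ((norm (u1 x))\<^sup>2 * (norm (u2 x))\<^sup>2)"
  have "ennreal (inter u1 u2 x / (4 * \<epsilon>\<^sup>2)) = ennreal (?A x) + ennreal (?B x) + ennreal (?C x)" for x
  proof -
    have "inter u1 u2 x / (4 * \<epsilon>\<^sup>2) = ?A x + ?B x + ?C x"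
      using pos by (simp add: inter_def quad_def field_simps power2_eq_square power4_eq_xxxx)
    then show ?thesis using pos by (simp add: ennreal_plus)
  qed
  then have "(\<integral>\<^sup>+x. ennreal (inter u1 u2 x / (4 * \<epsilon>\<^sup>2)) \<partial>lborel)
      = (\<integral>\<^sup>+x. ennreal (?A x) \<partial>lborel) + (\<integral>\<^sup>+x. ennreal (?B x) \<partial>lborel) + (\<integral>\<^sup>+x. ennreal (?C x) \<partial>lborel)"
    by (simp add: nn_integral_add)
  also have "(\<integral>\<^sup>+x. ennreal (?C x) \<partial>lborel)
      = ennreal (g / (2 * \<epsilon>\<^sup>2)) * (\<integral>\<^sup>+x. ennreal ((norm (u1 x))\<^sup>2 * (norm (u2 x))\<^sup>2) \<partial>lborel)"
  proof -
    have "(\<integral>\<^sup>+x. ennreal (?C x) \<partial>lborel)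
        = (\<integral>\<^sup>+x. ennreal (g / (2 * \<epsilon>\<^sup>2)) * ennreal ((norm (u1 x))\<^sup>2 * (norm (u2 x))\<^sup>2) \<partial>lborel)"
      using pos by (intro nn_integral_cong ennreal_mult) auto
    then show ?thesis by (simp add: nn_integral_cmult)
  qed
  finally show ?thesis
    unfolding energy_def prod.case component_energy_eq[OF assms(1) pos(2)] component_energy_eq[OF assms(2) pos(3)]
    using quadratic_energy_nonneg by (simp add: ennreal_plus add_ac)
qed

lemma energy_admissible:
  assumes "admissible u1 u2"
  shows "energy \<epsilon> g1 g2 g (u1, u2) = ennreal (real_energy u1 u2)"
proof -
  have s: "state u1" "state u2" and i: "integrable lborel (inter u1 u2)"
    using assms by (auto simp: admissible_def)
  have "(\<integral>\<^sup>+x. ennreal (inter u1 u2 x / (4 * \<epsilon>\<^sup>2)) \<partial>lborel) = ennreal (LINT x|lborel. inter u1 u2 x / (4 * \<epsilon>\<^sup>2))"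
    using i inter_nonneg by (intro nn_integral_eq_integral) auto
  moreover have "0 \<le> (LINT x|lborel. inter u1 u2 x / (4 * \<epsilon>\<^sup>2))"
    using inter_nonneg by (intro Bochner_Integration.integral_nonneg) simp
  ultimately show ?thesis
    using quadratic_energy_nonneg[of u1] quadratic_energy_nonneg[of u2]
    by (simp add: energy_eq[OF s] real_energy_def ennreal_plus)
qed

lemma energy_not_admissible:
  assumes "(u1, u2) \<in> H_space" "\<not> admissible u1 u2"
  shows "energy \<epsilon> g1 g2 g (u1, u2) = \<infinity>"
proof -
  have s: "state u1" "state u2" using assms(1) by (auto simp: H_space_iff)
  have "(\<integral>\<^sup>+x. ennreal (inter u1 u2 x / (4 * \<epsilon>\<^sup>2)) \<partial>lborel) = \<infinity>"
  proof (rule ccontr)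
    assume "\<not> ?thesis"
    then have "integrable lborel (\<lambda>x. inter u1 u2 x / (4 * \<epsilon>\<^sup>2))"
      using inter_nonneg inter_measurable[OF state_integral(4)[OF s(1)] state_integral(4)[OF s(2)]]
      by (intro integrableI_nonneg) (auto simp: top.not_eq_extremum)
    then have "integrable lborel (\<lambda>x. 4 * \<epsilon>\<^sup>2 * (inter u1 u2 x / (4 * \<epsilon>\<^sup>2)))" by (rule integrable_mult_right)
    then have "integrable lborel (inter u1 u2)" using pos by simp
    then show False using assms(2) s by (simp add: admissible_def)
  qed
  then show ?thesis unfolding energy_eq[OF s] by simp
qed

lemma admissible_H_space: "admissible u1 u2 \<Longrightarrow> (u1, u2) \<in> H_space"
  by (simp add: admissible_def H_space_iff)

text \<open>One admissible pair is assumed so that a minimizer has finite energy and is itself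
  admissible. From here on only real numbers are compared.\<close>

lemma minimizer_iff:
  assumes "admissible w1 w2"
  shows "minimizer \<epsilon> g1 g2 g (u1, u2) \<longleftrightarrow>
    admissible u1 u2 \<and> (\<forall>v1 v2. admissible v1 v2 \<longrightarrow> real_energy u1 u2 \<le> real_energy v1 v2)"
proof
  assume m: "minimizer \<epsilon> g1 g2 g (u1, u2)"
  then have H: "(u1, u2) \<in> H_space" and le: "\<And>v1 v2. (v1, v2) \<in> H_space \<Longrightarrow> energy \<epsilon> g1 g2 g (u1, u2) \<le> energy \<epsilon> g1 g2 g (v1, v2)"
    by (auto simp: minimizer_def)
  have "energy \<epsilon> g1 g2 g (u1, u2) \<noteq> \<infinity>"
    using le[OF admissible_H_space[OF assms]] energy_admissible[OF assms] by (auto simp: top_unique)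
  then have a: "admissible u1 u2" using energy_not_admissible[OF H] by blast
  moreover have "real_energy u1 u2 \<le> real_energy v1 v2" if "admissible v1 v2" for v1 v2
    using le[OF admissible_H_space[OF that]] energy_admissible[OF that] energy_admissible[OF a] real_energy_nonneg[of v1 v2]
    by (simp add: ennreal_le_iff)
  ultimately show "admissible u1 u2 \<and> (\<forall>v1 v2. admissible v1 v2 \<longrightarrow> real_energy u1 u2 \<le> real_energy v1 v2)" by blast
next
  assume a: "admissible u1 u2 \<and> (\<forall>v1 v2. admissible v1 v2 \<longrightarrow> real_energy u1 u2 \<le> real_energy v1 v2)"
  show "minimizer \<epsilon> g1 g2 g (u1, u2)"
    unfolding minimizer_def
  proof (intro conjI ballI)
    show "(u1, u2) \<in> H_space" using a admissible_H_space by blast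
    fix v assume v: "v \<in> H_space"
    obtain v1 v2 where [simp]: "v = (v1, v2)" by (cases v)
    show "energy \<epsilon> g1 g2 g (u1, u2) \<le> energy \<epsilon> g1 g2 g v"
    proof (cases "admissible v1 v2")
      case True
      then show ?thesis using a energy_admissible by (simp add: ennreal_leI)
    next
      case False
      then show ?thesis using energy_not_admissible v by simp
    qed
  qed
qed

text \<open>Coercivity of the form bounds the fourth powers of both moduli by a multiple of
  \<open>inter\<close>.\<close>

lemma admissible_quartic:
  assumes "admissible u1 u2"
  shows "(\<lambda>x. (norm (u1 x))\<^sup>2) \<in> L2" "(\<lambda>x. (norm (u2 x))\<^sup>2) \<in> L2"
proof -
  obtain k where k: "k > 0" "\<And>r s. k * (r\<^sup>2 + s\<^sup>2) \<le> quad g1 g2 g r s"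
    using quad_coercive[OF pos(2,3) det] by blast
  have i: "integrable lborel (\<lambda>x. inter u1 u2 x / k)" and m: "u1 \<in> borel_measurable borel" "u2 \<in> borel_measurable borel"
    using assms by (auto simp: admissible_def state_integral)
  have "((norm (u1 x))\<^sup>2)\<^sup>2 + ((norm (u2 x))\<^sup>2)\<^sup>2 \<le> inter u1 u2 x / k" for x
    using k(2)[of "(norm (u1 x))\<^sup>2" "(norm (u2 x))\<^sup>2"] k(1) by (simp add: inter_def field_simps)
  then have "(norm ((norm (u1 x))\<^sup>2))\<^sup>2 \<le> inter u1 u2 x / k" "(norm ((norm (u2 x))\<^sup>2))\<^sup>2 \<le> inter u1 u2 x / k" for x
    unfolding real_norm_def power2_abs by (smt (verit) zero_le_power2)+
  then show "(\<lambda>x. (norm (u1 x))\<^sup>2) \<in> L2" "(\<lambda>x. (norm (u2 x))\<^sup>2) \<in> L2"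
    using m by (auto intro!: L2_boundI[OF i])
qed

text \<open>Mass and trap energy are linear in the densities, so convexity has only two sources: the
  Dirichlet defects and the form of the density differences with factor s (1 - s). The equation
  retains both: uniqueness of the moduli draws on the second, positivity and phases on the
  first.\<close>

lemma real_energy_mix:
  assumes s: "0 \<le> s" "s \<le> 1" and u: "admissible u1 u2" and v: "admissible v1 v2"
  shows "admissible (mix s u1 v1) (mix s u2 v2)"
    and "integrable lborel (\<lambda>x. quad g1 g2 g ((norm (u1 x))\<^sup>2 - (norm (v1 x))\<^sup>2) ((norm (u2 x))\<^sup>2 - (norm (v2 x))\<^sup>2))"
    and "real_energy (mix s u1 v1) (mix s u2 v2)
      + (\<Sum>b\<in>Basis. (1 - s) * dirichlet b u1 + s * dirichlet b v1 - dirichlet b (mix s u1 v1)) / 2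
      + (\<Sum>b\<in>Basis. (1 - s) * dirichlet b u2 + s * dirichlet b v2 - dirichlet b (mix s u2 v2)) / 2
      + s * (1 - s) * (LINT x|lborel. quad g1 g2 g ((norm (u1 x))\<^sup>2 - (norm (v1 x))\<^sup>2) ((norm (u2 x))\<^sup>2 - (norm (v2 x))\<^sup>2)) / (4 * \<epsilon>\<^sup>2)
      = (1 - s) * real_energy u1 u2 + s * real_energy v1 v2"
proof -
  let ?d = "\<lambda>x. quad g1 g2 g ((norm (u1 x))\<^sup>2 - (norm (v1 x))\<^sup>2) ((norm (u2 x))\<^sup>2 - (norm (v2 x))\<^sup>2)"
  have st: "state u1" "state u2" "state v1" "state v2" and i: "integrable lborel (inter u1 u2)" "integrable lborel (inter v1 v2)"
    using u v by (auto simp: admissible_def)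
  note [measurable] = st[THEN state_integral(4)]
  have e: "inter (mix s u1 v1) (mix s u2 v2) x = (1 - s) * inter u1 u2 x + s * inter v1 v2 x - s * (1 - s) * ?d x"
    if "0 \<le> s" "s \<le> 1" for s x
    unfolding inter_def norm_mix_power2[OF that] by (rule quad_convex_combination)
  have d0: "0 \<le> ?d x" for x by (rule quad_nonneg')
  show id: "integrable lborel ?d"
  proof (rule Bochner_Integration.integrable_bound)
    show "integrable lborel (\<lambda>x. 2 * inter u1 u2 x + 2 * inter v1 v2 x)" using i by simp
    show "?d \<in> borel_measurable lborel" unfolding quad_def by measurable
    \<comment> \<open>At s = 1/2 the mixed interaction is half the sum of the two interactions minus
      a quarter of \<open>?d\<close>, and it is nonnegative.\<close>
    have "norm (?d x) \<le> norm (2 * inter u1 u2 x + 2 * inter v1 v2 x)" for x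
      using e[of "1/2" x] inter_nonneg[of "mix (1/2) u1 v1" "mix (1/2) u2 v2" x] inter_nonneg[of u1 u2 x]
        inter_nonneg[of v1 v2 x] d0[of x] by simp
    then show "AE x in lborel. norm (?d x) \<le> norm (2 * inter u1 u2 x + 2 * inter v1 v2 x)" by simp
  qed
  have im: "integrable lborel (inter (mix s u1 v1) (mix s u2 v2))"
    using i id by (simp add: e[OF s, abs_def])
  then show "admissible (mix s u1 v1) (mix s u2 v2)"
    using st s by (simp add: admissible_def state_mix(1))
  have "(LINT x|lborel. inter (mix s u1 v1) (mix s u2 v2) x)
      = (1 - s) * (LINT x|lborel. inter u1 u2 x) + s * (LINT x|lborel. inter v1 v2 x) - s * (1 - s) * (LINT x|lborel. ?d x)"
    using i id by (simp add: e[OF s])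
  then have e': "(LINT x|lborel. inter (mix s u1 v1) (mix s u2 v2) x) / (4 * \<epsilon>\<^sup>2)
      = (1 - s) * ((LINT x|lborel. inter u1 u2 x) / (4 * \<epsilon>\<^sup>2)) + s * ((LINT x|lborel. inter v1 v2 x) / (4 * \<epsilon>\<^sup>2))
        - s * (1 - s) * (LINT x|lborel. ?d x) / (4 * \<epsilon>\<^sup>2)"
    by (simp add: add_divide_distrib diff_divide_distrib)
  show "real_energy (mix s u1 v1) (mix s u2 v2)
      + (\<Sum>b\<in>Basis. (1 - s) * dirichlet b u1 + s * dirichlet b v1 - dirichlet b (mix s u1 v1)) / 2
      + (\<Sum>b\<in>Basis. (1 - s) * dirichlet b u2 + s * dirichlet b v2 - dirichlet b (mix s u2 v2)) / 2
      + s * (1 - s) * (LINT x|lborel. ?d x) / (4 * \<epsilon>\<^sup>2)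
      = (1 - s) * real_energy u1 u2 + s * real_energy v1 v2"
    unfolding real_energy_def quadratic_energy_def state_mix(2)[OF s st(1,3)] state_mix(2)[OF s st(2,4)] e'
    by (simp add: sum_subtractf sum.distrib sum_distrib_left[symmetric] add_divide_distrib diff_divide_distrib algebra_simps)
qed

lemma real_energy_mix_le:
  assumes s: "0 \<le> s" "s \<le> 1" and u: "admissible u1 u2" and v: "admissible v1 v2"
  shows "real_energy (mix s u1 v1) (mix s u2 v2) \<le> (1 - s) * real_energy u1 u2 + s * real_energy v1 v2
      - s * (1 - s) * (LINT x|lborel. quad g1 g2 g ((norm (u1 x))\<^sup>2 - (norm (v1 x))\<^sup>2) ((norm (u2 x))\<^sup>2 - (norm (v2 x))\<^sup>2)) / (4 * \<epsilon>\<^sup>2)"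
proof -
  have st: "state u1" "state u2" "state v1" "state v2" using u v by (auto simp: admissible_def)
  have "0 \<le> (\<Sum>b\<in>Basis. (1 - s) * dirichlet b u1 + s * dirichlet b v1 - dirichlet b (mix s u1 v1))"
    "0 \<le> (\<Sum>b\<in>Basis. (1 - s) * dirichlet b u2 + s * dirichlet b v2 - dirichlet b (mix s u2 v2))"
    using dirichlet_mix_le[OF s state_integral(2)[OF st(1)] state_integral(2)[OF st(3)] state_integral(3)[OF st(1)] state_integral(3)[OF st(3)]]
      dirichlet_mix_le[OF s state_integral(2)[OF st(2)] state_integral(2)[OF st(4)] state_integral(3)[OF st(2)] state_integral(3)[OF st(4)]]
    by (auto intro!: sum_nonneg)
  then show ?thesis using real_energy_mix(3)[OF assms] by linarith
qed

text \<open>The midpoint mixture would lie strictly below the minimum unless the integral of the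
  form of the density differences vanished; the form is positive definite.\<close>

lemma minimizers_same_modulus:
  assumes u: "admissible u1 u2" and v: "admissible v1 v2"
    and min: "\<And>w1 w2. admissible w1 w2 \<Longrightarrow> real_energy u1 u2 \<le> real_energy w1 w2"
    and eq: "real_energy v1 v2 = real_energy u1 u2"
  shows "AE x in lborel. norm (u1 x) = norm (v1 x) \<and> norm (u2 x) = norm (v2 x)"
proof -
  let ?d = "\<lambda>x. quad g1 g2 g ((norm (u1 x))\<^sup>2 - (norm (v1 x))\<^sup>2) ((norm (u2 x))\<^sup>2 - (norm (v2 x))\<^sup>2)"
  have s: "0 \<le> (1/2::real)" "(1/2::real) \<le> 1" by auto
  obtain k where k: "k > 0" "\<And>r s. k * (r\<^sup>2 + s\<^sup>2) \<le> quad g1 g2 g r s"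
    using quad_coercive[OF pos(2,3) det] by blast
  have "real_energy u1 u2 \<le> real_energy (mix (1/2) u1 v1) (mix (1/2) u2 v2)"
    by (intro min real_energy_mix(1)[OF s u v])
  also have "\<dots> \<le> real_energy u1 u2 - (1/4) * (LINT x|lborel. ?d x) / (4 * \<epsilon>\<^sup>2)"
    using real_energy_mix_le[OF s u v] eq by simp
  finally have "(LINT x|lborel. ?d x) / (4 * \<epsilon>\<^sup>2) \<le> 0" by simp
  then have "(LINT x|lborel. ?d x) \<le> 0" using pos by (simp add: divide_le_0_iff)
  moreover have "0 \<le> (LINT x|lborel. ?d x)" by (intro Bochner_Integration.integral_nonneg quad_nonneg')
  ultimately have "(LINT x|lborel. ?d x) = 0" by simp
  then have "AE x in lborel. ?d x = 0"
    using integral_nonneg_eq_0_iff_AE[OF real_energy_mix(2)[OF s u v]] quad_nonneg' by simp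
  then show ?thesis
  proof eventually_elim
    case (elim x)
    then have "((norm (u1 x))\<^sup>2 - (norm (v1 x))\<^sup>2)\<^sup>2 + ((norm (u2 x))\<^sup>2 - (norm (v2 x))\<^sup>2)\<^sup>2 \<le> 0"
      using k(2)[of "(norm (u1 x))\<^sup>2 - (norm (v1 x))\<^sup>2" "(norm (u2 x))\<^sup>2 - (norm (v2 x))\<^sup>2"] k(1)
      by (simp add: mult_le_0_iff)
    then have "(norm (u1 x))\<^sup>2 = (norm (v1 x))\<^sup>2" "(norm (u2 x))\<^sup>2 = (norm (v2 x))\<^sup>2"
      by (auto simp: sum_power2_le_zero_iff)
    then show ?case by (simp add: power2_eq_iff_nonneg)
  qed
qed

end

subsection \<open>Compactly supported states\<close>

lemma has_weak_partial_test_function: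
  assumes \<phi>: "test_function \<phi>" and b: "b \<in> Basis"
  shows "has_weak_partial b \<phi> (partial b \<phi>)"
  unfolding has_weak_partial_def
proof (intro conjI allI impI)
  have c: "continuous_on UNIV \<phi>" "continuous_on UNIV (partial b \<phi>)"
    using test_function_continuous[OF \<phi>] test_function_partial_continuous[OF \<phi> b] .
  then show l: "locally_integrable \<phi>" "locally_integrable (partial b \<phi>)"
    by (auto intro: continuous_imp_locally_integrable)
  fix \<psi> :: "'a \<Rightarrow> real" assume \<psi>: "test_function \<psi>"
  obtain K where K: "compact K" "\<And>x. x \<notin> K \<Longrightarrow> \<phi> x = 0"
    using test_function_support[OF \<phi>] by blast
  have c': "continuous_on UNIV \<psi>" "continuous_on UNIV (partial b \<psi>)"
    using test_function_continuous[OF \<psi>] test_function_partial_continuous[OF \<psi> b] .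
  have "(LINT x|lborel. partial b \<psi> x * \<phi> x + \<psi> x * partial b \<phi> x) = 0"
  proof (rule integral_dirderiv_eq_0[of "\<lambda>x. \<psi> x * \<phi> x" b])
    show "((\<lambda>s. \<psi> (x + s *\<^sub>R b) * \<phi> (x + s *\<^sub>R b)) has_real_derivative
        partial b \<psi> x * \<phi> x + \<psi> x * partial b \<phi> x) (at 0)" for x
      using DERIV_mult[OF test_function_dirderiv[OF \<psi>] test_function_dirderiv[OF \<phi>], of x b x b]
      by (simp add: mult.commute add.commute)
  qed (use K c c' in \<open>auto intro!: continuous_intros\<close>)
  moreover have "integrable lborel (\<lambda>x. partial b \<psi> x * \<phi> x)" "integrable lborel (\<lambda>x. \<psi> x * partial b \<phi> x)"
    using integrable_test_mult[OF l(1) test_function_partial[OF \<psi> b]] integrable_test_mult[OF l(2) \<psi>] by simp_all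
  ultimately show "(LINT x|lborel. partial b \<psi> x *\<^sub>R \<phi> x) = - (LINT x|lborel. \<psi> x *\<^sub>R partial b \<phi> x)"
    by simp
qed

lemma test_function_H1:
  assumes \<phi>: "test_function \<phi>"
  shows "(\<lambda>x. complex_of_real (\<phi> x)) \<in> H1"
  unfolding H1_def
proof (intro CollectI conjI ballI)
  show "(\<lambda>x. complex_of_real (\<phi> x)) \<in> L2" using test_function_L2[OF \<phi>] by (simp add: L2_of_real)
  fix b :: 'a assume b: "b \<in> Basis"
  have "has_weak_partial b (\<lambda>x. complex_of_real (\<phi> x)) (\<lambda>x. complex_of_real (partial b \<phi> x))"
    by (rule has_weak_partial_bounded_linear[OF bounded_linear_of_real has_weak_partial_test_function[OF \<phi> b] b])
  moreover have "(\<lambda>x. complex_of_real (partial b \<phi> x)) \<in> L2"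
    using test_function_L2[OF test_function_partial[OF \<phi> b]] by (simp add: L2_of_real)
  ultimately show "\<exists>v\<in>L2. has_weak_partial b (\<lambda>x. complex_of_real (\<phi> x)) v" by blast
qed

text \<open>A bump normalised to mass one. Its boundedness makes interactions integrable, and its
  positivity on a prescribed box controls directions near zeros of a minimizer.\<close>

lemma bump_state:
  fixes a b :: "real^2"
  assumes ne: "box a b \<noteq> {}"
  obtains \<phi> M where "test_function \<phi>" "\<And>x. x \<in> box a b \<Longrightarrow> 0 < \<phi> x" "\<And>x. 0 \<le> \<phi> x"
    "\<And>x. \<phi> x \<le> M" "state (\<lambda>x. complex_of_real (\<phi> x))"
proof -
  let ?f = "bump 1 a b"
  have f: "test_function ?f" by (rule test_function_bump) simp
  have pos: "L2_norm ?f > 0"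
  proof (rule ccontr)
    assume "\<not> ?thesis"
    then have "(LINT x|lborel. (?f x)\<^sup>2) = 0"
      using L2_norm_power2[of ?f] L2_norm_nonneg[of ?f] by simp
    then have "AE x in lborel. (?f x)\<^sup>2 = 0"
      using integral_nonneg_eq_0_iff_AE[of lborel "\<lambda>x. (?f x)\<^sup>2"] L2_integrable[OF test_function_L2[OF f]] by simp
    then have "AE x in lborel. x \<notin> box a b"
      by eventually_elim (use bump_pos[of 1 a b] in force)
    then have "box a b \<in> null_sets lborel" by (subst (asm) AE_iff_null) auto
    then have "negligible (box a b)" by (simp add: negligible_iff_null_sets null_sets_completionI)
    then show False using open_not_negligible[OF open_box ne] by blast
  qed
  define \<phi> where "\<phi> = (\<lambda>x. inverse (L2_norm ?f) * ?f x)"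
  have t: "test_function \<phi>" unfolding \<phi>_def using f by (rule test_function_cmult)
  have "L2_norm \<phi> = 1"
  proof -
    have "(LINT x|lborel. (\<phi> x)\<^sup>2) = (inverse (L2_norm ?f))\<^sup>2 * (L2_norm ?f)\<^sup>2"
      by (simp add: \<phi>_def power_mult_distrib L2_norm_power2)
    also have "\<dots> = 1" using pos by (simp flip: power_mult_distrib)
    finally show ?thesis by (simp add: L2_norm_def)
  qed
  then have n: "L2_norm (\<lambda>x. complex_of_real (\<phi> x)) = 1" by (simp add: L2_norm_def)
  obtain K where K: "compact K" "\<And>x. x \<notin> K \<Longrightarrow> \<phi> x = 0"
    using test_function_support[OF t] by blast
  have "integrable lborel (\<lambda>x. (norm x)\<^sup>2 * (\<phi> x)\<^sup>2)"
    using K test_function_continuous[OF t]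
    by (intro integrable_continuous_compact_support[of _ K] continuous_intros) auto
  then have "state (\<lambda>x. complex_of_real (\<phi> x))"
    using n test_function_H1[OF t] by (simp add: state_def)
  moreover have "0 < \<phi> x" if "x \<in> box a b" for x
    using pos that bump_pos[of 1 a b x] by (simp add: \<phi>_def)
  moreover have "0 \<le> \<phi> x" "\<phi> x \<le> inverse (L2_norm ?f)" for x
    using pos bump_bounds[of 1 a b x] by (auto simp: \<phi>_def mult_left_le)
  ultimately show ?thesis using that t by blast
qed

context gross_pitaevskii
begin

text \<open>Boundedness of \<open>\<phi>\<close> reduces both terms containing it to masses, so that
  only the fourth power of \<open>norm (u x)\<close> needs a hypothesis of its own.\<close>

lemma admissible_bounded_state:
  assumes \<phi>: "state (\<lambda>x. complex_of_real (\<phi> x))" "\<And>x. 0 \<le> \<phi> x" "\<And>x. \<phi> x \<le> M"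
    and u: "state u" "(\<lambda>x. (norm (u x))\<^sup>2) \<in> L2"
  shows "admissible (\<lambda>x. complex_of_real (\<phi> x)) u"
  unfolding admissible_def
proof (intro conjI \<phi> u)
  note [measurable] = state_integral(4)[OF \<phi>(1)] state_integral(4)[OF u(1)]
  note i = state_integral(5)[OF \<phi>(1)] state_integral(5)[OF u(1)] L2_integrable[OF u(2)]
  let ?w = "\<lambda>x. g1 * M\<^sup>2 * (norm (complex_of_real (\<phi> x)))\<^sup>2 + 2 * g * M\<^sup>2 * (norm (u x))\<^sup>2 + g2 * (norm ((norm (u x))\<^sup>2))\<^sup>2"
  show "integrable lborel (inter (\<lambda>x. complex_of_real (\<phi> x)) u)"
  proof (rule Bochner_Integration.integrable_bound)
    show "integrable lborel ?w" using i by simp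
    show "inter (\<lambda>x. complex_of_real (\<phi> x)) u \<in> borel_measurable lborel"
      using inter_measurable[OF state_integral(4)[OF \<phi>(1)] state_integral(4)[OF u(1)]] by simp
    have "norm (inter (\<lambda>x. complex_of_real (\<phi> x)) u x) \<le> norm (?w x)" for x
    proof -
      have M: "(\<phi> x)\<^sup>2 \<le> M\<^sup>2" using \<phi>(2,3)[of x] by (intro power_mono) auto
      have "inter (\<lambda>x. complex_of_real (\<phi> x)) u x
          = g1 * ((\<phi> x)\<^sup>2 * (\<phi> x)\<^sup>2) + 2 * g * ((\<phi> x)\<^sup>2 * (norm (u x))\<^sup>2) + g2 * ((norm (u x))\<^sup>2)\<^sup>2"
        by (simp add: inter_def quad_def power2_eq_square[of "(\<phi> x)\<^sup>2"])
      also have "\<dots> \<le> g1 * (M\<^sup>2 * (\<phi> x)\<^sup>2) + 2 * g * (M\<^sup>2 * (norm (u x))\<^sup>2) + g2 * ((norm (u x))\<^sup>2)\<^sup>2"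
        using pos M by (intro add_mono mult_left_mono mult_right_mono order_refl) auto
      finally have "inter (\<lambda>x. complex_of_real (\<phi> x)) u x \<le> ?w x" by (simp add: mult_ac)
      then show ?thesis using inter_nonneg[of "\<lambda>x. complex_of_real (\<phi> x)" u x] by simp
    qed
    then show "AE x in lborel. norm (inter (\<lambda>x. complex_of_real (\<phi> x)) u x) \<le> norm (?w x)" by simp
  qed
qed

lemma admissible_nonempty: "\<exists>u1 u2. admissible u1 u2"
proof -
  have "box (- One) (One::real^2) \<noteq> {}" by (simp add: box_ne_empty)
  then obtain \<phi> M where \<phi>: "test_function \<phi>" "\<And>x. 0 \<le> \<phi> x" "\<And>x. \<phi> x \<le> M" "state (\<lambda>x. complex_of_real (\<phi> x))"
    using bump_state by metis
  have "(\<lambda>x. (norm (complex_of_real (\<phi> x)))\<^sup>2) \<in> L2"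
  proof (rule L2_boundI)
    show "integrable lborel (\<lambda>x. M\<^sup>2 * (norm (complex_of_real (\<phi> x)))\<^sup>2)"
      using state_integral(5)[OF \<phi>(4)] by simp
    show "(\<lambda>x. (norm (complex_of_real (\<phi> x)))\<^sup>2) \<in> borel_measurable borel"
      using state_integral(4)[OF \<phi>(4)] by measurable
    show "(norm ((norm (complex_of_real (\<phi> x)))\<^sup>2))\<^sup>2 \<le> M\<^sup>2 * (norm (complex_of_real (\<phi> x)))\<^sup>2" for x
    proof -
      have "(\<phi> x)\<^sup>2 \<le> M\<^sup>2" using \<phi>(2,3)[of x] by (intro power_mono) auto
      then have "(\<phi> x)\<^sup>2 * (\<phi> x)\<^sup>2 \<le> M\<^sup>2 * (\<phi> x)\<^sup>2" by (intro mult_right_mono) auto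
      also have "(\<phi> x)\<^sup>2 * (\<phi> x)\<^sup>2 = (norm ((norm (complex_of_real (\<phi> x)))\<^sup>2))\<^sup>2"
        by (simp flip: power_mult power_add)
      finally show ?thesis by simp
    qed
  qed
  then show ?thesis using admissible_bounded_state[OF \<phi>(4,2,3,4)] by blast
qed

end

subsection \<open>Existence of a minimizer\<close>

context gross_pitaevskii
begin

text \<open>The quadratic energy density with the gradient replaced by difference quotients of fixed
  step. Unlike a weak gradient it converges pointwise along an almost everywhere convergent
  sequence, so Fatou's lemma applies.\<close>

definition diffq_density :: "real \<Rightarrow> (real^2 \<Rightarrow> complex) \<Rightarrow> real^2 \<Rightarrow> real" where
  "diffq_density t u x = (\<Sum>b\<in>Basis. (norm (u (x + t *\<^sub>R b) - u x))\<^sup>2) / (2 * t\<^sup>2)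
     + ((norm x)\<^sup>2 * (norm (u x))\<^sup>2) / (2 * \<epsilon>\<^sup>2)"

lemma diffq_density_nonneg: "0 \<le> diffq_density t u x"
  unfolding diffq_density_def by (intro add_nonneg_nonneg divide_nonneg_nonneg sum_nonneg) auto

lemma diffq_density_integral:
  assumes "u \<in> L2" "integrable lborel (\<lambda>x. (norm x)\<^sup>2 * (norm (u x))\<^sup>2)"
  shows "integrable lborel (diffq_density t u)"
    and "(LINT x|lborel. diffq_density t u x)
      = (\<Sum>b\<in>Basis. diffq b t u) / 2 + (LINT x|lborel. (norm x)\<^sup>2 * (norm (u x))\<^sup>2) / (2 * \<epsilon>\<^sup>2)"
proof -
  have d: "integrable lborel (\<lambda>x. (norm (u (x + t *\<^sub>R b) - u x))\<^sup>2)" for b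
    by (intro L2_integrable L2_diff L2_translate assms)
  show "integrable lborel (diffq_density t u)"
    unfolding diffq_density_def[abs_def] using d assms(2) by simp
  show "(LINT x|lborel. diffq_density t u x)
      = (\<Sum>b\<in>Basis. diffq b t u) / 2 + (LINT x|lborel. (norm x)\<^sup>2 * (norm (u x))\<^sup>2) / (2 * \<epsilon>\<^sup>2)"
    unfolding diffq_density_def diffq_def using d assms(2)
    by (simp add: sum_divide_distrib mult.commute)
qed

lemma diffq_density_le:
  assumes "state u"
  shows "(LINT x|lborel. diffq_density t u x) \<le> quadratic_energy u"
  unfolding diffq_density_integral(2)[OF state_integral(2,6)[OF assms]] quadratic_energy_def
  by (intro add_right_mono divide_right_mono sum_mono diffq_le_dirichlet state_integral(3)[OF assms]) auto

lemma diffq_density_tendsto: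
  assumes "state u"
  shows "((\<lambda>t. LINT x|lborel. diffq_density t u x) \<longlongrightarrow> quadratic_energy u) (at_right 0)"
  unfolding diffq_density_integral(2)[OF state_integral(2,6)[OF assms]] quadratic_energy_def
  by (intro tendsto_intros diffq_tendsto_dirichlet state_integral(3)[OF assms]) auto

text \<open>The uniform convexity of the interaction in the densities makes the densities of a minimising
  sequence Cauchy in \<open>L\<^sup>2\<close>, so that no compact embedding is needed.\<close>

lemma density_Cauchy:
  assumes k: "k > 0" "\<And>r s. k * (r\<^sup>2 + s\<^sup>2) \<le> quad g1 g2 g r s"
    and u: "admissible u1 u2" "real_energy u1 u2 \<le> I + \<delta> * k / (16 * \<epsilon>\<^sup>2)"
    and v: "admissible v1 v2" "real_energy v1 v2 \<le> I + \<delta> * k / (16 * \<epsilon>\<^sup>2)"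
    and I: "\<And>w1 w2. admissible w1 w2 \<Longrightarrow> I \<le> real_energy w1 w2"
  shows "(LINT x|lborel. ((norm (u1 x))\<^sup>2 - (norm (v1 x))\<^sup>2)\<^sup>2) \<le> \<delta>"
    "(LINT x|lborel. ((norm (u2 x))\<^sup>2 - (norm (v2 x))\<^sup>2)\<^sup>2) \<le> \<delta>"
proof -
  let ?d1 = "\<lambda>x. (norm (u1 x))\<^sup>2 - (norm (v1 x))\<^sup>2" and ?d2 = "\<lambda>x. (norm (u2 x))\<^sup>2 - (norm (v2 x))\<^sup>2"
  let ?D = "LINT x|lborel. quad g1 g2 g (?d1 x) (?d2 x)"
  have s: "0 \<le> (1/2::real)" "(1/2::real) \<le> 1" by auto
  note m = real_energy_mix(1,2)[OF s u(1) v(1)]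
  have "I \<le> real_energy (mix (1/2) u1 v1) (mix (1/2) u2 v2)" using m(1) by (rule I)
  \<comment> \<open>At s = 1/2 the factor s (1 - s) = 1/4 meets the denominator
    \<open>4 * \<epsilon>\<^sup>2\<close>; this is the origin of 16 in the assumed energy
    bounds.\<close>
  also have "\<dots> \<le> (1/2) * real_energy u1 u2 + (1/2) * real_energy v1 v2 - ?D / (16 * \<epsilon>\<^sup>2)"
    using real_energy_mix_le[OF s u(1) v(1)] by simp
  finally have "?D / (16 * \<epsilon>\<^sup>2) \<le> \<delta> * k / (16 * \<epsilon>\<^sup>2)" using u(2) v(2) by linarith
  then have D: "?D \<le> \<delta> * k" using pos by (simp add: divide_le_cancel)
  have i: "integrable lborel (\<lambda>x. (?d1 x)\<^sup>2)" "integrable lborel (\<lambda>x. (?d2 x)\<^sup>2)"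
    using L2_integrable[OF L2_diff[OF admissible_quartic(1)[OF u(1)] admissible_quartic(1)[OF v(1)]]]
      L2_integrable[OF L2_diff[OF admissible_quartic(2)[OF u(1)] admissible_quartic(2)[OF v(1)]]] by simp_all
  have "(LINT x|lborel. k * ((?d1 x)\<^sup>2 + (?d2 x)\<^sup>2)) \<le> ?D"
    using i m(2) k(2) by (intro integral_mono) auto
  then have "k * ((LINT x|lborel. (?d1 x)\<^sup>2) + (LINT x|lborel. (?d2 x)\<^sup>2)) \<le> k * \<delta>"
    using i D by (simp add: mult.commute)
  then have "(LINT x|lborel. (?d1 x)\<^sup>2) + (LINT x|lborel. (?d2 x)\<^sup>2) \<le> \<delta>"
    using k(1) by simp
  moreover have "0 \<le> (LINT x|lborel. (?d1 x)\<^sup>2)" "0 \<le> (LINT x|lborel. (?d2 x)\<^sup>2)" by simp_all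
  ultimately show "(LINT x|lborel. (?d1 x)\<^sup>2) \<le> \<delta>" "(LINT x|lborel. (?d2 x)\<^sup>2) \<le> \<delta>" by linarith+
qed

text \<open>Fatou's lemma gives mass at most 1. Conversely, the trap leaves each \<open>u n\<close>
  at most mass P / R^2 outside the ball of radius R, and inside the ball L^2 convergence of the
  densities implies convergence of their integrals. So the limit has mass at least 1 - P / R^2 for
  every R.\<close>

lemma mass_of_limit:
  fixes w :: "real^2 \<Rightarrow> complex"
  assumes u: "\<And>n. state (u n)" and P: "\<And>n. (LINT x|lborel. (norm x)\<^sup>2 * (norm (u n x))\<^sup>2) \<le> P"
    and \<rho>: "\<And>n. (\<lambda>x. (norm (u n x))\<^sup>2) \<in> L2" "\<rho> \<in> L2" "\<And>n. (LINT x|lborel. (\<rho> x - (norm (u n x))\<^sup>2)\<^sup>2) \<le> (1/4)^n"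
    and w: "w \<in> borel_measurable borel" "AE x in lborel. (norm (w x))\<^sup>2 = \<rho> x"
    and lim: "AE x in lborel. (\<lambda>n. norm (u n x)) \<longlonglongrightarrow> norm (w x)"
  shows "w \<in> L2" "L2_norm w = 1"
proof -
  note U = state_integral[OF u]
  have "AE x in lborel. (\<lambda>n. (norm (u n x))\<^sup>2) \<longlonglongrightarrow> (norm (w x))\<^sup>2"
    using lim by eventually_elim (rule tendsto_power)
  from Fatou_integrable[OF U(5) _ this _ eq_refl[OF U(1)], of 1]
  have i: "integrable lborel (\<lambda>x. (norm (w x))\<^sup>2)" "(LINT x|lborel. (norm (w x))\<^sup>2) \<le> 1"
    using w(1) by auto
  then show wL2: "w \<in> L2" using w(1) by (simp add: L2_def)
  have "1 \<le> (LINT x|lborel. (norm (w x))\<^sup>2) + P / R\<^sup>2" if R: "R > 0" for R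
  proof -
    let ?I = "indicator (cball (0::real^2) R) :: _ \<Rightarrow> real"
    have I2: "?I \<in> L2"
      using emeasure_lborel_cball_finite[of "0::real^2" R]
      by (intro L2_boundI[of ?I] borel_measurable_indicator)
        (auto simp: integrable_indicator_iff split: split_indicator)
    have ir: "integrable lborel (\<lambda>x. ?I x * f x)" if "f \<in> L2" for f
      using integrable_L2_mult[OF I2 that] by simp
    have 1: "1 \<le> (LINT x|lborel. ?I x * \<rho> x) + L2_norm ?I * (1/2)^n + P / R\<^sup>2" for n
    proof -
      let ?r = "\<lambda>x. (norm (u n x))\<^sup>2"
      have "1 = (LINT x|lborel. ?r x)" using U(1) by simp
      also have "\<dots> \<le> (LINT x|lborel. ?I x * ?r x + ((norm x)\<^sup>2 * ?r x) / R\<^sup>2)"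
      proof (intro integral_mono)
        show "?r x \<le> ?I x * ?r x + ((norm x)\<^sup>2 * ?r x) / R\<^sup>2" for x
        proof (cases "x \<in> cball 0 R")
          case False
          then have "R\<^sup>2 \<le> (norm x)\<^sup>2" using R by (intro power_mono) auto
          then have "R\<^sup>2 * ?r x \<le> (norm x)\<^sup>2 * ?r x" by (intro mult_right_mono) auto
          then show ?thesis using R False by (simp add: pos_le_divide_eq mult.commute)
        qed simp
      qed (use U(5,6) ir[OF \<rho>(1)] in auto)
      also have "\<dots> = (LINT x|lborel. ?I x * ?r x) + (LINT x|lborel. (norm x)\<^sup>2 * ?r x) / R\<^sup>2"
        using U(6) ir[OF \<rho>(1)] by simp
      also have "(LINT x|lborel. ?I x * ?r x) = (LINT x|lborel. ?I x * \<rho> x) - (LINT x|lborel. ?I x * (\<rho> x - ?r x))"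
        using ir[OF \<rho>(1)] ir[OF \<rho>(2)] by (simp add: right_diff_distrib)
      also have "\<dots> \<le> (LINT x|lborel. ?I x * \<rho> x) + L2_norm ?I * (1/2)^n"
      proof -
        have "L2_norm (\<lambda>x. \<rho> x - ?r x) \<le> (1/2)^n"
        proof (rule power2_le_imp_le)
          show "(L2_norm (\<lambda>x. \<rho> x - ?r x))\<^sup>2 \<le> ((1/2)^n)\<^sup>2"
            using \<rho>(3)[of n] unfolding L2_norm_power2
            by (simp add: power_mult[symmetric] mult.commute[of n 2]) (simp add: power_mult power2_eq_square power_divide)
        qed simp
        then have "L2_norm ?I * L2_norm (\<lambda>x. \<rho> x - ?r x) \<le> L2_norm ?I * (1/2)^n"
          by (intro mult_left_mono L2_norm_nonneg)
        then show ?thesis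
          using integral_Cauchy_Schwarz'[OF I2 L2_diff[OF \<rho>(2) \<rho>(1)[of n]]] by linarith
      qed
      also have "(LINT x|lborel. (norm x)\<^sup>2 * ?r x) / R\<^sup>2 \<le> P / R\<^sup>2"
        using P by (intro divide_right_mono) auto
      finally show ?thesis by simp
    qed
    have "(\<lambda>n. (LINT x|lborel. ?I x * \<rho> x) + L2_norm ?I * (1/2)^n + P / R\<^sup>2)
        \<longlonglongrightarrow> (LINT x|lborel. ?I x * \<rho> x) + L2_norm ?I * 0 + P / R\<^sup>2"
      by (intro tendsto_intros LIMSEQ_power_zero) simp
    then have "1 \<le> (LINT x|lborel. ?I x * \<rho> x) + P / R\<^sup>2"
      using 1 by (auto intro: LIMSEQ_le_const)
    also have "(LINT x|lborel. ?I x * \<rho> x) \<le> (LINT x|lborel. (norm (w x))\<^sup>2)"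
    proof (rule integral_mono_AE[OF ir[OF \<rho>(2)] i(1)])
      show "AE x in lborel. ?I x * \<rho> x \<le> (norm (w x))\<^sup>2"
        using w(2)
      proof eventually_elim
        case (elim x)
        then have "0 \<le> \<rho> x" by (metis zero_le_power2)
        then show ?case using elim by (simp add: indicator_def)
      qed
    qed
    finally show ?thesis by simp
  qed
  then have "1 \<le> (LINT x|lborel. (norm (w x))\<^sup>2) + P / (real (Suc n))\<^sup>2" for n by simp
  moreover have "(\<lambda>n. (LINT x|lborel. (norm (w x))\<^sup>2) + P * (inverse (real (Suc n)))\<^sup>2)
      \<longlonglongrightarrow> (LINT x|lborel. (norm (w x))\<^sup>2) + P * 0\<^sup>2"
    by (intro tendsto_intros LIMSEQ_inverse_real_of_nat)
  ultimately have "1 \<le> (LINT x|lborel. (norm (w x))\<^sup>2)"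
    by (auto intro!: LIMSEQ_le_const simp: divide_inverse power_inverse)
  then show "L2_norm w = 1" using i(2) by (simp add: L2_norm_def)
qed

text \<open>\<open>mix 0 u u\<close> is the modulus of \<open>u\<close>, so passing to moduli is a
  special case of mixing.\<close>

lemma admissible_modulus:
  assumes "admissible u1 u2"
  shows "admissible (mix 0 u1 u1) (mix 0 u2 u2)" "real_energy (mix 0 u1 u1) (mix 0 u2 u2) \<le> real_energy u1 u2"
  using real_energy_mix(1)[OF _ _ assms assms, of 0] real_energy_mix_le[OF _ _ assms assms, of 0] by simp_all

text \<open>The order of limits matters: Fatou's lemma is applied at a fixed step, where quotients
  of the sequence are below its Dirichlet energies. The resulting bound, uniform in the step, puts
  the limit into \<open>H1\<close>, and only then does the step tend to 0.\<close>

lemma energy_lower_semicontinuous: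
  assumes v: "\<And>n. admissible (v1 n) (v2 n)" "\<And>n. real_energy (v1 n) (v2 n) \<le> I + e n" "e \<longlonglongrightarrow> 0"
    and lim: "AE x in lborel. (\<lambda>n. v1 n x) \<longlonglongrightarrow> complex_of_real (w1 x)" "AE x in lborel. (\<lambda>n. v2 n x) \<longlonglongrightarrow> complex_of_real (w2 x)"
    and w: "(\<lambda>x. complex_of_real (w1 x)) \<in> L2" "(\<lambda>x. complex_of_real (w2 x)) \<in> L2"
    and n: "L2_norm (\<lambda>x. complex_of_real (w1 x)) = 1" "L2_norm (\<lambda>x. complex_of_real (w2 x)) = 1"
  shows "admissible (\<lambda>x. complex_of_real (w1 x)) (\<lambda>x. complex_of_real (w2 x))"
    "real_energy (\<lambda>x. complex_of_real (w1 x)) (\<lambda>x. complex_of_real (w2 x)) \<le> I"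
proof -
  let ?W1 = "\<lambda>x. complex_of_real (w1 x)" and ?W2 = "\<lambda>x. complex_of_real (w2 x)"
  have st: "state (v1 n)" "state (v2 n)" and iv: "integrable lborel (inter (v1 n) (v2 n))" for n
    using v(1) by (auto simp: admissible_def)
  note [measurable] = w[THEN L2_measurable]
  have dqm[measurable]: "diffq_density t u \<in> borel_measurable borel" if [measurable]: "u \<in> borel_measurable borel" for t u
    unfolding diffq_density_def[abs_def] by measurable
  note [measurable] = inter_measurable[OF w[THEN L2_measurable]]
  let ?F = "\<lambda>t u1 u2 x. diffq_density t u1 x + diffq_density t u2 x + inter u1 u2 x / (4 * \<epsilon>\<^sup>2)"
  have F0: "0 \<le> ?F t u1 u2 x" for t u1 u2 x
    by (intro add_nonneg_nonneg diffq_density_nonneg divide_nonneg_nonneg inter_nonneg) auto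
  have F: "integrable lborel (?F t ?W1 ?W2)" "(LINT x|lborel. ?F t ?W1 ?W2 x) \<le> I" for t
  proof -
    have i: "integrable lborel (?F t (v1 n) (v2 n))" for n
      using diffq_density_integral(1)[OF state_integral(2,6)[OF st(1)]] diffq_density_integral(1)[OF state_integral(2,6)[OF st(2)]] iv by simp
    have b: "(LINT x|lborel. ?F t (v1 n) (v2 n) x) \<le> I + e n" for n
    proof -
      have "(LINT x|lborel. ?F t (v1 n) (v2 n) x) = (LINT x|lborel. diffq_density t (v1 n) x) + (LINT x|lborel. diffq_density t (v2 n) x)
          + (LINT x|lborel. inter (v1 n) (v2 n) x) / (4 * \<epsilon>\<^sup>2)"
        using diffq_density_integral(1)[OF state_integral(2,6)[OF st(1)]] diffq_density_integral(1)[OF state_integral(2,6)[OF st(2)]] iv by simp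
      also have "\<dots> \<le> real_energy (v1 n) (v2 n)"
        unfolding real_energy_def using diffq_density_le[OF st(1)] diffq_density_le[OF st(2)] by (intro add_mono order_refl)
      finally show ?thesis using v(2)[of n] by simp
    qed
    \<comment> \<open>Convergence almost everywhere carries over to the shifted points because
      translations preserve null sets; the basis is finite.\<close>
    have sh: "AE x in lborel. \<forall>b\<in>Basis. (\<lambda>n. v n (x + t *\<^sub>R b)) \<longlonglongrightarrow> complex_of_real (w (x + t *\<^sub>R b))"
      if "AE x in lborel. (\<lambda>n. v n x) \<longlonglongrightarrow> complex_of_real (w x)" for v and w :: "real^2 \<Rightarrow> real"
      using AE_translate[OF that] by (intro AE_finite_allI) auto
    have L: "AE x in lborel. (\<lambda>n. ?F t (v1 n) (v2 n) x) \<longlonglongrightarrow> ?F t ?W1 ?W2 x"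
      using lim sh[OF lim(1)] sh[OF lim(2)]
    proof eventually_elim
      case (elim x)
      have "(\<lambda>n. diffq_density t (v1 n) x) \<longlonglongrightarrow> diffq_density t ?W1 x"
        "(\<lambda>n. diffq_density t (v2 n) x) \<longlonglongrightarrow> diffq_density t ?W2 x"
        unfolding diffq_density_def divide_inverse by (intro tendsto_intros; use elim in blast)+
      moreover have "(\<lambda>n. inter (v1 n) (v2 n) x / (4 * \<epsilon>\<^sup>2)) \<longlonglongrightarrow> inter ?W1 ?W2 x / (4 * \<epsilon>\<^sup>2)"
        unfolding inter_def quad_def divide_inverse by (intro tendsto_intros; use elim in blast)
      ultimately show ?case by (intro tendsto_add)
    qed
    have "(\<lambda>n. I + e n) \<longlonglongrightarrow> I" using tendsto_add[OF tendsto_const v(3)] by simp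
    from Fatou_integrable[OF i F0 L _ b this]
    show "integrable lborel (?F t ?W1 ?W2)" "(LINT x|lborel. ?F t ?W1 ?W2 x) \<le> I" by auto
  qed
  have ii: "integrable lborel (inter ?W1 ?W2)"
  proof -
    have "integrable lborel (\<lambda>x. inter ?W1 ?W2 x / (4 * \<epsilon>\<^sup>2))"
    proof (rule Bochner_Integration.integrable_bound[OF F(1)[of 1]])
      show "AE x in lborel. norm (inter ?W1 ?W2 x / (4 * \<epsilon>\<^sup>2)) \<le> norm (?F 1 ?W1 ?W2 x)"
        using diffq_density_nonneg[of 1 ?W1] diffq_density_nonneg[of 1 ?W2] inter_nonneg[of ?W1 ?W2] F0[of 1 ?W1 _ ?W2]
        by (intro AE_I2) simp
    qed measurable
    then have "integrable lborel (\<lambda>x. 4 * \<epsilon>\<^sup>2 * (inter ?W1 ?W2 x / (4 * \<epsilon>\<^sup>2)))" by (rule integrable_mult_right)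
    then show ?thesis using pos by simp
  qed
  have dens: "integrable lborel (diffq_density t W)" "(LINT x|lborel. diffq_density t W x) \<le> I" if "W = ?W1 \<or> W = ?W2" for t W
  proof -
    have le: "diffq_density t W x \<le> ?F t ?W1 ?W2 x" for x
    proof -
      have "0 \<le> inter ?W1 ?W2 x / (4 * \<epsilon>\<^sup>2)" by (intro divide_nonneg_nonneg inter_nonneg) simp
      then show ?thesis
        using that diffq_density_nonneg[of t ?W1 x] diffq_density_nonneg[of t ?W2 x] by auto
    qed
    have [measurable]: "W \<in> borel_measurable borel" using that w[THEN L2_measurable] by auto
    show i: "integrable lborel (diffq_density t W)"
    proof (rule Bochner_Integration.integrable_bound[OF F(1)[of t]])
      show "AE x in lborel. norm (diffq_density t W x) \<le> norm (?F t ?W1 ?W2 x)"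
        using le diffq_density_nonneg[of t W] F0[of t ?W1 _ ?W2] by (intro AE_I2) simp
    qed measurable
    have "(LINT x|lborel. diffq_density t W x) \<le> (LINT x|lborel. ?F t ?W1 ?W2 x)"
      using i F(1) le by (intro integral_mono) auto
    then show "(LINT x|lborel. diffq_density t W x) \<le> I" using F(2)[of t] by linarith
  qed
  have stw: "state W" if W: "W = ?W1 \<or> W = ?W2" for W
  proof -
    have W2: "W \<in> L2" and Wn: "L2_norm W = 1" using W w n by auto
    then have [measurable]: "W \<in> borel_measurable borel" by (simp add: L2_measurable)
    have "integrable lborel (\<lambda>x. ((norm x)\<^sup>2 * (norm (W x))\<^sup>2) / (2 * \<epsilon>\<^sup>2))"
    proof (rule Bochner_Integration.integrable_bound[OF dens(1)[OF W, of 1]])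
      show "AE x in lborel. norm (((norm x)\<^sup>2 * (norm (W x))\<^sup>2) / (2 * \<epsilon>\<^sup>2)) \<le> norm (diffq_density 1 W x)"
      proof (intro AE_I2)
        fix x
        have "0 \<le> (\<Sum>b\<in>Basis. (norm (W (x + 1 *\<^sub>R b) - W x))\<^sup>2) / (2 * 1\<^sup>2)"
          by (intro divide_nonneg_nonneg sum_nonneg) auto
        then show "norm (((norm x)\<^sup>2 * (norm (W x))\<^sup>2) / (2 * \<epsilon>\<^sup>2)) \<le> norm (diffq_density 1 W x)"
          unfolding diffq_density_def by simp
      qed
    qed measurable
    then have "integrable lborel (\<lambda>x. 2 * \<epsilon>\<^sup>2 * (((norm x)\<^sup>2 * (norm (W x))\<^sup>2) / (2 * \<epsilon>\<^sup>2)))" by (rule integrable_mult_right)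
    then have p: "integrable lborel (\<lambda>x. (norm x)\<^sup>2 * (norm (W x))\<^sup>2)" using pos by simp
    have "diffq b t W \<le> 2 * I" if b: "b \<in> Basis" for b t
    proof -
      have "diffq b t W \<le> (\<Sum>b\<in>Basis. diffq b t W)"
        using b by (intro member_le_sum) (auto simp: diffq_nonneg)
      moreover have "0 \<le> (LINT x|lborel. (norm x)\<^sup>2 * (norm (W x))\<^sup>2) / (2 * \<epsilon>\<^sup>2)" by simp
      ultimately show ?thesis
        using dens(2)[OF W, of t] unfolding diffq_density_integral(2)[OF W2 p] by linarith
    qed
    then have "W \<in> H1" using W W2 by (auto intro: H1_of_realI[where M = "\<lambda>_. 2 * I"])
    then show ?thesis using p Wn by (simp add: state_def)
  qed
  show a: "admissible ?W1 ?W2" using stw ii by (simp add: admissible_def)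
  have "((\<lambda>t. (LINT x|lborel. diffq_density t ?W1 x) + (LINT x|lborel. diffq_density t ?W2 x)
      + (LINT x|lborel. inter ?W1 ?W2 x) / (4 * \<epsilon>\<^sup>2)) \<longlongrightarrow> real_energy ?W1 ?W2) (at_right 0)"
    unfolding real_energy_def using stw by (intro tendsto_intros diffq_density_tendsto) auto
  moreover have "(LINT x|lborel. diffq_density t ?W1 x) + (LINT x|lborel. diffq_density t ?W2 x)
      + (LINT x|lborel. inter ?W1 ?W2 x) / (4 * \<epsilon>\<^sup>2) \<le> I" for t
    using F(2)[of t] dens(1)[of ?W1 t] dens(1)[of ?W2 t] ii by simp
  ultimately show "real_energy ?W1 ?W2 \<le> I"
    by (intro tendsto_upperbound[of _ _ "at_right (0::real)"]) auto
qed

text \<open>The minimising sequence is first replaced by its moduli. Convergence of the densities is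
  then convergence of the functions themselves, with the square roots of the limit densities as
  limits.\<close>

lemma minimizer_exists:
  obtains w1 w2 :: "real^2 \<Rightarrow> real" where "\<And>x. 0 \<le> w1 x" "\<And>x. 0 \<le> w2 x"
    "admissible (\<lambda>x. complex_of_real (w1 x)) (\<lambda>x. complex_of_real (w2 x))"
    "\<And>v1 v2. admissible v1 v2 \<Longrightarrow> real_energy (\<lambda>x. complex_of_real (w1 x)) (\<lambda>x. complex_of_real (w2 x)) \<le> real_energy v1 v2"
proof -
  obtain k where k: "k > 0" "\<And>r s. k * (r\<^sup>2 + s\<^sup>2) \<le> quad g1 g2 g r s"
    using quad_coercive[OF pos(2,3) det] by blast
  define E where "E = {real_energy u1 u2 | u1 u2. admissible u1 u2}"
  define I where "I = Inf E"
  have bdd: "bdd_below E" unfolding E_def using real_energy_nonneg by (auto intro!: bdd_belowI[of _ 0])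
  have ne: "E \<noteq> {}" unfolding E_def using admissible_nonempty by blast
  have I: "I \<le> real_energy u1 u2" if "admissible u1 u2" for u1 u2
    unfolding I_def using that by (intro cInf_lower bdd) (auto simp: E_def)
  \<comment> \<open>With this error \<open>density_Cauchy\<close> yields exactly the rate (1/4)^n
    that \<open>L2_complete\<close> asks for.\<close>
  define e where "e = (\<lambda>n::nat. (1/4)^n * k / (16 * \<epsilon>\<^sup>2))"
  have e0: "e n > 0" for n using k pos by (simp add: e_def)
  have "\<exists>u1 u2. admissible u1 u2 \<and> real_energy u1 u2 < I + e n" for n
  proof -
    have "I < I + e n" using e0 by simp
    then have "\<exists>x\<in>E. x < I + e n" unfolding I_def using cInf_less_iff[OF ne bdd] by blast
    then show ?thesis by (auto simp: E_def)
  qed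
  then obtain u1 u2 where u: "\<And>n. admissible (u1 n) (u2 n)" "\<And>n. real_energy (u1 n) (u2 n) < I + e n" by metis
  define v1 v2 where "v1 n = mix 0 (u1 n) (u1 n)" and "v2 n = mix 0 (u2 n) (u2 n)" for n
  have v: "admissible (v1 n) (v2 n)" "real_energy (v1 n) (v2 n) \<le> I + e n" for n
    using admissible_modulus[OF u(1)[of n]] u(2)[of n] by (auto simp: v1_def v2_def)
  have vr: "v1 n x = complex_of_real (norm (v1 n x))" "v2 n x = complex_of_real (norm (v2 n x))" for n x
    by (simp_all add: v1_def v2_def mix_def)
  note q = admissible_quartic[OF v(1)]
  have c: "(LINT x|lborel. ((norm (v1 m x))\<^sup>2 - (norm (v1 n x))\<^sup>2)\<^sup>2) \<le> (1/4)^n"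
    "(LINT x|lborel. ((norm (v2 m x))\<^sup>2 - (norm (v2 n x))\<^sup>2)\<^sup>2) \<le> (1/4)^n" if "n \<le> m" for n m
  proof -
    have "(1/4::real)^m \<le> (1/4)^n" using that by (intro power_decreasing) auto
    then have "e m \<le> e n" unfolding e_def using k(1) by (intro divide_right_mono mult_right_mono) auto
    then have "real_energy (v1 m) (v2 m) \<le> I + (1/4)^n * k / (16 * \<epsilon>\<^sup>2)" "real_energy (v1 n) (v2 n) \<le> I + (1/4)^n * k / (16 * \<epsilon>\<^sup>2)"
      using v(2)[of m] v(2)[of n] by (auto simp: e_def)
    from density_Cauchy[OF k v(1) this(1) v(1) this(2) I]
    show "(LINT x|lborel. ((norm (v1 m x))\<^sup>2 - (norm (v1 n x))\<^sup>2)\<^sup>2) \<le> (1/4)^n"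
      "(LINT x|lborel. ((norm (v2 m x))\<^sup>2 - (norm (v2 n x))\<^sup>2)\<^sup>2) \<le> (1/4)^n" by auto
  qed
  obtain \<rho>1 where \<rho>1: "\<rho>1 \<in> L2" "AE x in lborel. (\<lambda>n. (norm (v1 n x))\<^sup>2) \<longlonglongrightarrow> \<rho>1 x"
    "\<And>n. (LINT x|lborel. (\<rho>1 x - (norm (v1 n x))\<^sup>2)\<^sup>2) \<le> (1/4)^n"
    by (rule L2_complete[of "\<lambda>n x. (norm (v1 n x))\<^sup>2", OF q(1) c(1)]) blast+
  obtain \<rho>2 where \<rho>2: "\<rho>2 \<in> L2" "AE x in lborel. (\<lambda>n. (norm (v2 n x))\<^sup>2) \<longlonglongrightarrow> \<rho>2 x"
    "\<And>n. (LINT x|lborel. (\<rho>2 x - (norm (v2 n x))\<^sup>2)\<^sup>2) \<le> (1/4)^n"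
    by (rule L2_complete[of "\<lambda>n x. (norm (v2 n x))\<^sup>2", OF q(2) c(2)]) blast+
  \<comment> \<open>The limit densities are nonnegative only almost everywhere, and
    \<open>sqrt\<close> is odd; the maximum makes the roots nonnegative everywhere.\<close>
  define w1 w2 where "w1 x = sqrt (max 0 (\<rho>1 x))" and "w2 x = sqrt (max 0 (\<rho>2 x))" for x
  have w0: "0 \<le> w1 x" "0 \<le> w2 x" for x by (auto simp: w1_def w2_def)
  have P: "(LINT x|lborel. (norm x)\<^sup>2 * (norm (v1 n x))\<^sup>2) \<le> 2 * \<epsilon>\<^sup>2 * (I + e 0)"
    "(LINT x|lborel. (norm x)\<^sup>2 * (norm (v2 n x))\<^sup>2) \<le> 2 * \<epsilon>\<^sup>2 * (I + e 0)" for n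
  proof -
    have "(1/4::real)^n \<le> (1/4)^0" by (intro power_decreasing) auto
    then have "e n \<le> e 0" unfolding e_def using k(1) by (intro divide_right_mono mult_right_mono) auto
    then have E: "quadratic_energy (v1 n) + quadratic_energy (v2 n) \<le> I + e 0"
    proof -
      have "0 \<le> (LINT x|lborel. inter (v1 n) (v2 n) x) / (4 * \<epsilon>\<^sup>2)"
        by (intro divide_nonneg_nonneg Bochner_Integration.integral_nonneg inter_nonneg) simp
      then show ?thesis using v(2)[of n] \<open>e n \<le> e 0\<close> unfolding real_energy_def by linarith
    qed
    have "(LINT x|lborel. (norm x)\<^sup>2 * (norm (v x))\<^sup>2) / (2 * \<epsilon>\<^sup>2) \<le> quadratic_energy v" for v :: "real^2 \<Rightarrow> complex"
      unfolding quadratic_energy_def by (simp add: sum_nonneg dirichlet_nonneg)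
    then have "(LINT x|lborel. (norm x)\<^sup>2 * (norm (v1 n x))\<^sup>2) / (2 * \<epsilon>\<^sup>2) \<le> I + e 0"
      "(LINT x|lborel. (norm x)\<^sup>2 * (norm (v2 n x))\<^sup>2) / (2 * \<epsilon>\<^sup>2) \<le> I + e 0"
      using E quadratic_energy_nonneg[of "v1 n"] quadratic_energy_nonneg[of "v2 n"]
      by (meson add_increasing add_increasing2 order_trans order_refl)+
    then show "(LINT x|lborel. (norm x)\<^sup>2 * (norm (v1 n x))\<^sup>2) \<le> 2 * \<epsilon>\<^sup>2 * (I + e 0)"
      "(LINT x|lborel. (norm x)\<^sup>2 * (norm (v2 n x))\<^sup>2) \<le> 2 * \<epsilon>\<^sup>2 * (I + e 0)"
      using pos(1) by (simp_all add: divide_le_eq mult.commute)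
  qed
  have lim: "AE x in lborel. (\<lambda>n. v n x) \<longlonglongrightarrow> complex_of_real (sqrt (max 0 (\<rho> x)))"
    "AE x in lborel. (norm (complex_of_real (sqrt (max 0 (\<rho> x)))))\<^sup>2 = \<rho> x"
    if "AE x in lborel. (\<lambda>n. (norm (v n x))\<^sup>2) \<longlonglongrightarrow> \<rho> x" "\<And>n x. v n x = complex_of_real (norm (v n x))"
    for \<rho> and v :: "nat \<Rightarrow> real^2 \<Rightarrow> complex"
  proof -
    show "AE x in lborel. (norm (complex_of_real (sqrt (max 0 (\<rho> x)))))\<^sup>2 = \<rho> x"
      using that(1)
    proof eventually_elim
      case (elim x)
      then have "0 \<le> \<rho> x" by (rule LIMSEQ_le_const) auto
      then show ?case by simp
    qed
    show "AE x in lborel. (\<lambda>n. v n x) \<longlonglongrightarrow> complex_of_real (sqrt (max 0 (\<rho> x)))"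
      using that(1)
    proof eventually_elim
      case (elim x)
      then have "0 \<le> \<rho> x" by (rule LIMSEQ_le_const) auto
      moreover have "(\<lambda>n. complex_of_real (sqrt ((norm (v n x))\<^sup>2))) \<longlonglongrightarrow> complex_of_real (sqrt (\<rho> x))"
        by (intro tendsto_of_real tendsto_real_sqrt elim)
      ultimately show ?case using that(2)[symmetric] by (simp add: max_def)
    qed
  qed
  note l1 = lim[OF \<rho>1(2) vr(1), folded w1_def] and l2 = lim[OF \<rho>2(2) vr(2), folded w2_def]
  have st: "state (v1 n)" "state (v2 n)" for n using v(1) by (auto simp: admissible_def)
  have m: "(\<lambda>x. complex_of_real (w1 x)) \<in> borel_measurable borel" "(\<lambda>x. complex_of_real (w2 x)) \<in> borel_measurable borel"
    unfolding w1_def w2_def using L2_measurable[OF \<rho>1(1)] L2_measurable[OF \<rho>2(1)] by measurable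
  have "AE x in lborel. (\<lambda>n. norm (v1 n x)) \<longlonglongrightarrow> norm (complex_of_real (w1 x))"
    "AE x in lborel. (\<lambda>n. norm (v2 n x)) \<longlonglongrightarrow> norm (complex_of_real (w2 x))"
    by (rule eventually_mono[OF l1(1)], erule tendsto_norm)
      (rule eventually_mono[OF l2(1)], erule tendsto_norm)
  note M1 = mass_of_limit[OF st(1) P(1) q(1) \<rho>1(1,3) m(1) l1(2) this(1)]
    and M2 = mass_of_limit[OF st(2) P(2) q(2) \<rho>2(1,3) m(2) l2(2) this(2)]
  have "(\<lambda>n. (1/4)^n * (k / (16 * \<epsilon>\<^sup>2))) \<longlonglongrightarrow> 0 * (k / (16 * \<epsilon>\<^sup>2))"
    by (intro tendsto_intros LIMSEQ_power_zero) simp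
  then have el: "e \<longlonglongrightarrow> 0" unfolding e_def by simp
  from energy_lower_semicontinuous[OF v el l1(1) l2(1) M1(1) M2(1) M1(2) M2(2)]
  show ?thesis using that[of w1 w2] w0 I by (meson order_trans)
qed

end

subsection \<open>Difference estimates on boxes\<close>

definition cube :: "real \<Rightarrow> 'a::euclidean_space set" where
  "cube r = cbox (- r *\<^sub>R One) (r *\<^sub>R One)"

lemma cube_shift:
  assumes "x \<in> cube r" "b \<in> Basis" "0 \<le> s" "s \<le> T"
  shows "x + s *\<^sub>R b \<in> cube (r + T)"
  unfolding cube_def mem_box
proof
  fix c :: 'a assume c: "c \<in> Basis"
  have "- r \<le> x \<bullet> c" "x \<bullet> c \<le> r" using assms(1) c by (auto simp: cube_def mem_box)
  then show "(- (r + T) *\<^sub>R One) \<bullet> c \<le> (x + s *\<^sub>R b) \<bullet> c \<and> (x + s *\<^sub>R b) \<bullet> c \<le> ((r + T) *\<^sub>R One) \<bullet> c"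
    using assms c by (auto simp: inner_add_left inner_Basis)
qed

lemma cube_measurable[measurable]: "cube r \<in> sets borel"
  by (simp add: cube_def)

lemma cube_mono: "r \<le> r' \<Longrightarrow> cube r \<subseteq> cube r'"
  unfolding cube_def by (fastforce simp: mem_box)

lemma integrable_cube:
  fixes f :: "'a::euclidean_space \<Rightarrow> real"
  assumes "f \<in> borel_measurable borel" "\<And>x. \<bar>f x\<bar> \<le> M"
  shows "integrable lborel (\<lambda>x. indicator (cube r) x * f x)"
proof (rule Bochner_Integration.integrable_bound)
  have "integrable lborel (indicator (cube r :: 'a set) :: _ \<Rightarrow> real)"
    using emeasure_lborel_cbox_finite by (simp add: cube_def integrable_indicator_iff)
  then show "integrable lborel (\<lambda>x::'a. M * indicator (cube r) x)" by simp
  show "(\<lambda>x. indicator (cube r) x * f x) \<in> borel_measurable lborel"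
    using assms(1) by measurable
  have "\<bar>f x\<bar> \<le> \<bar>M\<bar>" for x using assms(2)[of x] by linarith
  then show "AE x in lborel. norm (indicator (cube r) x * f x) \<le> norm (M * indicator (cube r) x)"
    by (auto simp: abs_mult split: split_indicator)
qed

text \<open>A shift by at most \<open>T\<close> is paid for by enlarging the cube by
  \<open>T\<close>, which is why cubes grow in the estimates that follow.\<close>

lemma integral_cube_shift:
  fixes G :: "'a::euclidean_space \<Rightarrow> real"
  assumes G[measurable]: "G \<in> borel_measurable borel" and b: "\<And>x. 0 \<le> G x" "\<And>x. G x \<le> M"
    and s: "b \<in> Basis" "0 \<le> s" "s \<le> T"
  shows "(LINT x|lborel. indicator (cube r) x * G (x + s *\<^sub>R b)) \<le> (LINT x|lborel. indicator (cube (r + T)) x * G x)"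
proof -
  have b': "\<bar>G x\<bar> \<le> M" for x using b[of x] by simp
  have i: "integrable lborel (\<lambda>x. indicator (cube (r + T)) x * G x)" by (rule integrable_cube[OF G b'])
  have "(LINT x|lborel. indicator (cube r) x * G (x + s *\<^sub>R b))
      \<le> (LINT x|lborel. indicator (cube (r + T)) (x + s *\<^sub>R b) * G (x + s *\<^sub>R b))"
  proof (rule integral_mono)
    show "integrable lborel (\<lambda>x. indicator (cube r) x * G (x + s *\<^sub>R b))"
      by (rule integrable_cube[OF _ b']) measurable
    show "integrable lborel (\<lambda>x. indicator (cube (r + T)) (x + s *\<^sub>R b) * G (x + s *\<^sub>R b))"
      by (rule integrable_translate[OF i])
    show "indicator (cube r) x * G (x + s *\<^sub>R b) \<le> indicator (cube (r + T)) (x + s *\<^sub>R b) * G (x + s *\<^sub>R b)" for x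
      using cube_shift[OF _ s, of x r] b(1) by (auto simp: indicator_def)
  qed
  also have "\<dots> = (LINT x|lborel. indicator (cube (r + T)) x * G x)"
    by (rule integral_translate[OF i])
  finally show ?thesis .
qed

text \<open>The translation by \<open>T\<close> is a chain of \<open>N\<close> translations by T /
  N. The triangle inequality produces the factor N; for squares, Cauchy-Schwarz over the N summands
  produces N^2. All intermediate points stay in the enlarged cube.\<close>

lemma
  fixes f :: "'a::euclidean_space \<Rightarrow> 'b::{banach, second_countable_topology}"
  assumes f[measurable]: "f \<in> borel_measurable borel" and f1: "\<And>x. norm (f x) \<le> 1"
    and b: "b \<in> Basis" and T: "0 < T" and N: "0 < (N::nat)"
  shows chain_L1: "(LINT x|lborel. indicator (cube r) x * norm (f (x + T *\<^sub>R b) - f x))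
      \<le> N * (LINT x|lborel. indicator (cube (r + T)) x * norm (f (x + (T / N) *\<^sub>R b) - f x))"
    and chain_L2: "(LINT x|lborel. indicator (cube r) x * (norm (f (x + T *\<^sub>R b) - f x))\<^sup>2)
      \<le> (real N)\<^sup>2 * (LINT x|lborel. indicator (cube (r + T)) x * (norm (f (x + (T / N) *\<^sub>R b) - f x))\<^sup>2)"
proof -
  let ?t = "T / N"
  let ?d = "\<lambda>x. norm (f (x + ?t *\<^sub>R b) - f x)"
  have d2: "norm (f x - f y) \<le> 2" for x y
    using norm_triangle_ineq4[of "f x" "f y"] f1[of x] f1[of y] by linarith
  have d4: "(norm (f x - f y))\<^sup>2 \<le> 4" for x y
    using power_mono[OF d2[of x y] norm_ge_zero, of 2] by simp
  have tel: "norm (f (x + T *\<^sub>R b) - f x) \<le> (\<Sum>k<N. ?d (x + (k * ?t) *\<^sub>R b))" for x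
  proof -
    have "f (x + T *\<^sub>R b) - f x = (\<Sum>k<N. f (x + (Suc k * ?t) *\<^sub>R b) - f (x + (k * ?t) *\<^sub>R b))"
      using N by (simp only: sum_lessThan_telescope[of "\<lambda>k. f (x + (real k * ?t) *\<^sub>R b)"]) simp
    also have "norm \<dots> \<le> (\<Sum>k<N. norm (f (x + (Suc k * ?t) *\<^sub>R b) - f (x + (k * ?t) *\<^sub>R b)))"
      by (rule norm_sum)
    finally show ?thesis by (simp add: algebra_simps add_divide_distrib)
  qed
  have kt: "0 \<le> real k * ?t" "real k * ?t \<le> T" if "k < N" for k
    using that T by (auto simp: field_simps)
  have i1: "integrable lborel (\<lambda>x. indicator (cube r) x * ?d (x + s *\<^sub>R b))" for s
    by (rule integrable_cube[of _ 2]) (use d2 in auto)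
  have i2: "integrable lborel (\<lambda>x. indicator (cube r) x * (?d (x + s *\<^sub>R b))\<^sup>2)" for s
    by (rule integrable_cube[of _ 4]) (use d4 in auto)
  have "(LINT x|lborel. indicator (cube r) x * norm (f (x + T *\<^sub>R b) - f x))
      \<le> (LINT x|lborel. (\<Sum>k<N. indicator (cube r) x * ?d (x + (k * ?t) *\<^sub>R b)))"
  proof (rule integral_mono)
    show "integrable lborel (\<lambda>x. indicator (cube r) x * norm (f (x + T *\<^sub>R b) - f x))"
      by (rule integrable_cube[of _ 2]) (use d2 in auto)
    show "integrable lborel (\<lambda>x. \<Sum>k<N. indicator (cube r) x * ?d (x + (k * ?t) *\<^sub>R b))"
      using i1 by (intro Bochner_Integration.integrable_sum)
    show "indicator (cube r) x * norm (f (x + T *\<^sub>R b) - f x) \<le> (\<Sum>k<N. indicator (cube r) x * ?d (x + (k * ?t) *\<^sub>R b))" for x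
      unfolding sum_distrib_left[symmetric] by (intro mult_left_mono tel) auto
  qed
  also have "\<dots> = (\<Sum>k<N. LINT x|lborel. indicator (cube r) x * ?d (x + (k * ?t) *\<^sub>R b))"
    using i1 by (intro Bochner_Integration.integral_sum)
  also have "\<dots> \<le> (\<Sum>k<N. LINT x|lborel. indicator (cube (r + T)) x * ?d x)"
    by (intro sum_mono integral_cube_shift[where M = 2] b kt) (use d2 in auto)
  finally show "(LINT x|lborel. indicator (cube r) x * norm (f (x + T *\<^sub>R b) - f x))
      \<le> N * (LINT x|lborel. indicator (cube (r + T)) x * ?d x)" by simp
  have sqr: "(norm (f (x + T *\<^sub>R b) - f x))\<^sup>2 \<le> (\<Sum>k<N. N * (?d (x + (k * ?t) *\<^sub>R b))\<^sup>2)" for x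
  proof -
    have "(norm (f (x + T *\<^sub>R b) - f x))\<^sup>2 \<le> (\<Sum>k<N. 1 * ?d (x + (k * ?t) *\<^sub>R b))\<^sup>2"
      using tel[of x] by (intro power_mono) auto
    also have "\<dots> \<le> (\<Sum>k<N. 1\<^sup>2) * (\<Sum>k<N. (?d (x + (k * ?t) *\<^sub>R b))\<^sup>2)"
      by (rule Cauchy_Schwarz_ineq_sum)
    finally show ?thesis by (simp add: sum_distrib_left)
  qed
  have "(LINT x|lborel. indicator (cube r) x * (norm (f (x + T *\<^sub>R b) - f x))\<^sup>2)
      \<le> (LINT x|lborel. (\<Sum>k<N. N * (indicator (cube r) x * (?d (x + (k * ?t) *\<^sub>R b))\<^sup>2)))"
  proof (rule integral_mono)
    show "integrable lborel (\<lambda>x. indicator (cube r) x * (norm (f (x + T *\<^sub>R b) - f x))\<^sup>2)"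
      by (rule integrable_cube[of _ 4]) (use d4 in auto)
    show "integrable lborel (\<lambda>x. \<Sum>k<N. N * (indicator (cube r) x * (?d (x + (k * ?t) *\<^sub>R b))\<^sup>2))"
      using i2 by (intro Bochner_Integration.integrable_sum integrable_mult_right)
    show "indicator (cube r) x * (norm (f (x + T *\<^sub>R b) - f x))\<^sup>2
        \<le> (\<Sum>k<N. N * (indicator (cube r) x * (?d (x + (k * ?t) *\<^sub>R b))\<^sup>2))" for x
      using mult_left_mono[OF sqr[of x], of "indicator (cube r) x"]
      by (simp add: sum_distrib_left mult.left_commute)
  qed
  also have "\<dots> = (\<Sum>k<N. LINT x|lborel. N * (indicator (cube r) x * (?d (x + (k * ?t) *\<^sub>R b))\<^sup>2))"
    using i2 by (intro Bochner_Integration.integral_sum integrable_mult_right)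
  also have "\<dots> = (\<Sum>k<N. N * (LINT x|lborel. indicator (cube r) x * (?d (x + (k * ?t) *\<^sub>R b))\<^sup>2))"
    by simp
  also have "\<dots> \<le> (\<Sum>k<N. N * (LINT x|lborel. indicator (cube (r + T)) x * (?d x)\<^sup>2))"
    by (intro sum_mono mult_left_mono integral_cube_shift[where M = 4] b kt) (use d4 in auto)
  finally show "(LINT x|lborel. indicator (cube r) x * (norm (f (x + T *\<^sub>R b) - f x))\<^sup>2)
      \<le> (real N)\<^sup>2 * (LINT x|lborel. indicator (cube (r + T)) x * (?d x)\<^sup>2)"
    by (simp add: power2_eq_square)
qed

text \<open>Estimates known only for small steps are used at step T / N, so that N steps add up
  exactly to T.\<close>

lemma eventually_divide_nat:
  assumes "eventually P (at_right (0::real))" "0 < T"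
  shows "\<forall>\<^sub>F N in sequentially. P (T / real N) \<and> 0 < N"
proof -
  have "filterlim (\<lambda>N. T / real N) (at_right 0) sequentially"
    unfolding filterlim_at
    using assms(2) lim_const_over_n[of T]
    by (auto simp: eventually_at_top_linorder intro!: exI[of _ 1])
  then have "\<forall>\<^sub>F N in sequentially. P (T / real N)"
    using assms(1) by (rule eventually_compose_filterlim[rotated])
  then show ?thesis using eventually_gt_at_top[of 0] by eventually_elim simp
qed

lemma AE_zero_of_integral_cube:
  fixes f :: "'a::euclidean_space \<Rightarrow> real"
  assumes [measurable]: "f \<in> borel_measurable borel" and b: "\<And>x. 0 \<le> f x" "\<And>x. f x \<le> M"
    and z: "\<And>r. 0 < r \<Longrightarrow> (LINT x|lborel. indicator (cube r) x * f x) \<le> 0"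
  shows "AE x in lborel. f x = 0"
proof -
  have "AE x in lborel. indicator (cube (real (Suc n))) x * f x = 0" for n
  proof -
    have i: "integrable lborel (\<lambda>x. indicator (cube (real (Suc n))) x * f x)"
      by (rule integrable_cube[of _ M]) (use b in auto)
    have n: "AE x in lborel. 0 \<le> indicator (cube (real (Suc n))) x * f x" using b by simp
    have "(LINT x|lborel. indicator (cube (real (Suc n))) x * f x) = 0"
      using z[of "real (Suc n)"] integral_nonneg_AE[OF n] by simp
    then show ?thesis using integral_nonneg_eq_0_iff_AE[OF i n] by simp
  qed
  then have "AE x in lborel. \<forall>n. indicator (cube (real (Suc n))) x * f x = 0"
    unfolding AE_all_countable by blast
  then show ?thesis
  proof eventually_elim
    case (elim x)
    obtain n where n: "norm x < real n" using reals_Archimedean2 by blast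
    have "\<bar>x \<bullet> c\<bar> \<le> real (Suc n)" if "c \<in> Basis" for c
      using Basis_le_norm[OF that, of x] n by simp
    then have "x \<in> cube (real (Suc n))" by (fastforce simp: cube_def mem_box abs_le_iff)
    then show ?case using elim[rule_format, of n] by simp
  qed
qed

text \<open>The exceptional null set depends on the translation. Fubini on the pairs (x, h) provides
  one x with f (x + h) = f x for almost every h, and f x is then the constant.\<close>

lemma translation_invariant_const:
  fixes f :: "'a::euclidean_space \<Rightarrow> 'b::{banach, second_countable_topology}"
  assumes f[measurable]: "f \<in> borel_measurable borel"
    and inv: "\<And>b T. b \<in> Basis \<Longrightarrow> 0 < T \<Longrightarrow> AE x in lborel. f (x + T *\<^sub>R b) = f x"
  obtains c where "AE x in lborel. f x = c"
proof -
  have inv1: "AE x in lborel. f (x + T *\<^sub>R b) = f x" if b: "b \<in> Basis" for b and T :: real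
  proof (cases T "0::real" rule: linorder_cases)
    case less
    then have "AE x in lborel. f (x + (- T) *\<^sub>R b) = f x" using inv[OF b, of "- T"] by simp
    from AE_translate[OF this, of "T *\<^sub>R b"] show ?thesis by (auto elim: eventually_mono)
  qed (use inv[OF b] in auto)
  have invF: "AE x in lborel. f (x + (\<Sum>b\<in>F. (h \<bullet> b) *\<^sub>R b)) = f x" if "finite F" "F \<subseteq> Basis" for F and h :: 'a
    using that
  proof (induction F rule: finite_induct)
    case (insert b F)
    have 1: "AE x in lborel. f (x + (\<Sum>b\<in>F. (h \<bullet> b) *\<^sub>R b)) = f x" using insert by simp
    have 2: "AE x in lborel. f ((x + (\<Sum>b\<in>F. (h \<bullet> b) *\<^sub>R b)) + (h \<bullet> b) *\<^sub>R b) = f (x + (\<Sum>b\<in>F. (h \<bullet> b) *\<^sub>R b))"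
      using AE_translate[OF inv1[of b "h \<bullet> b"], of "\<Sum>b\<in>F. (h \<bullet> b) *\<^sub>R b"] insert by simp
    show ?case using 1 2
      by eventually_elim (use insert in \<open>simp add: add_ac\<close>)
  qed simp
  have all: "AE x in lborel. f (x + h) = f x" for h
    using invF[of Basis h] by (simp add: euclidean_representation)
  have "AE h in (lborel :: 'a measure). AE x in lborel. f (x + h) = f x"
    using all by simp
  then have "AE x in (lborel :: 'a measure). AE h in lborel. f (x + h) = f x"
  proof (subst lborel_pair.AE_commute)
    show "{p \<in> space (lborel \<Otimes>\<^sub>M lborel). f (fst p + snd p) = f (fst p)} \<in> sets (lborel \<Otimes>\<^sub>M lborel)"
      by measurable
  qed
  moreover have "ae_filter (lborel :: 'a measure) \<noteq> bot"
    by (simp add: ae_filter_eq_bot_iff emeasure_lborel_UNIV)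
  ultimately obtain x where x: "AE h in lborel. f (x + h) = f x"
    using eventually_happens' by blast
  have "AE h in lborel. f (x + (h + - x)) = f x"
    using AE_translate[OF x, of "- x"] .
  then show ?thesis using that[of "f x"] by simp
qed


subsection \<open>Positivity and phases of minimizers\<close>

lemma norm_snd_component_le:
  fixes p :: "'a::real_normed_vector \<times> 'b::real_normed_vector"
  shows "norm (snd p) \<le> norm p"
  by (cases p) (simp add: norm_snd_le)

lemma norm_sgn_le_1: "norm (sgn x) \<le> 1"
  by (simp add: norm_sgn)

context gross_pitaevskii
begin

text \<open>Mixing cannot go below the minimum, while by \<open>real_energy_mix\<close> the mixture
  lies below the linear interpolation of the energies by at least half the defect. So the defect
  costs at most the linear increase; the factor 2 undoes the 1/2 in front of the Dirichlet
  energy.\<close>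

lemma mix_defect_limit_le:
  assumes u: "admissible u1 u2" and min: "\<And>v1 v2. admissible v1 v2 \<Longrightarrow> real_energy u1 u2 \<le> real_energy v1 v2"
    and v: "admissible v u2" and s: "0 \<le> s" "s \<le> 1" and b: "b \<in> Basis"
  shows "(1 - s) * dirichlet b u1 + s * dirichlet b v - dirichlet b (mix s u1 v)
      \<le> 2 * s * (real_energy v u2 - real_energy u1 u2)"
proof -
  have st: "state u1" "state u2" "state v" using u v by (auto simp: admissible_def)
  let ?d1 = "\<lambda>b. (1 - s) * dirichlet b u1 + s * dirichlet b v - dirichlet b (mix s u1 v)"
  let ?d2 = "\<lambda>b. (1 - s) * dirichlet b u2 + s * dirichlet b u2 - dirichlet b (mix s u2 u2)"
  let ?q = "LINT x|lborel. quad g1 g2 g ((norm (u1 x))\<^sup>2 - (norm (v x))\<^sup>2) ((norm (u2 x))\<^sup>2 - (norm (u2 x))\<^sup>2)"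
  have d: "0 \<le> ?d1 b" "0 \<le> ?d2 b" if "b \<in> Basis" for b
    using dirichlet_mix_le[OF s state_integral(2)[OF st(1)] state_integral(2)[OF st(3)] state_integral(3)[OF st(1)] state_integral(3)[OF st(3)] that]
      dirichlet_mix_le[OF s state_integral(2)[OF st(2)] state_integral(2)[OF st(2)] state_integral(3)[OF st(2)] state_integral(3)[OF st(2)] that]
    by auto
  have q0: "0 \<le> s * (1 - s) * ?q / (4 * \<epsilon>\<^sup>2)"
    using s by (intro divide_nonneg_nonneg mult_nonneg_nonneg Bochner_Integration.integral_nonneg quad_nonneg') auto
  have S2: "0 \<le> (\<Sum>b\<in>Basis. ?d2 b)" using d by (intro sum_nonneg)
  have S1: "?d1 b \<le> (\<Sum>b\<in>Basis. ?d1 b)" using d b by (intro member_le_sum) auto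
  have m: "real_energy u1 u2 \<le> real_energy (mix s u1 v) (mix s u2 u2)"
    by (intro min real_energy_mix(1)[OF s u v])
  have "d \<le> 2 * (X - e)" if "0 \<le> q" "0 \<le> S2" "d \<le> S1" "e \<le> m" "m + S1 / 2 + S2 / 2 + q = X"
    for d e m q S1 S2 X :: real
    using that by (simp add: field_simps)
  from this[OF q0 S2 S1 m real_energy_mix(3)[OF s u v]]
  have "?d1 b \<le> 2 * ((1 - s) * real_energy u1 u2 + s * real_energy v u2 - real_energy u1 u2)" .
  also have "\<dots> = 2 * s * (real_energy v u2 - real_energy u1 u2)" by (simp add: algebra_simps)
  finally show ?thesis .
qed

section \<open>Directions of the mixed vector, and absence of zeros\<close>

text \<open>The limit, as s tends to 0, of the direction of \<open>mix_pair s u \<phi>\<close> where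
  the bump is positive. At a zero of \<open>u\<close> the bump alone decides and the direction is
  (0, 1). Thus the first component records the phase and the second the zero set.\<close>

definition polar_pair :: "(real^2 \<Rightarrow> complex) \<Rightarrow> real^2 \<Rightarrow> complex \<times> complex" where
  "polar_pair u x = (sgn (u x), if u x = 0 then 1 else 0)"

lemma polar_pair_measurable:
  assumes [measurable]: "u \<in> borel_measurable borel"
  shows "polar_pair u \<in> borel_measurable borel"
proof -
  have "polar_pair u = (\<lambda>x. (inverse (norm (u x)) *\<^sub>R u x, if u x = 0 then 1 else 0))"
    by (auto simp: polar_pair_def sgn_div_norm)
  also have "\<dots> \<in> borel_measurable borel" by measurable
  finally show ?thesis .
qed

lemma sgn_measurable:
  fixes f :: "'a::euclidean_space \<Rightarrow> 'b::euclidean_space"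
  assumes [measurable]: "f \<in> borel_measurable borel"
  shows "(\<lambda>x. sgn (f x)) \<in> borel_measurable borel"
  unfolding sgn_div_norm by measurable

lemma norm_polar_pair_le_1: "norm (polar_pair u x) \<le> 1"
  by (simp add: polar_pair_def norm_Pair norm_sgn)

text \<open>At a zero of \<open>u\<close> the sequence is constant; elsewhere the bump component has
  size of order sqrt s and disappears in the limit. The double \<open>Suc\<close> keeps s strictly
  between 0 and 1.\<close>

lemma sgn_mix_pair_tendsto:
  assumes f: "0 < \<phi> x"
  shows "(\<lambda>n. sgn (mix_pair (inverse (real (Suc (Suc n)))) u (\<lambda>x. complex_of_real (\<phi> x)) x)) \<longlonglongrightarrow> polar_pair u x"
proof (cases "u x = 0")
  case True
  have "sgn (mix_pair (inverse (real (Suc (Suc n)))) u (\<lambda>x. complex_of_real (\<phi> x)) x) = polar_pair u x" for n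
  proof -
    define y where "y = sqrt (inverse (real (Suc (Suc n)))) * \<phi> x"
    have y: "0 < y" using f by (simp add: y_def)
    have "mix_pair (inverse (real (Suc (Suc n)))) u (\<lambda>x. complex_of_real (\<phi> x)) x = (0, complex_of_real y)"
      using True by (simp add: mix_pair_def y_def scaleR_conv_of_real)
    moreover have "sgn (0 :: complex, complex_of_real y) = (0, 1)"
      using y by (simp add: sgn_div_norm norm_Pair scaleR_conv_of_real)
    ultimately show ?thesis using True by (simp add: polar_pair_def)
  qed
  then show ?thesis by simp
next
  case False
  have i: "(\<lambda>n. inverse (real (Suc (Suc n)))) \<longlonglongrightarrow> 0"
    using LIMSEQ_Suc[OF LIMSEQ_inverse_real_of_nat] by simp
  have "(\<lambda>n. mix_pair (inverse (real (Suc (Suc n)))) u (\<lambda>x. complex_of_real (\<phi> x)) x)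
      \<longlonglongrightarrow> (sqrt (1 - 0) *\<^sub>R u x, sqrt 0 *\<^sub>R complex_of_real (\<phi> x))"
    unfolding mix_pair_def by (intro tendsto_intros i)
  then have "(\<lambda>n. sgn (mix_pair (inverse (real (Suc (Suc n)))) u (\<lambda>x. complex_of_real (\<phi> x)) x))
      \<longlonglongrightarrow> sgn (u x, 0)"
    using False by (intro tendsto_sgn) (auto simp: zero_prod_def)
  moreover have "sgn (u x, 0::complex) = polar_pair u x"
    using False by (simp add: polar_pair_def sgn_div_norm norm_Pair)
  ultimately show ?thesis by simp
qed

text \<open>Mixing \<open>s\<close> of the bump \<open>\<phi>\<close> into the minimizer costs at most \<open>C s\<close>, whereas the defect dominates
  \<open>s \<phi>\<^sup>2\<close> times the squared differences of the directions \<open>sgn (mix_pair s u \<phi>)\<close>. So these are bounded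
  uniformly in \<open>s\<close>, and the bound survives \<open>s \<rightarrow> 0\<close>.\<close>

lemma polar_pair_difference_bound:
  assumes u: "admissible u1 u2" and min: "\<And>v1 v2. admissible v1 v2 \<Longrightarrow> real_energy u1 u2 \<le> real_energy v1 v2"
    and r: "0 < r" and T0: "0 < T0"
  obtains K where "0 \<le> K" "\<And>b T. b \<in> Basis \<Longrightarrow> 0 < T \<Longrightarrow> T \<le> T0 \<Longrightarrow>
    (LINT x|lborel. indicator (cube r) x * (norm (polar_pair u1 (x + T *\<^sub>R b) - polar_pair u1 x))\<^sup>2) \<le> K * T\<^sup>2"
proof -
  \<comment> \<open>Chaining enlarges the cube to \<open>r + T\<close>, one more step shorter than
    \<open>T0\<close> stays within \<open>r + 2 * T0\<close>, and the summand 1 puts that closed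
    cube inside the open box where the bump is positive.\<close>
  let ?R = "r + 2 * T0 + 1"
  have "box (- ?R *\<^sub>R One) (?R *\<^sub>R One :: real^2) \<noteq> {}" using r T0 by (simp add: box_ne_empty)
  then obtain \<phi> M where \<phi>: "test_function \<phi>" "\<And>x. x \<in> box (- ?R *\<^sub>R One) (?R *\<^sub>R One) \<Longrightarrow> 0 < \<phi> x"
    "\<And>x. 0 \<le> \<phi> x" "\<And>x. \<phi> x \<le> M" "state (\<lambda>x. complex_of_real (\<phi> x))"
    using bump_state by metis
  let ?\<phi> = "\<lambda>x. complex_of_real (\<phi> x)"
  let ?B = "cube (r + 2 * T0) :: (real^2) set"
  have B: "x \<in> ?B \<Longrightarrow> 0 < \<phi> x" for x
    by (rule \<phi>(2)) (fastforce simp: cube_def mem_box)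
  have "compact (\<phi> ` ?B)"
    using test_function_continuous[OF \<phi>(1)] unfolding cube_def
    by (meson compact_cbox compact_continuous_image continuous_on_subset subset_UNIV)
  moreover have "0 \<in> ?B" using r T0 by (auto simp: cube_def mem_box)
  then have "\<phi> ` ?B \<noteq> {}" by blast
  ultimately obtain x0 where x0: "x0 \<in> ?B" "\<And>x. x \<in> ?B \<Longrightarrow> \<phi> x0 \<le> \<phi> x"
    using compact_attains_inf[of "\<phi> ` ?B"] by auto
  define c where "c = \<phi> x0"
  have c: "0 < c" "\<And>x. x \<in> ?B \<Longrightarrow> c \<le> \<phi> x" using x0 B by (auto simp: c_def)
  have st: "state u1" "state u2" using u by (auto simp: admissible_def)
  note [measurable] = state_integral(4)[OF st(1)] state_integral(4)[OF \<phi>(5)]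
  have v: "admissible ?\<phi> u2"
    by (rule admissible_bounded_state[OF \<phi>(5,3,4) st(2) admissible_quartic(2)[OF u]])
  define C where "C = real_energy ?\<phi> u2 - real_energy u1 u2"
  have C: "0 \<le> C" using min[OF v] by (simp add: C_def)
  \<comment> \<open>The summand 1 makes the bound on the limiting defect strict even when
    \<open>C = 0\<close>, so that it holds for all sufficiently small steps.\<close>
  define K where "K = (2 * C + 1) / c\<^sup>2"
  have K: "0 \<le> K" using C by (simp add: K_def)
  have Ssq: "(LINT x|lborel. indicator (cube r) x * (norm (sgn (mix_pair s u1 ?\<phi> (x + T *\<^sub>R b)) - sgn (mix_pair s u1 ?\<phi> x)))\<^sup>2)
      \<le> K * T\<^sup>2" if s: "0 < s" "s < 1" and b: "b \<in> Basis" and T: "0 < T" "T \<le> T0" for s T b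
  proof -
    let ?p = "mix_pair s u1 ?\<phi>"
    let ?S = "\<lambda>x. sgn (?p x)"
    have pm[measurable]: "?p \<in> borel_measurable borel" by (rule mix_pair_measurable) measurable
    have Sm[measurable]: "?S \<in> borel_measurable borel" by (rule sgn_measurable) measurable
    have S1: "norm (?S x) \<le> 1" for x by (rule norm_sgn_le_1)
    have s': "0 \<le> s" "s \<le> 1" using s by auto
    have "((\<lambda>t. mix_defect b t s u1 ?\<phi>) \<longlongrightarrow> (1 - s) * dirichlet b u1 + s * dirichlet b ?\<phi> - dirichlet b (mix s u1 ?\<phi>)) (at_right 0)"
      by (rule mix_defect_tendsto[OF s' state_integral(2)[OF st(1)] state_integral(2)[OF \<phi>(5)] state_integral(3)[OF st(1)] state_integral(3)[OF \<phi>(5)] b])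
    moreover have "(1 - s) * dirichlet b u1 + s * dirichlet b ?\<phi> - dirichlet b (mix s u1 ?\<phi>) < s * (2 * C + 1)"
      using mix_defect_limit_le[OF u min v s' b] s(1) by (simp add: C_def algebra_simps)
    ultimately have "\<forall>\<^sub>F t in at_right 0. mix_defect b t s u1 ?\<phi> < s * (2 * C + 1)"
      by (rule order_tendstoD(2))
    moreover have "\<forall>\<^sub>F t in at_right 0. t < T0"
      using T0 by (auto simp: eventually_at_right_field intro!: exI[of _ T0])
    moreover have "\<forall>\<^sub>F t::real in at_right 0. 0 < t"
      by (rule eventually_at_right_less)
    ultimately have ev: "\<forall>\<^sub>F t in at_right 0. (LINT x|lborel. indicator (cube (r + T)) x * (norm (?S (x + t *\<^sub>R b) - ?S x))\<^sup>2) \<le> K * t\<^sup>2"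
    proof eventually_elim
      case (elim t)
      let ?I = "\<lambda>x. norm (?p (x + t *\<^sub>R b)) * norm (?p x) * (norm (?S (x + t *\<^sub>R b) - ?S x))\<^sup>2"
      have d4: "(norm (?S x - ?S y))\<^sup>2 \<le> 4" for x y
        using power_mono[OF order_trans[OF norm_triangle_ineq4[of "?S x" "?S y"] add_mono[OF S1[of x] S1[of y]]] norm_ge_zero, of 2] by simp
      have pL2: "(\<lambda>x. norm (?p x)) \<in> L2"
        using mix_L2[OF s' state_integral(2)[OF st(1)] state_integral(2)[OF \<phi>(5)]]
        unfolding mix_def[abs_def] L2_of_real .
      have iI: "integrable lborel ?I"
      proof (rule Bochner_Integration.integrable_bound)
        show "integrable lborel (\<lambda>x. 4 * (norm (?p (x + t *\<^sub>R b)) *\<^sub>R norm (?p x)))"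
          by (intro integrable_mult_right integrable_L2_mult[OF L2_translate[OF pL2] pL2])
        show "AE x in lborel. norm (?I x) \<le> norm (4 * (norm (?p (x + t *\<^sub>R b)) *\<^sub>R norm (?p x)))"
        proof (rule AE_I2)
          fix x
          have "norm (?p (x + t *\<^sub>R b)) * norm (?p x) * (norm (?S (x + t *\<^sub>R b) - ?S x))\<^sup>2 \<le> norm (?p (x + t *\<^sub>R b)) * norm (?p x) * 4"
            by (intro mult_left_mono d4) auto
          then show "norm (?I x) \<le> norm (4 * (norm (?p (x + t *\<^sub>R b)) *\<^sub>R norm (?p x)))"
            by (simp add: abs_mult mult_ac)
        qed
      qed measurable
      \<comment> \<open>The bump component alone bounds the mixed vector from below. Both endpoints
        together give the weight \<open>s * c\<^sup>2\<close>, and the s cancels against the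
        cost.\<close>
      have pl: "sqrt s * c \<le> norm (?p x)" if "x \<in> ?B" for x
      proof -
        have "sqrt s * c \<le> norm (sqrt s *\<^sub>R ?\<phi> x)" using c(2)[OF that] \<phi>(3)[of x] s by (simp add: mult_left_mono)
        also have "\<dots> = norm (snd (?p x))" by (simp add: mix_pair_def)
        also have "\<dots> \<le> norm (?p x)" by (rule norm_snd_component_le)
        finally show ?thesis .
      qed
      have "s * c\<^sup>2 * (LINT x|lborel. indicator (cube (r + T)) x * (norm (?S (x + t *\<^sub>R b) - ?S x))\<^sup>2)
          = (LINT x|lborel. s * c\<^sup>2 * (indicator (cube (r + T)) x * (norm (?S (x + t *\<^sub>R b) - ?S x))\<^sup>2))"
        by (rule integral_mult_right_zero[symmetric])
      also have "\<dots> \<le> (LINT x|lborel. ?I x)"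
      proof (rule integral_mono[OF _ iI])
        show "integrable lborel (\<lambda>x. s * c\<^sup>2 * (indicator (cube (r + T)) x * (norm (?S (x + t *\<^sub>R b) - ?S x))\<^sup>2))"
          by (intro integrable_mult_right integrable_cube[of _ 4]) (use d4 in auto)
        show "s * c\<^sup>2 * (indicator (cube (r + T)) x * (norm (?S (x + t *\<^sub>R b) - ?S x))\<^sup>2) \<le> ?I x" for x
        proof (cases "x \<in> cube (r + T)")
          case True
          have "x \<in> ?B" using True cube_mono[of "r + T" "r + 2 * T0"] T T0 by auto
          moreover have "x + t *\<^sub>R b \<in> cube (r + T + T0)" using True b elim by (intro cube_shift) auto
          then have "x + t *\<^sub>R b \<in> ?B" using cube_mono[of "r + T + T0" "r + 2 * T0"] T by auto
          ultimately have "(sqrt s * c) * (sqrt s * c) \<le> norm (?p (x + t *\<^sub>R b)) * norm (?p x)"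
            using pl c(1) s by (intro mult_mono) auto
          then have "s * c\<^sup>2 \<le> norm (?p (x + t *\<^sub>R b)) * norm (?p x)"
            using s by (simp add: power2_eq_square mult_ac)
          then show ?thesis using True by (simp add: mult_right_mono)
        qed simp
      qed
      also have "\<dots> = mix_defect b t s u1 ?\<phi> * t\<^sup>2" using elim by (simp add: mix_defect_def)
      also have "\<dots> \<le> s * (2 * C + 1) * t\<^sup>2" using elim by (intro mult_right_mono) auto
      also have "\<dots> = s * c\<^sup>2 * (K * t\<^sup>2)" using c(1) by (simp add: K_def)
      finally show ?case using s c(1) by simp
    qed
    obtain N where N: "(LINT x|lborel. indicator (cube (r + T)) x * (norm (?S (x + (T / real N) *\<^sub>R b) - ?S x))\<^sup>2) \<le> K * (T / real N)\<^sup>2" "0 < N"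
      using eventually_happens'[OF sequentially_bot eventually_divide_nat[OF ev T(1)]] by blast
    have "(LINT x|lborel. indicator (cube r) x * (norm (?S (x + T *\<^sub>R b) - ?S x))\<^sup>2)
        \<le> (real N)\<^sup>2 * (LINT x|lborel. indicator (cube (r + T)) x * (norm (?S (x + (T / N) *\<^sub>R b) - ?S x))\<^sup>2)"
      by (rule chain_L2[OF Sm S1 b T(1) N(2)])
    also have "\<dots> \<le> (real N)\<^sup>2 * (K * (T / real N)\<^sup>2)" by (intro mult_left_mono N) auto
    also have "\<dots> = K * T\<^sup>2" using N(2) by (simp add: power_divide)
    finally show ?thesis .
  qed
  show ?thesis
  proof (rule that[OF K])
    fix b :: "real^2" and T assume b: "b \<in> Basis" and T: "0 < T" "T \<le> T0"
    let ?s = "\<lambda>n. inverse (real (Suc (Suc n)))"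
    let ?S = "\<lambda>n x. sgn (mix_pair (?s n) u1 ?\<phi> x)"
    let ?f = "\<lambda>n x. indicator (cube r) x * (norm (?S n (x + T *\<^sub>R b) - ?S n x))\<^sup>2"
    have [measurable]: "?S n \<in> borel_measurable borel" for n
      by (intro sgn_measurable mix_pair_measurable) measurable
    have [measurable]: "polar_pair u1 \<in> borel_measurable borel" by (rule polar_pair_measurable) measurable
    have i: "integrable lborel (?f n)" for n
    proof (rule integrable_cube[of _ 4])
      show "\<bar>(norm (?S n (x + T *\<^sub>R b) - ?S n x))\<^sup>2\<bar> \<le> 4" for x
        using power_mono[OF order_trans[OF norm_triangle_ineq4 add_mono[OF norm_sgn_le_1 norm_sgn_le_1]] norm_ge_zero,
            of "mix_pair (?s n) u1 ?\<phi> (x + T *\<^sub>R b)" "mix_pair (?s n) u1 ?\<phi> x" 2] by simp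
    qed measurable
    have lim: "AE x in lborel. (\<lambda>n. ?f n x) \<longlonglongrightarrow> indicator (cube r) x * (norm (polar_pair u1 (x + T *\<^sub>R b) - polar_pair u1 x))\<^sup>2"
    proof (rule AE_I2)
      fix x
      show "(\<lambda>n. ?f n x) \<longlonglongrightarrow> indicator (cube r) x * (norm (polar_pair u1 (x + T *\<^sub>R b) - polar_pair u1 x))\<^sup>2"
      proof (cases "x \<in> cube r")
        case True
        have "x + T *\<^sub>R b \<in> cube (r + T0)" using True b T by (intro cube_shift) auto
        then have "0 < \<phi> (x + T *\<^sub>R b)" "0 < \<phi> x"
          using True B cube_mono[of "r + T0" "r + 2 * T0"] cube_mono[of r "r + 2 * T0"] T0 by auto
        then show ?thesis by (intro tendsto_intros sgn_mix_pair_tendsto)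
      qed simp
    qed
    have m: "(\<lambda>x. indicator (cube r) x * (norm (polar_pair u1 (x + T *\<^sub>R b) - polar_pair u1 x))\<^sup>2) \<in> borel_measurable lborel"
      by measurable
    have sn: "0 < ?s n" "?s n < 1" for n by (auto simp: inverse_less_1_iff)
    \<comment> \<open>The bound does not depend on s, so Fatou's lemma lets s tend to 0.\<close>
    show "(LINT x|lborel. indicator (cube r) x * (norm (polar_pair u1 (x + T *\<^sub>R b) - polar_pair u1 x))\<^sup>2) \<le> K * T\<^sup>2"
      by (rule Fatou_integrable(2)[OF i _ lim m Ssq[OF sn b T] tendsto_const]) auto
  qed
qed

text \<open>The indicator \<open>z\<close> of the zero set has differences equal in modulus to their
  squares, hence of L^1 size at most K t^2 on cubes. N steps of length T / N cost K T^2 / N, which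
  tends to 0, so \<open>z\<close> is translation invariant and constant; mass one rules out the
  value 1.\<close>

lemma minimizer_nonzero_AE:
  assumes u: "admissible u1 u2" and min: "\<And>v1 v2. admissible v1 v2 \<Longrightarrow> real_energy u1 u2 \<le> real_energy v1 v2"
  shows "AE x in lborel. u1 x \<noteq> 0"
proof -
  have st: "state u1" "state u2" using u by (auto simp: admissible_def)
  note [measurable] = state_integral(4)[OF st(1)]
  define z :: "real^2 \<Rightarrow> real" where "z = (\<lambda>x. if u1 x = 0 then 1 else 0)"
  have zm[measurable]: "z \<in> borel_measurable borel" unfolding z_def by measurable
  have z1: "norm (z x) \<le> 1" for x by (simp add: z_def)
  have inv: "AE x in lborel. z (x + T *\<^sub>R b) = z x" if b: "b \<in> Basis" and T: "0 < T" for b T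
  proof -
    have "AE x in lborel. norm (z (x + T *\<^sub>R b) - z x) = 0"
    proof (rule AE_zero_of_integral_cube[where M = 1])
      fix r :: real assume r: "0 < r"
      have rT: "0 < r + T" using r T by simp
      obtain K where K: "0 \<le> K" and K': "\<And>b t. b \<in> Basis \<Longrightarrow> 0 < t \<Longrightarrow> t \<le> T \<Longrightarrow>
        (LINT x|lborel. indicator (cube (r + T)) x * (norm (polar_pair u1 (x + t *\<^sub>R b) - polar_pair u1 x))\<^sup>2) \<le> K * t\<^sup>2"
        by (rule polar_pair_difference_bound[OF u min rT T]) blast+
      have "(LINT x|lborel. indicator (cube r) x * norm (z (x + T *\<^sub>R b) - z x)) \<le> K * T\<^sup>2 * inverse (real (Suc n))" for n
      proof -
        let ?N = "Suc n" and ?t = "T / real (Suc n)"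
        have t: "0 < ?t" "?t \<le> T" using T divide_left_mono[of 1 "real (Suc n)" T] by auto
        have "(LINT x|lborel. indicator (cube r) x * norm (z (x + T *\<^sub>R b) - z x))
            \<le> ?N * (LINT x|lborel. indicator (cube (r + T)) x * norm (z (x + ?t *\<^sub>R b) - z x))"
          by (rule chain_L1[OF zm z1 b T]) simp
        also have "\<dots> \<le> ?N * (LINT x|lborel. indicator (cube (r + T)) x * (norm (polar_pair u1 (x + ?t *\<^sub>R b) - polar_pair u1 x))\<^sup>2)"
        proof (rule mult_left_mono[OF integral_mono])
          show "integrable lborel (\<lambda>x. indicator (cube (r + T)) x * norm (z (x + ?t *\<^sub>R b) - z x))"
            by (rule integrable_cube[of _ 1]) (auto simp: z_def)
          have pm[measurable]: "polar_pair u1 \<in> borel_measurable borel" by (rule polar_pair_measurable) measurable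
          show "integrable lborel (\<lambda>x. indicator (cube (r + T)) x * (norm (polar_pair u1 (x + ?t *\<^sub>R b) - polar_pair u1 x))\<^sup>2)"
          proof (rule integrable_cube[of _ 4])
            show "\<bar>(norm (polar_pair u1 (x + ?t *\<^sub>R b) - polar_pair u1 x))\<^sup>2\<bar> \<le> 4" for x
              using power_mono[OF order_trans[OF norm_triangle_ineq4 add_mono[OF norm_polar_pair_le_1 norm_polar_pair_le_1]] norm_ge_zero,
                  of u1 "x + ?t *\<^sub>R b" u1 x 2] by simp
          qed measurable
          show "indicator (cube (r + T)) x * norm (z (x + ?t *\<^sub>R b) - z x)
              \<le> indicator (cube (r + T)) x * (norm (polar_pair u1 (x + ?t *\<^sub>R b) - polar_pair u1 x))\<^sup>2" for x
          proof (rule mult_left_mono)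
            have "norm (z (x + ?t *\<^sub>R b) - z x) = (norm (snd (polar_pair u1 (x + ?t *\<^sub>R b) - polar_pair u1 x)))\<^sup>2"
              by (simp add: z_def polar_pair_def)
            also have "\<dots> \<le> (norm (polar_pair u1 (x + ?t *\<^sub>R b) - polar_pair u1 x))\<^sup>2"
              by (intro power_mono norm_snd_component_le) auto
            finally show "norm (z (x + ?t *\<^sub>R b) - z x) \<le> (norm (polar_pair u1 (x + ?t *\<^sub>R b) - polar_pair u1 x))\<^sup>2" .
          qed simp
        qed simp
        also have "\<dots> \<le> ?N * (K * ?t\<^sup>2)" by (intro mult_left_mono K'[OF b] t) auto
        also have "\<dots> = K * T\<^sup>2 * inverse (real ?N)"
        proof -
          have "m * (K * (T / m)\<^sup>2) = K * T\<^sup>2 * inverse m" if "m \<noteq> 0" for m :: real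
            using that by (simp add: power2_eq_square field_simps)
          then show ?thesis by (metis of_nat_eq_0_iff nat.distinct(2))
        qed
        finally show ?thesis .
      qed
      moreover have "(\<lambda>n. K * T\<^sup>2 * inverse (real (Suc n))) \<longlonglongrightarrow> K * T\<^sup>2 * 0"
        by (intro tendsto_intros LIMSEQ_inverse_real_of_nat)
      ultimately show "(LINT x|lborel. indicator (cube r) x * norm (z (x + T *\<^sub>R b) - z x)) \<le> 0"
        by (auto intro: LIMSEQ_le_const)
    qed (auto simp: z_def)
    then show ?thesis by simp
  qed
  obtain c where c: "AE x in lborel. z x = c"
    using translation_invariant_const[OF zm inv] by blast
  show ?thesis
  proof (cases "c = 0")
    case True
    then show ?thesis using c by (auto simp: z_def elim: eventually_mono)
  next
    case False
    then have "AE x in lborel. (norm (u1 x))\<^sup>2 = 0"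
      using c by (auto simp: z_def elim!: eventually_mono split: if_splits)
    then have "(LINT x|lborel. (norm (u1 x))\<^sup>2) = (LINT x|(lborel :: (real^2) measure). 0)"
      by (intro integral_cong_AE) auto
    then show ?thesis using state_integral(1)[OF st(1)] by simp
  qed
qed

end

lemma norm_fst_component_le:
  fixes p :: "'a::real_normed_vector \<times> 'b::real_normed_vector"
  shows "norm (fst p) \<le> norm p"
  by (cases p) (simp add: norm_fst_le)

context gross_pitaevskii
begin

section \<open>Rigidity of the phase\<close>

text \<open>Where u is nonzero, x leaves the sets {|u| < 1 / n} eventually; dominated convergence on
  the cube makes their measure small.\<close>

lemma small_modulus_set:
  fixes u :: "real^2 \<Rightarrow> complex" and e :: real
  assumes u[measurable]: "u \<in> borel_measurable borel" and nz: "AE x in lborel. u x \<noteq> 0" and e: "0 < e"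
  obtains \<kappa> where "0 < \<kappa>" "(LINT x|lborel. indicator (cube r) x * indicator {x. norm (u x) < \<kappa>} x) \<le> e"
proof -
  let ?k = "\<lambda>n. inverse (real (Suc n))"
  have i: "integrable lborel (\<lambda>x. indicator (cube r :: (real^2) set) x * (1 :: real))"
    by (rule integrable_cube[of _ 1]) auto
  have "(\<lambda>n. LINT x|lborel. indicator (cube r) x * indicator {x. norm (u x) < ?k n} x) \<longlonglongrightarrow> (LINT x|(lborel :: (real^2) measure). (0::real))"
  proof (rule integral_dominated_convergence[where w = "\<lambda>x. indicator (cube r) x * 1"])
    show "AE x in lborel. (\<lambda>n. indicator (cube r) x * indicator {x. norm (u x) < ?k n} x) \<longlonglongrightarrow> (0::real)"
      using nz
    proof eventually_elim
      case (elim x)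
      have "\<forall>\<^sub>F n in sequentially. ?k n < norm (u x)"
        using LIMSEQ_inverse_real_of_nat by (rule order_tendstoD(2)) (use elim in simp)
      then have "\<forall>\<^sub>F n in sequentially. 0 = indicator (cube r) x * (indicator {x. norm (u x) < ?k n} x :: real)"
        by eventually_elim simp
      then show ?case by (rule Lim_transform_eventually[OF tendsto_const])
    qed
  qed (use i in \<open>auto split: split_indicator\<close>)
  then have "\<forall>\<^sub>F n in sequentially. (LINT x|lborel. indicator (cube r) x * indicator {x. norm (u x) < ?k n} x) < e"
    by (rule order_tendstoD(2)) (use e in simp)
  then obtain n where "(LINT x|lborel. indicator (cube r) x * indicator {x. norm (u x) < ?k n} x) < e"
    using eventually_happens'[OF sequentially_bot] by blast
  then show ?thesis using that[of "?k n"] by simp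
qed

text \<open>The inequality d <= d^2 / (2 t a) + a t / 2 is applied with a = \<alpha> where the
  weight \<open>w\<close> is at least \<kappa>, so that a factor w / \<kappa> may be inserted, and
  with a = \<beta> elsewhere. A small \<alpha> suits the bulk, a large \<beta> the exceptional set
  of small measure.\<close>

lemma AM_GM_split:
  fixes d w t \<alpha> \<beta> \<kappa> :: real
  assumes "0 \<le> d" "0 \<le> w" "0 < t" "0 < \<alpha>" "0 < \<beta>" "0 < \<kappa>"
  shows "d \<le> \<alpha> * t / 2 + w * d\<^sup>2 / (2 * t * \<alpha> * \<kappa>) + d\<^sup>2 / (2 * t * \<beta>) + (if w < \<kappa> then 1 else 0) * (\<beta> * t / 2)"
proof -
  have amgm: "d \<le> d\<^sup>2 / (2 * t * a) + a * t / 2" if "0 < a" for a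
  proof -
    have "0 \<le> (d - a * t)\<^sup>2" by simp
    then have "2 * t * a * d \<le> d\<^sup>2 + (a * t)\<^sup>2" by (simp add: power2_diff mult_ac)
    then show ?thesis using that assms(3) by (simp add: field_simps power2_eq_square)
  qed
  have n: "0 \<le> w * d\<^sup>2 / (2 * t * \<alpha> * \<kappa>)" "0 \<le> d\<^sup>2 / (2 * t * \<beta>)" "0 \<le> \<alpha> * t / 2"
    using assms by auto
  show ?thesis
  proof (cases "w < \<kappa>")
    case True
    then show ?thesis using amgm[OF assms(5)] n by simp
  next
    case False
    have "d\<^sup>2 / (2 * t * \<alpha>) * 1 \<le> d\<^sup>2 / (2 * t * \<alpha>) * (w / \<kappa>)"
      using False assms by (intro mult_left_mono) auto
    also have "\<dots> = w * d\<^sup>2 / (2 * t * \<alpha> * \<kappa>)" by simp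
    finally show ?thesis using amgm[OF assms(4)] n False by simp
  qed
qed

text \<open>Equality in \<open>\<integral>|\<nabla>|u||\<^sup>2 \<le> \<integral>|\<nabla>u|\<^sup>2\<close> makes the phase differences \<open>o(t)\<close> where \<open>|u|\<close> is bounded below;
  elsewhere they are \<open>O(t)\<close> in \<open>L\<^sup>2\<close> on a set of small measure. Summing over \<open>T / t\<close> steps, the phase
  does not change under any translation.\<close>

lemma minimizer_phase_constant:
  assumes u: "admissible u1 u2" and min: "\<And>v1 v2. admissible v1 v2 \<Longrightarrow> real_energy u1 u2 \<le> real_energy v1 v2"
  obtains c where "norm c = 1" "AE x in lborel. u1 x = c * complex_of_real (norm (u1 x))"
proof -
  have st: "state u1" "state u2" using u by (auto simp: admissible_def)
  note um[measurable] = state_integral(4)[OF st(1)]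
  have nz: "AE x in lborel. u1 x \<noteq> 0" by (rule minimizer_nonzero_AE[OF u min])
  let ?S = "\<lambda>x. sgn (u1 x)"
  have Sm[measurable]: "?S \<in> borel_measurable borel" by (rule sgn_measurable) measurable
  have S1: "norm (?S x) \<le> 1" for x by (rule norm_sgn_le_1)
  have S2: "norm (?S x - ?S y) \<le> 2" for x y
    using norm_triangle_ineq4[of "?S x" "?S y"] S1[of x] S1[of y] by linarith
  have S4: "(norm (?S x - ?S y))\<^sup>2 \<le> 4" for x y
    using power_mono[OF S2[of x y] norm_ge_zero, of 2] by simp
  let ?W = "\<lambda>t b x. norm (u1 (x + t *\<^sub>R b)) * norm (u1 x)"
  \<comment> \<open>A minimizer mixed with itself at \<open>s = 0\<close> becomes its modulus, and
    minimality forces the defect to tend to 0. This is stronger than the mere boundedness obtained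
    from the bump, but weighted by the moduli.\<close>
  have weighted: "\<forall>\<^sub>F t in at_right 0. (LINT x|lborel. ?W t b x * (norm (?S (x + t *\<^sub>R b) - ?S x))\<^sup>2) \<le> \<delta> * t\<^sup>2"
    if b: "b \<in> Basis" and \<delta>: "0 < \<delta>" for b \<delta>
  proof -
    have s: "0 \<le> (0::real)" "(0::real) \<le> 1" by auto
    have "((\<lambda>t. mix_defect b t 0 u1 u1) \<longlongrightarrow> (1 - 0) * dirichlet b u1 + 0 * dirichlet b u1 - dirichlet b (mix 0 u1 u1)) (at_right 0)"
      by (rule mix_defect_tendsto[OF s state_integral(2)[OF st(1)] state_integral(2)[OF st(1)] state_integral(3)[OF st(1)] state_integral(3)[OF st(1)] b])
    moreover have "(1 - 0) * dirichlet b u1 + 0 * dirichlet b u1 - dirichlet b (mix 0 u1 u1) < \<delta>"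
      using mix_defect_limit_le[OF u min u s b] \<delta> by simp
    ultimately have "\<forall>\<^sub>F t in at_right 0. mix_defect b t 0 u1 u1 < \<delta>"
      by (rule order_tendstoD(2))
    moreover have "\<forall>\<^sub>F t::real in at_right 0. 0 < t" by (rule eventually_at_right_less)
    ultimately show ?thesis
    proof eventually_elim
      case (elim t)
      have p: "norm (mix_pair 0 u1 u1 x) = norm (u1 x)" "sgn (mix_pair 0 u1 u1 x) = (sgn (u1 x), 0)" for x
        by (auto simp: mix_pair_def norm_Pair sgn_div_norm)
      have "norm (sgn (mix_pair 0 u1 u1 x) - sgn (mix_pair 0 u1 u1 y)) = norm (?S x - ?S y)" for x y
        by (simp add: p norm_Pair)
      then have "(LINT x|lborel. ?W t b x * (norm (?S (x + t *\<^sub>R b) - ?S x))\<^sup>2) = mix_defect b t 0 u1 u1 * t\<^sup>2"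
        using elim(2) by (simp add: mix_defect_def p(1))
      also have "\<dots> \<le> \<delta> * t\<^sup>2" using elim by (intro mult_right_mono) auto
      finally show ?case .
    qed
  qed
  have inv: "AE x in lborel. ?S (x + T *\<^sub>R b) = ?S x" if b: "b \<in> Basis" and T: "0 < T" for b T
  proof -
    have "AE x in lborel. norm (?S (x + T *\<^sub>R b) - ?S x) = 0"
    proof (rule AE_zero_of_integral_cube[where M = 2])
      fix r :: real assume r: "0 < r"
      have rT: "0 < r + T" using r T by simp
      obtain K where K: "0 \<le> K" and K': "\<And>b t. b \<in> Basis \<Longrightarrow> 0 < t \<Longrightarrow> t \<le> T \<Longrightarrow>
        (LINT x|lborel. indicator (cube (r + T)) x * (norm (polar_pair u1 (x + t *\<^sub>R b) - polar_pair u1 x))\<^sup>2) \<le> K * t\<^sup>2"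
        by (rule polar_pair_difference_bound[OF u min rT T]) blast+
      let ?B = "cube (r + T) :: (real^2) set"
      define V where "V = (LINT x|lborel. indicator ?B x * (1::real))"
      have V: "0 \<le> V" by (simp add: V_def)
      let ?X = "LINT x|lborel. indicator (cube r) x * norm (?S (x + T *\<^sub>R b) - ?S x)"
      have X: "?X \<le> T * (e * (V / 2 + K / 2 + 2))" if e: "0 < e" for e
      proof -
        \<comment> \<open>The exceptional set gets measure \<open>e\<^sup>2\<close> because it will
          be weighted by 1 / e. The cube is enlarged twice to contain also the shifted
          points.\<close>
        obtain \<kappa> where \<kappa>: "0 < \<kappa>" "(LINT x|lborel. indicator (cube (r + T + T)) x * indicator {x. norm (u1 x) < \<kappa>} x) \<le> e\<^sup>2"
          by (rule small_modulus_set[OF um nz, of "e\<^sup>2" "r + T + T"]) (use e in auto)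
        let ?L = "\<lambda>x. indicator {x. norm (u1 x) < \<kappa>} x :: real"
        have Lm[measurable]: "?L \<in> borel_measurable borel" by measurable
        \<comment> \<open>Chosen so that the weighted term, divided by
          \<open>2 * t * e * \<kappa>\<^sup>2\<close>, contributes at most
          \<open>t * e\<close>.\<close>
        have "0 < 2 * e * e * \<kappa>\<^sup>2" using e \<kappa> by simp
        from weighted[OF b this] obtain N :: nat where
          N: "(LINT x|lborel. ?W (T / N) b x * (norm (?S (x + (T / N) *\<^sub>R b) - ?S x))\<^sup>2) \<le> 2 * e * e * \<kappa>\<^sup>2 * (T / N)\<^sup>2" "0 < N"
          using eventually_happens'[OF sequentially_bot eventually_divide_nat[OF _ T]] by blast
        define t where "t = T / N"
        have t: "0 < t" "t \<le> T" "N * t = T"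
          using T N(2) divide_left_mono[of 1 "real N" T] by (auto simp: t_def)
        let ?d = "\<lambda>x. norm (?S (x + t *\<^sub>R b) - ?S x)" and ?w = "?W t b"
        have dm[measurable]: "?d \<in> borel_measurable borel" by measurable
        \<comment> \<open>The four terms of \<open>AM_GM_split\<close> for \<alpha> = e and \<beta>
          = 1 / e. Their integrals are at most \<open>e * t / 2 * V\<close>, \<open>t * e\<close>,
          \<open>e * t * K / 2\<close> and \<open>t * e\<close>: each is of order t, with a factor e
          that tends to 0 at the end.\<close>
        let ?R1 = "\<lambda>x. e * t / 2 * (indicator ?B x * 1)"
        let ?R2 = "\<lambda>x. 1 / (2 * t * e * \<kappa>\<^sup>2) * (?w x * (?d x)\<^sup>2)"
        let ?R3 = "\<lambda>x. e / (2 * t) * (indicator ?B x * (norm (polar_pair u1 (x + t *\<^sub>R b) - polar_pair u1 x))\<^sup>2)"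
        let ?R4 = "\<lambda>x. t / (2 * e) * (indicator ?B x * ?L x + indicator ?B x * ?L (x + t *\<^sub>R b))"
        have pm[measurable]: "polar_pair u1 \<in> borel_measurable borel" by (rule polar_pair_measurable) measurable
        have ir: "integrable lborel (\<lambda>x. indicator ?B x * (1::real))" by (rule integrable_cube[of _ 1]) auto
        have i2: "integrable lborel (\<lambda>x. ?w x * (?d x)\<^sup>2)"
        proof (rule Bochner_Integration.integrable_bound)
          have nL2: "(\<lambda>x. norm (u1 x)) \<in> L2"
            using state_integral(5)[OF st(1)] by (simp add: L2_def)
          show "integrable lborel (\<lambda>x. 4 * (norm (u1 (x + t *\<^sub>R b)) *\<^sub>R norm (u1 x)))"
            by (intro integrable_mult_right integrable_L2_mult[OF L2_translate[OF nL2] nL2])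
          show "AE x in lborel. norm (?w x * (?d x)\<^sup>2) \<le> norm (4 * (norm (u1 (x + t *\<^sub>R b)) *\<^sub>R norm (u1 x)))"
          proof (rule AE_I2)
            fix x
            have "?w x * (?d x)\<^sup>2 \<le> ?w x * 4" by (intro mult_left_mono S4) auto
            then show "norm (?w x * (?d x)\<^sup>2) \<le> norm (4 * (norm (u1 (x + t *\<^sub>R b)) *\<^sub>R norm (u1 x)))"
              by (simp add: abs_mult mult_ac)
          qed
        qed measurable
        have i3: "integrable lborel (\<lambda>x. indicator ?B x * (norm (polar_pair u1 (x + t *\<^sub>R b) - polar_pair u1 x))\<^sup>2)"
        proof (rule integrable_cube[of _ 4])
          show "\<bar>(norm (polar_pair u1 (x + t *\<^sub>R b) - polar_pair u1 x))\<^sup>2\<bar> \<le> 4" for x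
            using power_mono[OF order_trans[OF norm_triangle_ineq4 add_mono[OF norm_polar_pair_le_1 norm_polar_pair_le_1]] norm_ge_zero,
                of u1 "x + t *\<^sub>R b" u1 x 2] by simp
        qed measurable
        have i4: "integrable lborel (\<lambda>x. indicator ?B x * ?L x)" "integrable lborel (\<lambda>x. indicator ?B x * ?L (x + t *\<^sub>R b))"
          by (rule integrable_cube[of _ 1]; simp add: indicator_def)+
        have pw: "indicator ?B x * ?d x \<le> ?R1 x + ?R2 x + ?R3 x + ?R4 x" for x
        proof (cases "x \<in> ?B")
          case True
          have "?d x \<le> e * t / 2 + ?w x * (?d x)\<^sup>2 / (2 * t * e * \<kappa>\<^sup>2) + (?d x)\<^sup>2 / (2 * t * (1 / e))
              + (if ?w x < \<kappa>\<^sup>2 then 1 else 0) * ((1 / e) * t / 2)"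
            using t e \<kappa>(1) by (intro AM_GM_split) auto
          moreover have "(?d x)\<^sup>2 / (2 * t * (1 / e)) \<le> ?R3 x"
          proof -
            have "?d x = norm (fst (polar_pair u1 (x + t *\<^sub>R b) - polar_pair u1 x))"
              by (simp add: polar_pair_def)
            also have "\<dots> \<le> norm (polar_pair u1 (x + t *\<^sub>R b) - polar_pair u1 x)" by (rule norm_fst_component_le)
            finally have "(?d x)\<^sup>2 \<le> (norm (polar_pair u1 (x + t *\<^sub>R b) - polar_pair u1 x))\<^sup>2"
              by (rule power_mono) simp
            from mult_left_mono[OF this, of "e / (2 * t)"] show ?thesis
              using True e t by (simp add: mult.commute)
          qed
          moreover have "(if ?w x < \<kappa>\<^sup>2 then 1 else 0) * ((1 / e) * t / 2) \<le> ?R4 x"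
          proof -
            \<comment> \<open>If the product of the moduli at the two points is below
              \<open>\<kappa>\<^sup>2\<close>, one of them is below \<kappa>.\<close>
            have "(if ?w x < \<kappa>\<^sup>2 then 1 else 0) \<le> ?L x + ?L (x + t *\<^sub>R b)"
            proof (cases "?L x = 0 \<and> ?L (x + t *\<^sub>R b) = 0")
              case True
              then have "\<kappa> \<le> norm (u1 x)" "\<kappa> \<le> norm (u1 (x + t *\<^sub>R b))" by (auto simp: indicator_def split: if_splits)
              then have "\<kappa> * \<kappa> \<le> ?w x" using \<kappa>(1) by (intro mult_mono) auto
              then show ?thesis using True by (simp add: power2_eq_square)
            qed (auto simp: indicator_def)
            from mult_left_mono[OF this, of "t / (2 * e)"] show ?thesis
              using True e t by (simp add: mult.commute)
          qed
          ultimately show ?thesis using True by simp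
        next
          case False
          have "0 \<le> ?R2 x" using t e by simp
          then show ?thesis using False by simp
        qed
        have "(LINT x|lborel. indicator ?B x * ?d x) \<le> (LINT x|lborel. ?R1 x + ?R2 x + ?R3 x + ?R4 x)"
        proof (rule integral_mono[OF _ _ pw])
          show "integrable lborel (\<lambda>x. indicator ?B x * ?d x)"
            by (rule integrable_cube[of _ 2]) (use S2 in auto)
          show "integrable lborel (\<lambda>x. ?R1 x + ?R2 x + ?R3 x + ?R4 x)"
            by (intro Bochner_Integration.integrable_add integrable_mult_right ir i2 i3 i4)
        qed
        also have "\<dots> = (LINT x|lborel. ?R1 x) + (LINT x|lborel. ?R2 x) + (LINT x|lborel. ?R3 x) + (LINT x|lborel. ?R4 x)"
        proof -
          have "integrable lborel ?R1" "integrable lborel ?R2" "integrable lborel ?R3" "integrable lborel ?R4"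
            by (intro Bochner_Integration.integrable_add integrable_mult_right ir i2 i3 i4)+
          then show ?thesis by (simp only: Bochner_Integration.integral_add Bochner_Integration.integrable_add)
        qed
        also have "(LINT x|lborel. ?R1 x) = e * t / 2 * V" unfolding V_def by (rule integral_mult_right_zero)
        also have "(LINT x|lborel. ?R2 x) \<le> t * e"
        proof -
          have "(LINT x|lborel. ?R2 x) = 1 / (2 * t * e * \<kappa>\<^sup>2) * (LINT x|lborel. ?w x * (?d x)\<^sup>2)"
            by (rule integral_mult_right_zero)
          also have "\<dots> \<le> 1 / (2 * t * e * \<kappa>\<^sup>2) * (2 * e * e * \<kappa>\<^sup>2 * t\<^sup>2)"
            using N(1)[folded t_def] t(1) e by (intro mult_left_mono) auto
          also have "\<dots> = t * e" using t(1) e \<kappa>(1) by (simp add: power2_eq_square)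
          finally show ?thesis .
        qed
        also have "(LINT x|lborel. ?R3 x) \<le> e * t * K / 2"
        proof -
          have "(LINT x|lborel. ?R3 x) = e / (2 * t) * (LINT x|lborel. indicator ?B x * (norm (polar_pair u1 (x + t *\<^sub>R b) - polar_pair u1 x))\<^sup>2)"
            by (rule integral_mult_right_zero)
          also have "\<dots> \<le> e / (2 * t) * (K * t\<^sup>2)"
            using e t by (intro mult_left_mono K'[OF b]) auto
          also have "\<dots> = e * t * K / 2" using t(1) by (simp add: power2_eq_square)
          finally show ?thesis .
        qed
        also have "(LINT x|lborel. ?R4 x) \<le> t * e"
        proof -
          have l: "(LINT x|lborel. indicator ?B x * ?L (x + s *\<^sub>R b)) \<le> e\<^sup>2" if "0 \<le> s" "s \<le> T" for s
            using that b by (intro order_trans[OF integral_cube_shift[where M = 1] \<kappa>(2)]) (auto simp: indicator_def)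
          have "(LINT x|lborel. ?R4 x) = t / (2 * e) * (LINT x|lborel. indicator ?B x * ?L x + indicator ?B x * ?L (x + t *\<^sub>R b))"
            by (rule integral_mult_right_zero)
          also have "\<dots> = t / (2 * e) * ((LINT x|lborel. indicator ?B x * ?L x) + (LINT x|lborel. indicator ?B x * ?L (x + t *\<^sub>R b)))"
            using i4 by (simp only: Bochner_Integration.integral_add)
          also have "\<dots> \<le> t / (2 * e) * (e\<^sup>2 + e\<^sup>2)"
            using l[of 0] l[of t] t T e by (intro mult_left_mono add_mono) auto
          also have "\<dots> = t * e" using e by (simp add: power2_eq_square)
          finally show ?thesis .
        qed
        finally have "(LINT x|lborel. indicator ?B x * ?d x) \<le> e * t / 2 * V + t * e + e * t * K / 2 + t * e" by simp
        also have "\<dots> = t * (e * (V / 2 + K / 2 + 2))" by (simp add: field_simps)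
        finally have fin: "(LINT x|lborel. indicator ?B x * ?d x) \<le> t * (e * (V / 2 + K / 2 + 2))" .
        have "?X \<le> N * (LINT x|lborel. indicator ?B x * ?d x)"
          unfolding t_def by (rule chain_L1[OF Sm S1 b T N(2)])
        also have "\<dots> \<le> N * (t * (e * (V / 2 + K / 2 + 2)))" by (intro mult_left_mono fin) simp
        also have "\<dots> = T * (e * (V / 2 + K / 2 + 2))" using t(3) by (metis mult.assoc)
        finally show ?thesis .
      qed
      have "(\<lambda>n. T * (inverse (real (Suc n)) * (V / 2 + K / 2 + 2))) \<longlonglongrightarrow> T * (0 * (V / 2 + K / 2 + 2))"
        by (intro tendsto_intros LIMSEQ_inverse_real_of_nat)
      moreover have "?X \<le> T * (inverse (real (Suc n)) * (V / 2 + K / 2 + 2))" for n by (rule X) simp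
      ultimately show "?X \<le> 0" by (auto intro: LIMSEQ_le_const)
    qed (use S2 in auto)
    then show ?thesis by (auto elim: eventually_mono)
  qed
  obtain c where c: "AE x in lborel. ?S x = c"
    using translation_invariant_const[OF Sm inv] by blast
  have a: "AE x in lborel. norm c = 1 \<and> u1 x = c * complex_of_real (norm (u1 x))"
    using c nz
  proof eventually_elim
    case (elim x)
    then have "norm c = 1" by (auto simp: norm_sgn)
    moreover have "u1 x = norm (u1 x) *\<^sub>R sgn (u1 x)" using elim(2) by (simp add: sgn_div_norm)
    ultimately show ?case using elim by (simp add: scaleR_conv_of_real mult.commute)
  qed
  have "ae_filter (lborel :: (real^2) measure) \<noteq> bot"
    by (simp add: ae_filter_eq_bot_iff emeasure_lborel_UNIV)
  then have "norm c = 1" using eventually_happens'[OF _ a] by blast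
  moreover have "AE x in lborel. u1 x = c * complex_of_real (norm (u1 x))"
    using a by eventually_elim simp
  ultimately show ?thesis using that by blast
qed

end

subsection \<open>Invariance under rotations\<close>

text \<open>Lebesgue measure is determined by its values on boxes, and the preimage of a box is its
  image under the inverse map, which is again orthogonal.\<close>

lemma orthogonal_measure_preserving:
  fixes A :: "real^2 \<Rightarrow> real^2"
  assumes A: "orthogonal_transformation A"
  shows "A \<in> borel_measurable borel" "distr lborel borel A = lborel"
proof -
  have "linear A" using A orthogonal_transformation_linear by blast
  then have "continuous_on UNIV A" using linear_continuous_on linear_conv_bounded_linear by blast
  then show m: "A \<in> borel_measurable borel" by (rule borel_measurable_continuous_onI)
  obtain A' where A': "orthogonal_transformation A'" "\<And>x. A (A' x) = x" "\<And>x. A' (A x) = x"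
    using orthogonal_transformation_inv[OF A] orthogonal_transformation_bij[OF A]
    by (metis bij_inv_eq_iff)
  show "distr lborel borel A = lborel"
  proof (rule lborel_eqI[symmetric])
    fix l u :: "real^2" assume lu: "\<And>b. b \<in> Basis \<Longrightarrow> l \<bullet> b \<le> u \<bullet> b"
    have pre: "A -` box l u = A' ` box l u"
    proof (intro set_eqI iffI)
      fix x assume "x \<in> A -` box l u"
      then show "x \<in> A' ` box l u" using A'(3)[of x] by (metis imageI vimageD)
    qed (auto simp: A'(2))
    have s: "A' ` box l u \<in> sets borel"
      unfolding pre[symmetric] using measurable_sets[OF m, of "box l u"] by simp
    have lm: "box l u \<in> lmeasurable" by simp
    have "emeasure (distr lborel borel A) (box l u) = emeasure lborel (A' ` box l u)"
      using m by (simp add: emeasure_distr pre)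
    also have "\<dots> = emeasure lebesgue (A' ` box l u)"
      using s by (simp add: emeasure_completion)
    also have "\<dots> = ennreal (measure lebesgue (A' ` box l u))"
      using measurable_orthogonal_image[OF A'(1) lm] by (rule emeasure_eq_measure2)
    also have "\<dots> = ennreal (measure lebesgue (box l u))"
      by (simp add: measure_orthogonal_image[OF A'(1) lm])
    also have "\<dots> = emeasure lebesgue (box l u)"
      using lm by (rule emeasure_eq_measure2[symmetric])
    also have "\<dots> = emeasure lborel (box l u)"
      by (simp add: emeasure_completion)
    finally show "emeasure (distr lborel borel A) (box l u) = (\<Prod>b\<in>Basis. (u - l) \<bullet> b)"
      using emeasure_lborel_box[OF lu] by simp
  qed simp
qed

text \<open>Let r have the coordinates \<open>v\<close> and let r = A s. The inner sums are the
  coordinates of s, which has the same norm as r.\<close>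

lemma orthogonal_sum_square:
  fixes A :: "'a::euclidean_space \<Rightarrow> 'a" and v :: "'a \<Rightarrow> real"
  assumes A: "orthogonal_transformation A"
  shows "(\<Sum>b\<in>Basis. (\<Sum>c\<in>Basis. (A b \<bullet> c) * v c)\<^sup>2) = (\<Sum>c\<in>Basis. (v c)\<^sup>2)"
proof -
  define r where "r = (\<Sum>c\<in>Basis. v c *\<^sub>R c)"
  have rc: "r \<bullet> c = v c" if "c \<in> Basis" for c
    using that by (simp add: r_def inner_sum_left inner_Basis if_distrib cong: if_cong)
  obtain s where s: "A s = r" using orthogonal_transformation_surj[OF A] by (metis surj_def)
  have norm2: "(norm y)\<^sup>2 = (\<Sum>b\<in>Basis. (y \<bullet> b)\<^sup>2)" for y :: 'a
    using euclidean_inner[of y y] by (simp add: power2_norm_eq_inner power2_eq_square[of "y \<bullet> _"])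
  have "(\<Sum>c\<in>Basis. (A b \<bullet> c) * v c) = s \<bullet> b" for b
  proof -
    have "(\<Sum>c\<in>Basis. (A b \<bullet> c) * v c) = A b \<bullet> r" by (simp add: r_def inner_sum_right mult.commute)
    also have "\<dots> = b \<bullet> s" using A by (simp add: s[symmetric] orthogonal_transformation_def)
    finally show ?thesis by (simp add: inner_commute)
  qed
  then have "(\<Sum>b\<in>Basis. (\<Sum>c\<in>Basis. (A b \<bullet> c) * v c)\<^sup>2) = (norm s)\<^sup>2" by (simp add: norm2)
  also have "\<dots> = (norm r)\<^sup>2" using A by (simp add: s[symmetric] orthogonal_transformation_norm)
  also have "\<dots> = (\<Sum>c\<in>Basis. (v c)\<^sup>2)" by (simp add: norm2 rc)
  finally show ?thesis .
qed

context
  fixes A :: "real^2 \<Rightarrow> real^2"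
  assumes A: "orthogonal_transformation A"
begin

text \<open>The map is transferred to the test function: \<phi> is \<psi> composed with
  \<open>A\<close> for a test function \<psi>, whose classical chain rule is available, and a change
  of variables returns to the weak derivatives of \<open>u\<close>.\<close>

lemma has_weak_partial_rotate:
  fixes u :: "real^2 \<Rightarrow> complex"
  assumes u: "u \<in> L2" and v: "\<And>c. c \<in> Basis \<Longrightarrow> has_weak_partial c u (v c)" "\<And>c. c \<in> Basis \<Longrightarrow> v c \<in> L2"
    and b: "b \<in> Basis"
  shows "has_weak_partial b (\<lambda>x. u (A x)) (\<lambda>x. \<Sum>c\<in>Basis. (A b \<bullet> c) *\<^sub>R v c (A x))"
    "(\<lambda>x. \<Sum>c\<in>Basis. (A b \<bullet> c) *\<^sub>R v c (A x)) \<in> L2"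
proof -
  note mp = orthogonal_measure_preserving[OF A]
  have l: "linear A" using A orthogonal_transformation_linear by blast
  have "(\<lambda>x. \<Sum>c\<in>C. (A b \<bullet> c) *\<^sub>R v c (A x)) \<in> L2" if "finite C" "C \<subseteq> Basis" for C
    using that
  proof (induction C rule: finite_induct)
    case empty
    then show ?case by (simp add: L2_def)
  next
    case (insert c C)
    then show ?case using L2_add[OF L2_scaleR[OF L2_measure_preserving[OF mp v(2)[of c]], of "A b \<bullet> c"]] by simp
  qed
  then show w2: "(\<lambda>x. \<Sum>c\<in>Basis. (A b \<bullet> c) *\<^sub>R v c (A x)) \<in> L2" by simp
  obtain A' where A': "orthogonal_transformation A'" "\<And>x. A (A' x) = x" "\<And>x. A' (A x) = x"
    using orthogonal_transformation_inv[OF A] orthogonal_transformation_bij[OF A]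
    by (metis bij_inv_eq_iff)
  show "has_weak_partial b (\<lambda>x. u (A x)) (\<lambda>x. \<Sum>c\<in>Basis. (A b \<bullet> c) *\<^sub>R v c (A x))"
    unfolding has_weak_partial_def
  proof (intro conjI allI impI)
    show "locally_integrable (\<lambda>x. u (A x))"
      by (intro L2_imp_locally_integrable L2_measure_preserving[OF mp u])
    show "locally_integrable (\<lambda>x. \<Sum>c\<in>Basis. (A b \<bullet> c) *\<^sub>R v c (A x))"
      by (intro L2_imp_locally_integrable w2)
    fix \<phi> :: "real^2 \<Rightarrow> real" assume \<phi>: "test_function \<phi>"
    define \<psi> where "\<psi> = (\<lambda>y. \<phi> (0 + A' y))"
    have \<psi>: "test_function \<psi>" unfolding \<psi>_def using \<phi> A'(1) by (rule test_function_compose_affine)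
    have \<phi>\<psi>: "\<phi> = (\<lambda>x. \<psi> (0 + A x))" by (simp add: \<psi>_def A'(3))
    have d: "partial b \<phi> x = (\<Sum>c\<in>Basis. (A b \<bullet> c) * partial c \<psi> (A x))" for x
      unfolding \<phi>\<psi> using partial_compose_affine(1)[OF l test_function_differentiable[OF \<psi>], of b 0] by simp
    have i1: "integrable lborel (\<lambda>y. partial c \<psi> y *\<^sub>R u y)" if "c \<in> Basis" for c
      by (intro integrable_test_mult L2_imp_locally_integrable u test_function_partial \<psi> that)
    have i2: "integrable lborel (\<lambda>y. \<psi> y *\<^sub>R v c y)" if "c \<in> Basis" for c
      by (intro integrable_test_mult L2_imp_locally_integrable v(2) \<psi> that)
    note r1 = integrable_measure_preserving[OF mp i1] and r2 = integrable_measure_preserving[OF mp i2]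
    have "(LINT x|lborel. partial b \<phi> x *\<^sub>R u (A x))
        = (LINT x|lborel. (\<Sum>c\<in>Basis. (A b \<bullet> c) *\<^sub>R (partial c \<psi> (A x) *\<^sub>R u (A x))))"
      by (simp add: d scaleR_sum_left)
    also have "\<dots> = (\<Sum>c\<in>Basis. LINT x|lborel. (A b \<bullet> c) *\<^sub>R (partial c \<psi> (A x) *\<^sub>R u (A x)))"
      using r1 by (intro Bochner_Integration.integral_sum integrable_scaleR_right)
    also have "\<dots> = (\<Sum>c\<in>Basis. - (LINT x|lborel. (A b \<bullet> c) *\<^sub>R (\<psi> (A x) *\<^sub>R v c (A x))))"
    proof (rule sum.cong[OF refl])
      fix c :: "real^2" assume c: "c \<in> Basis"
      have "(LINT x|lborel. partial c \<psi> (A x) *\<^sub>R u (A x)) = - (LINT x|lborel. \<psi> (A x) *\<^sub>R v c (A x))"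
        using integral_measure_preserving[OF mp i1[OF c]] integral_measure_preserving[OF mp i2[OF c]] v(1)[OF c] \<psi>
        by (simp add: has_weak_partial_def)
      then show "(LINT x|lborel. (A b \<bullet> c) *\<^sub>R (partial c \<psi> (A x) *\<^sub>R u (A x)))
          = - (LINT x|lborel. (A b \<bullet> c) *\<^sub>R (\<psi> (A x) *\<^sub>R v c (A x)))"
        by (simp only: integral_scaleR_right scaleR_minus_right)
    qed
    also have "\<dots> = - (LINT x|lborel. (\<Sum>c\<in>Basis. (A b \<bullet> c) *\<^sub>R (\<psi> (A x) *\<^sub>R v c (A x))))"
    proof -
      have "(LINT x|lborel. (\<Sum>c\<in>Basis. (A b \<bullet> c) *\<^sub>R (\<psi> (A x) *\<^sub>R v c (A x))))
          = (\<Sum>c\<in>Basis. LINT x|lborel. (A b \<bullet> c) *\<^sub>R (\<psi> (A x) *\<^sub>R v c (A x)))"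
        using r2 by (intro Bochner_Integration.integral_sum integrable_scaleR_right)
      then show ?thesis by (simp only: sum_negf)
    qed
    also have "(\<lambda>x. \<Sum>c\<in>Basis. (A b \<bullet> c) *\<^sub>R (\<psi> (A x) *\<^sub>R v c (A x))) = (\<lambda>x. \<phi> x *\<^sub>R (\<Sum>c\<in>Basis. (A b \<bullet> c) *\<^sub>R v c (A x)))"
      by (simp add: \<phi>\<psi> scaleR_sum_right mult.commute)
    finally show "(LINT x|lborel. partial b \<phi> x *\<^sub>R u (A x))
        = - (LINT x|lborel. \<phi> x *\<^sub>R (\<Sum>c\<in>Basis. (A b \<bullet> c) *\<^sub>R v c (A x)))" .
  qed
qed

text \<open>The map mixes the directions, so the invariant quantity is the sum of the directional
  energies over the basis.\<close>

lemma H1_rotate: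
  fixes u :: "real^2 \<Rightarrow> complex"
  assumes u: "u \<in> H1"
  shows "(\<lambda>x. u (A x)) \<in> H1" "(\<Sum>b\<in>Basis. dirichlet b (\<lambda>x. u (A x))) = (\<Sum>b\<in>Basis. dirichlet b u)"
proof -
  note mp = orthogonal_measure_preserving[OF A]
  let ?v = "\<lambda>c. weak_partial c u"
  let ?w = "\<lambda>b x. \<Sum>c\<in>Basis. (A b \<bullet> c) *\<^sub>R ?v c (A x)"
  note w = has_weak_partial_rotate[OF H1_L2[OF u] H1_weak_partial[OF u]]
  show "(\<lambda>x. u (A x)) \<in> H1"
    using w L2_measure_preserving[OF mp H1_L2[OF u]] by (auto simp: H1_def)
  have pw: "(\<Sum>b\<in>Basis. (norm (?w b x))\<^sup>2) = (\<Sum>c\<in>Basis. (norm (?v c (A x)))\<^sup>2)" for x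
    unfolding cmod_power2 sum.distrib
    using orthogonal_sum_square[OF A, of "\<lambda>c. Re (?v c (A x))"] orthogonal_sum_square[OF A, of "\<lambda>c. Im (?v c (A x))"]
    by simp
  have "(\<Sum>b\<in>Basis. dirichlet b (\<lambda>x. u (A x))) = (\<Sum>b\<in>Basis. LINT x|lborel. (norm (?w b x))\<^sup>2)"
    by (intro sum.cong refl weak_partial_L2(2) w)
  also have "\<dots> = (LINT x|lborel. (\<Sum>b\<in>Basis. (norm (?w b x))\<^sup>2))"
    using L2_integrable[OF w(2)] by (intro Bochner_Integration.integral_sum[symmetric])
  also have "\<dots> = (LINT x|lborel. (\<Sum>c\<in>Basis. (norm (?v c (A x)))\<^sup>2))" unfolding pw ..
  also have "\<dots> = (LINT x|lborel. (\<Sum>c\<in>Basis. (norm (?v c x))\<^sup>2))"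
    using L2_integrable[OF H1_weak_partial(2)[OF u]]
    by (intro integral_measure_preserving[OF mp] Bochner_Integration.integrable_sum)
  also have "\<dots> = (\<Sum>c\<in>Basis. dirichlet c u)"
    unfolding dirichlet_def using L2_integrable[OF H1_weak_partial(2)[OF u]]
    by (intro Bochner_Integration.integral_sum)
  finally show "(\<Sum>b\<in>Basis. dirichlet b (\<lambda>x. u (A x))) = (\<Sum>b\<in>Basis. dirichlet b u)" .
qed

lemma state_rotate:
  assumes u: "state u"
  shows "state (\<lambda>x. u (A x))"
    "(LINT x|lborel. (norm x)\<^sup>2 * (norm (u (A x)))\<^sup>2) = (LINT x|lborel. (norm x)\<^sup>2 * (norm (u x))\<^sup>2)"
proof -
  note mp = orthogonal_measure_preserving[OF A]
  have n: "norm (A x) = norm x" for x using A by (simp add: orthogonal_transformation_norm)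
  note i = integrable_measure_preserving[OF mp state_integral(6)[OF u]] integral_measure_preserving[OF mp state_integral(6)[OF u]]
  show "(LINT x|lborel. (norm x)\<^sup>2 * (norm (u (A x)))\<^sup>2) = (LINT x|lborel. (norm x)\<^sup>2 * (norm (u x))\<^sup>2)"
    using i(2) by (simp add: n)
  have "L2_norm (\<lambda>x. u (A x)) = 1"
    using integral_measure_preserving[OF mp state_integral(5)[OF u]] state_integral(1)[OF u] by (simp add: L2_norm_def)
  then show "state (\<lambda>x. u (A x))"
    using i(1) H1_rotate(1)[OF state_integral(3)[OF u]] by (simp add: state_def n)
qed

end

lemma (in gross_pitaevskii) admissible_rotate:
  assumes A: "orthogonal_transformation A" and u: "admissible u1 u2"
  shows "admissible (\<lambda>x. u1 (A x)) (\<lambda>x. u2 (A x))"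
    "real_energy (\<lambda>x. u1 (A x)) (\<lambda>x. u2 (A x)) = real_energy u1 u2"
proof -
  have st: "state u1" "state u2" and i: "integrable lborel (inter u1 u2)" using u by (auto simp: admissible_def)
  note mp = orthogonal_measure_preserving[OF A]
  have e: "inter (\<lambda>x. u1 (A x)) (\<lambda>x. u2 (A x)) = (\<lambda>x. inter u1 u2 (A x))" by (auto simp: inter_def)
  show "admissible (\<lambda>x. u1 (A x)) (\<lambda>x. u2 (A x))"
    using state_rotate(1)[OF A] st integrable_measure_preserving[OF mp i] by (simp add: admissible_def e)
  show "real_energy (\<lambda>x. u1 (A x)) (\<lambda>x. u2 (A x)) = real_energy u1 u2"
    unfolding real_energy_def quadratic_energy_def e
    using H1_rotate(2)[OF A] state_rotate(2)[OF A] st state_integral(3) integral_measure_preserving[OF mp i] by simp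
qed

section \<open>Rotations of the plane and radial symmetry\<close>

definition rot :: "real \<Rightarrow> real^2 \<Rightarrow> real^2" where
  "rot a x = vector [cos a * x $ 1 - sin a * x $ 2, sin a * x $ 1 + cos a * x $ 2]"

lemma orthogonal_transformation_rot: "orthogonal_transformation (rot a)"
  unfolding orthogonal_transformation_def
proof
  show "linear (rot a)"
    by (rule linearI) (auto simp: rot_def vec_eq_iff forall_2 algebra_simps)
  show "\<forall>v w. rot a v \<bullet> rot a w = v \<bullet> w"
  proof (intro allI)
    fix v w :: "real^2"
    have "rot a v \<bullet> rot a w = ((sin a)\<^sup>2 + (cos a)\<^sup>2) * (v $ 1 * w $ 1 + v $ 2 * w $ 2)"
      by (simp add: rot_def inner_vec_def sum_2 power2_eq_square algebra_simps
          del: sin_cos_squared_add sin_cos_squared_add2 sin_cos_squared_add3)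
    then show "rot a v \<bullet> rot a w = v \<bullet> w" by (simp add: inner_vec_def sum_2)
  qed
qed

lemma rot_add: "rot a (rot b x) = rot (a + b) x"
  by (simp add: rot_def vec_eq_iff forall_2 cos_add sin_add algebra_simps)

lemma rot_polar: "\<exists>a. x = rot a (vector [norm x, 0])"
proof -
  let ?z = "Complex (x $ 1) (x $ 2)"
  have n: "cmod ?z = norm x"
    by (simp add: complex_norm norm_vec_def L2_set_def sum_2)
  have "?z = rcis (norm x) (Arg ?z)" using rcis_cmod_Arg[of ?z] by (simp only: n)
  then have "x $ 1 = norm x * cos (Arg ?z)" "x $ 2 = norm x * sin (Arg ?z)"
    by (metis complex.sel(1) Re_rcis, metis complex.sel(2) Im_rcis)
  then have "x = rot (Arg ?z) (vector [norm x, 0])"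
    by (simp add: rot_def vec_eq_iff forall_2 mult.commute)
  then show ?thesis ..
qed

lemma rot_measurable: "(\<lambda>p. rot (fst p) (snd p)) \<in> borel_measurable borel"
proof (rule borel_measurable_continuous_onI)
  have "rot a x = (cos a * x $ 1 - sin a * x $ 2) *\<^sub>R axis 1 1 + (sin a * x $ 1 + cos a * x $ 2) *\<^sub>R axis 2 1" for a x
    by (simp add: rot_def vec_eq_iff forall_2 axis_def)
  then show "continuous_on UNIV (\<lambda>p. rot (fst p) (snd p))"
    by (simp only:) (intro continuous_intros)
qed

text \<open>The exceptional null set depends on the angle. Fubini exchanges the quantifiers: for
  almost every x, the value u x is attained at almost every angle of the circle through x, so it is
  determined by the radius.\<close>

lemma radial_of_rotation_invariant:
  fixes u :: "real^2 \<Rightarrow> complex"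
  assumes u[measurable]: "u \<in> borel_measurable borel" and inv: "\<And>a. AE x in lborel. u (rot a x) = u x"
  shows "radial_ae u"
proof -
  have [measurable]: "(\<lambda>p. rot (fst p) (snd p)) \<in> borel_measurable (borel \<Otimes>\<^sub>M borel)"
    using rot_measurable by (simp add: borel_prod)
  have "AE a in (lborel :: real measure). AE x in lborel. u (rot a x) = u x" using inv by simp
  then have ae: "AE x in lborel. AE a in (lborel :: real measure). u (rot a x) = u x"
  proof (subst (asm) lborel_pair.AE_commute)
    show "{p \<in> space (lborel \<Otimes>\<^sub>M lborel). u (rot (fst p) (snd p)) = u (snd p)} \<in> sets (lborel \<Otimes>\<^sub>M lborel)"
      by measurable
  qed
  \<comment> \<open>Whenever such a value exists it is unique, since two almost sure values agree at
    a common angle.\<close>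
  define f where "f = (\<lambda>r. SOME c. AE a in (lborel :: real measure). u (rot a (vector [r, 0])) = c)"
  have "AE x in lborel. u x = f (norm x)"
    using ae
  proof eventually_elim
    case (elim x)
    obtain b where b: "x = rot b (vector [norm x, 0])" using rot_polar by blast
    have r: "rot a x = rot (a + b) (vector [norm x, 0])" for a
      by (subst b) (rule rot_add)
    have "AE a in (lborel :: real measure). u (rot (a + b) (vector [norm x, 0])) = u x"
      using elim unfolding r .
    from AE_translate[OF this, of "- b"]
    have 1: "AE a in (lborel :: real measure). u (rot a (vector [norm x, 0])) = u x" by simp
    then have 2: "AE a in (lborel :: real measure). u (rot a (vector [norm x, 0])) = f (norm x)"
      unfolding f_def by (rule someI)
    have "AE a in (lborel :: real measure). u x = f (norm x)"
      using 1 2 by eventually_elim simp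
    moreover have "ae_filter (lborel :: real measure) \<noteq> bot"
      by (simp add: ae_filter_eq_bot_iff emeasure_lborel_UNIV)
    ultimately show ?case using eventually_happens' by blast
  qed
  then show ?thesis unfolding radial_ae_def by blast
qed

subsection \<open>The positive minimizer\<close>

context gross_pitaevskii
begin

text \<open>Positivity and phase rigidity are proved for the first component; exchanging the
  components together with \<open>g1\<close> and \<open>g2\<close> transfers them to the second. For
  \<open>g1 = g2\<close> it shows that the exchanged pair is a minimizer too.\<close>

lemma swap_components:
  "gross_pitaevskii.admissible g2 g1 g u2 u1 \<longleftrightarrow> admissible u1 u2"
  "gross_pitaevskii.real_energy \<epsilon> g2 g1 g u2 u1 = real_energy u1 u2"
proof -
  interpret swap: gross_pitaevskii \<epsilon> g2 g1 g
    using pos det by unfold_locales (auto simp: mult.commute)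
  have "swap.inter u2 u1 = inter u1 u2"
    by (auto simp: swap.inter_def inter_def quad_def)
  then show "swap.admissible u2 u1 \<longleftrightarrow> admissible u1 u2" "swap.real_energy u2 u1 = real_energy u1 u2"
    by (auto simp: swap.admissible_def admissible_def swap.real_energy_def real_energy_def
        swap.quadratic_energy_def quadratic_energy_def)
qed

lemma minimizer_phases:
  assumes u: "admissible u1 u2" and min: "\<And>v1 v2. admissible v1 v2 \<Longrightarrow> real_energy u1 u2 \<le> real_energy v1 v2"
  shows "AE x in lborel. u1 x \<noteq> 0 \<and> u2 x \<noteq> 0"
    and "\<exists>\<alpha>1 \<alpha>2 :: real. (AE x in lborel. u1 x = exp (\<i> * of_real \<alpha>1) * complex_of_real (norm (u1 x)))
      \<and> (AE x in lborel. u2 x = exp (\<i> * of_real \<alpha>2) * complex_of_real (norm (u2 x)))"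
proof -
  interpret swap: gross_pitaevskii \<epsilon> g2 g1 g
    using pos det by unfold_locales (auto simp: mult.commute)
  have min': "swap.real_energy u2 u1 \<le> swap.real_energy v2 v1" if "swap.admissible v2 v1" for v1 v2
    using min that by (simp add: swap_components)
  have u': "swap.admissible u2 u1" using u by (simp add: swap_components)
  show "AE x in lborel. u1 x \<noteq> 0 \<and> u2 x \<noteq> 0"
  proof -
    have "AE x in lborel. u1 x \<noteq> 0" by (rule minimizer_nonzero_AE[OF u min])
    moreover have "AE x in lborel. u2 x \<noteq> 0" by (rule swap.minimizer_nonzero_AE[OF u' min'])
    ultimately show ?thesis by eventually_elim simp
  qed
  obtain c1 where c1: "norm c1 = 1" "AE x in lborel. u1 x = c1 * complex_of_real (norm (u1 x))"
    by (rule minimizer_phase_constant[OF u min]) blast+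
  obtain c2 where c2: "norm c2 = 1" "AE x in lborel. u2 x = c2 * complex_of_real (norm (u2 x))"
    by (rule swap.minimizer_phase_constant[OF u' min']) blast+
  obtain \<alpha>1 \<alpha>2 where "c1 = exp (\<i> * of_real \<alpha>1)" "c2 = exp (\<i> * of_real \<alpha>2)"
    using c1(1) c2(1) complex_norm_eq_1_exp by metis
  then show "\<exists>\<alpha>1 \<alpha>2 :: real. (AE x in lborel. u1 x = exp (\<i> * of_real \<alpha>1) * complex_of_real (norm (u1 x)))
      \<and> (AE x in lborel. u2 x = exp (\<i> * of_real \<alpha>2) * complex_of_real (norm (u2 x)))"
    using c1(2) c2(2) by blast
qed

text \<open>Every pair with minimal energy has the moduli \<open>w1\<close>, \<open>w2\<close> of
  the constructed minimizer. The claims result from applying this to different competitors: another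
  positive minimizer, a rotated pair, the exchanged pair when \<open>g1 = g2\<close>, and an
  arbitrary minimizer combined with constancy of its phases.\<close>

lemma positive_minimizer_characterization:
  "\<exists>\<eta>1 \<eta>2. positive_minimizer \<epsilon> g1 g2 g (\<eta>1, \<eta>2) \<and>
     (\<forall>\<xi>1 \<xi>2. positive_minimizer \<epsilon> g1 g2 g (\<xi>1, \<xi>2) \<longrightarrow>
        (AE x in lborel. \<xi>1 x = \<eta>1 x) \<and> (AE x in lborel. \<xi>2 x = \<eta>2 x)) \<and>
     radial_ae \<eta>1 \<and> radial_ae \<eta>2 \<and>
     (\<forall>u1 u2. minimizer \<epsilon> g1 g2 g (u1, u2) \<longrightarrow>
        (\<exists>\<alpha>1 \<alpha>2 :: real.
           (AE x in lborel. u1 x = exp (\<i> * of_real \<alpha>1) * \<eta>1 x) \<and>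
           (AE x in lborel. u2 x = exp (\<i> * of_real \<alpha>2) * \<eta>2 x))) \<and>
     (g1 = g2 \<longrightarrow> (AE x in lborel. \<eta>1 x = \<eta>2 x))"
proof -
  obtain w1 w2 where w0: "\<And>x. 0 \<le> w1 x" "\<And>x. 0 \<le> w2 x"
    and a: "admissible (\<lambda>x. complex_of_real (w1 x)) (\<lambda>x. complex_of_real (w2 x))"
    and min: "\<And>v1 v2. admissible v1 v2 \<Longrightarrow>
      real_energy (\<lambda>x. complex_of_real (w1 x)) (\<lambda>x. complex_of_real (w2 x)) \<le> real_energy v1 v2"
    using minimizer_exists by metis
  let ?n1 = "\<lambda>x. complex_of_real (w1 x)" and ?n2 = "\<lambda>x. complex_of_real (w2 x)"
  have "AE x in lborel. ?n1 x \<noteq> 0 \<and> ?n2 x \<noteq> 0" by (rule minimizer_phases(1)[OF a min])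
  then have w: "AE x in lborel. 0 < w1 x \<and> 0 < w2 x"
    by eventually_elim (use w0 in \<open>auto simp: less_le\<close>)
  have m: "minimizer \<epsilon> g1 g2 g (u1, u2) \<longleftrightarrow> admissible u1 u2 \<and> (\<forall>v1 v2. admissible v1 v2 \<longrightarrow> real_energy u1 u2 \<le> real_energy v1 v2)" for u1 u2
    by (rule minimizer_iff[OF a])
  have mod: "AE x in lborel. norm (u1 x) = w1 x \<and> norm (u2 x) = w2 x"
    if "admissible u1 u2" "real_energy u1 u2 \<le> real_energy ?n1 ?n2" for u1 u2
  proof -
    have eq: "real_energy u1 u2 = real_energy ?n1 ?n2" using that min by (simp add: antisym)
    have "AE x in lborel. norm (?n1 x) = norm (u1 x) \<and> norm (?n2 x) = norm (u2 x)"
      by (rule minimizers_same_modulus[OF a that(1) _ eq]) (rule min)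
    then show ?thesis by eventually_elim (use w0 in simp)
  qed
  have mod_min: "AE x in lborel. norm (u1 x) = w1 x \<and> norm (u2 x) = w2 x" if "minimizer \<epsilon> g1 g2 g (u1, u2)" for u1 u2
    using that a unfolding m by (intro mod) auto
  have "positive_minimizer \<epsilon> g1 g2 g (?n1, ?n2)"
    using a min w by (auto simp: positive_minimizer_def m positive_ae_def elim: eventually_mono)
  moreover have "(AE x in lborel. \<xi>1 x = ?n1 x) \<and> (AE x in lborel. \<xi>2 x = ?n2 x)"
    if "positive_minimizer \<epsilon> g1 g2 g (\<xi>1, \<xi>2)" for \<xi>1 \<xi>2
  proof -
    have p: "z = complex_of_real (norm z)" if "z \<in> \<real> \<and> 0 < Re z" for z
      using that by (auto simp: complex_is_Real_iff complex_eq_iff cmod_eq_Re)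
    have pp: "minimizer \<epsilon> g1 g2 g (\<xi>1, \<xi>2)" "AE x in lborel. \<xi>1 x \<in> \<real> \<and> 0 < Re (\<xi>1 x)" "AE x in lborel. \<xi>2 x \<in> \<real> \<and> 0 < Re (\<xi>2 x)"
      using that by (auto simp: positive_minimizer_def positive_ae_def)
    show ?thesis
    proof
      show "AE x in lborel. \<xi>1 x = ?n1 x"
        using mod_min[OF pp(1)] pp(2) by eventually_elim (use p in metis)
      show "AE x in lborel. \<xi>2 x = ?n2 x"
        using mod_min[OF pp(1)] pp(3) by eventually_elim (use p in metis)
    qed
  qed
  moreover have "radial_ae ?n1 \<and> radial_ae ?n2"
  proof -
    have "AE x in lborel. norm (?n1 (rot b x)) = w1 x \<and> norm (?n2 (rot b x)) = w2 x" for b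
      using admissible_rotate[OF orthogonal_transformation_rot a, of b] by (intro mod) auto
    then have "AE x in lborel. ?n1 (rot b x) = ?n1 x" "AE x in lborel. ?n2 (rot b x) = ?n2 x" for b
      using w0 by (auto elim!: eventually_mono)
    moreover have "?n1 \<in> borel_measurable borel" "?n2 \<in> borel_measurable borel"
      using a by (auto simp: admissible_def intro: state_integral(4))
    ultimately show ?thesis by (auto intro: radial_of_rotation_invariant)
  qed
  moreover have "\<exists>\<alpha>1 \<alpha>2 :: real. (AE x in lborel. u1 x = exp (\<i> * of_real \<alpha>1) * ?n1 x) \<and>
      (AE x in lborel. u2 x = exp (\<i> * of_real \<alpha>2) * ?n2 x)" if u: "minimizer \<epsilon> g1 g2 g (u1, u2)" for u1 u2
  proof -
    obtain \<alpha>1 \<alpha>2 :: real where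
      \<alpha>: "AE x in lborel. u1 x = exp (\<i> * of_real \<alpha>1) * complex_of_real (norm (u1 x))"
      "AE x in lborel. u2 x = exp (\<i> * of_real \<alpha>2) * complex_of_real (norm (u2 x))"
      using minimizer_phases(2)[of u1 u2] u unfolding m by blast
    have "AE x in lborel. u1 x = exp (\<i> * of_real \<alpha>1) * ?n1 x"
      using \<alpha>(1) mod_min[OF u] by eventually_elim simp
    moreover have "AE x in lborel. u2 x = exp (\<i> * of_real \<alpha>2) * ?n2 x"
      using \<alpha>(2) mod_min[OF u] by eventually_elim simp
    ultimately show ?thesis by blast
  qed
  moreover have "AE x in lborel. ?n1 x = ?n2 x" if eq: "g1 = g2"
  proof -
    have "admissible ?n2 ?n1" "real_energy ?n2 ?n1 = real_energy ?n1 ?n2"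
      using a swap_components[of ?n1 ?n2] by (simp_all add: eq)
    from mod[OF this(1)] this(2) have "AE x in lborel. norm (?n2 x) = w1 x \<and> norm (?n1 x) = w2 x" by simp
    then show ?thesis
    proof eventually_elim
      case (elim x)
      from conjunct1[OF this] have "w2 x = w1 x" using w0(2)[of x] by simp
      then show ?case by simp
    qed
  qed
  ultimately show ?thesis by blast
qed

end

theorem theorem1p3:
  fixes g1 g2 g \<epsilon> :: real
  assumes "g1 > 0" and "g2 > 0" and "g > 0" and "\<epsilon> > 0"
    and "g\<^sup>2 < g1 * g2"
  shows
    "(\<forall>l1 l2 \<eta> \<xi>. l1 > 0 \<longrightarrow> l2 > 0 \<longrightarrow>
        positive_solution \<epsilon> g1 g2 g l1 l2 \<eta> \<longrightarrow> positive_solution \<epsilon> g1 g2 g l1 l2 \<xi> \<longrightarrow> \<eta> = \<xi>) \<and>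
     (\<exists>\<eta>1 \<eta>2. positive_minimizer \<epsilon> g1 g2 g (\<eta>1, \<eta>2) \<and>
        (\<forall>\<xi>1 \<xi>2. positive_minimizer \<epsilon> g1 g2 g (\<xi>1, \<xi>2) \<longrightarrow>
           (AE x in lborel. \<xi>1 x = \<eta>1 x) \<and> (AE x in lborel. \<xi>2 x = \<eta>2 x)) \<and>
        radial_ae \<eta>1 \<and> radial_ae \<eta>2 \<and>
        (\<forall>u1 u2. minimizer \<epsilon> g1 g2 g (u1, u2) \<longrightarrow>
           (\<exists>\<alpha>1 \<alpha>2 :: real.
              (AE x in lborel. u1 x = exp (\<i> * of_real \<alpha>1) * \<eta>1 x) \<and>
              (AE x in lborel. u2 x = exp (\<i> * of_real \<alpha>2) * \<eta>2 x))) \<and>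
        (g1 = g2 \<longrightarrow> (AE x in lborel. \<eta>1 x = \<eta>2 x)))"
proof
  interpret gross_pitaevskii \<epsilon> g1 g2 g
    using assms by unfold_locales
  show "\<forall>l1 l2 \<eta> \<xi>. l1 > 0 \<longrightarrow> l2 > 0 \<longrightarrow>
      positive_solution \<epsilon> g1 g2 g l1 l2 \<eta> \<longrightarrow> positive_solution \<epsilon> g1 g2 g l1 l2 \<xi> \<longrightarrow> \<eta> = \<xi>"
    using positive_solution_unique[OF assms(1,2,4,5)] by (intro allI impI)
  show "\<exists>\<eta>1 \<eta>2. positive_minimizer \<epsilon> g1 g2 g (\<eta>1, \<eta>2) \<and>
        (\<forall>\<xi>1 \<xi>2. positive_minimizer \<epsilon> g1 g2 g (\<xi>1, \<xi>2) \<longrightarrow>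
           (AE x in lborel. \<xi>1 x = \<eta>1 x) \<and> (AE x in lborel. \<xi>2 x = \<eta>2 x)) \<and>
        radial_ae \<eta>1 \<and> radial_ae \<eta>2 \<and>
        (\<forall>u1 u2. minimizer \<epsilon> g1 g2 g (u1, u2) \<longrightarrow>
           (\<exists>\<alpha>1 \<alpha>2 :: real.
              (AE x in lborel. u1 x = exp (\<i> * of_real \<alpha>1) * \<eta>1 x) \<and>
              (AE x in lborel. u2 x = exp (\<i> * of_real \<alpha>2) * \<eta>2 x))) \<and>
        (g1 = g2 \<longrightarrow> (AE x in lborel. \<eta>1 x = \<eta>2 x))"
    by (rule positive_minimizer_characterization)
qed

end
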